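(* Let $f:\mathbb{R}^2\to\mathbb{R}$ be a polynomial function with $f(0,0)=0$ and with a strict local minimum at the origin $O$. Let $\Gamma=\Gamma(f,x):=\{(x,y)\in\mathbb{R}^2\mid \frac{\partial f}{\partial y}(x,y)=0\}$ be the polar curve of $f$ with respect to the vertical projection $x$, and let $\phi:\mathbb{R}^2_{x,y}\to\mathbb{R}^2_{x,z}$ be the map $\phi(x,y):=(x,f(x,y))$. Suppose that: (a) the polar curve $\Gamma$ is reduced; (b) the restriction of $\phi$ to the polar curve $\Gamma$ is a homeomorphism onto its image $\phi(\Gamma)$. Then the (generic) asymptotic Poincaré-Reeb tree of $f$ relative to $x$ is a complete binary tree (i.e. every internal vertex has exactly two children), such that the preorder defined by $x$ on its vertices is a total order which is strictly monotone on the geodesics starting from the root.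
   Context: For $\varepsilon>0$, $\mathcal{D}_\varepsilon$ is the connected component containing the origin $O$ of $f^{-1}([0,\varepsilon])$, and $\mathcal{C}_\varepsilon:=\mathcal{D}_\varepsilon\setminus\mathrm{Int}\,\mathcal{D}_\varepsilon$. For all sufficiently small $\varepsilon>0$, $\mathcal{D}_\varepsilon$ is a topological disk bounded by the smooth Jordan curve $\mathcal{C}_\varepsilon$. The polar curve is reduced if its equation $\frac{\partial f}{\partial y}$ has no factor of multiplicity greater than one. Poincaré-Reeb tree: let $\Pi:\mathbb{R}^2\to\mathbb{R}$, $\Pi(x,y)=x$. Call two points of $\mathcal{D}_\varepsilon$ equivalent if they lie in the same connected component of $\mathcal{D}_\varepsilon\cap\Pi^{-1}(x_0)$ for some $x_0$. The quotient of $\mathcal{D}_\varepsilon$ by this relation is a plane tree, the Poincaré-Reeb tree of $\mathcal{C}_\varepsilon$ with respect to $x$. Its root is the image of the origin, and its other vertices are the images of the points of $\mathcal{C}_\varepsilon$ at which the tangent line is vertical. The function $x$ descends to the quotient and induces a total preorder on the vertices. For all sufficiently small $\varepsilon>0$ the combinatorial type of this tree with its preorder does not depend on $\varepsilon$; it is called the asymptotic Poincaré-Reeb tree of $f$ relative to $x$. It is called generic if the vertical direction is generic with respect to $\mathcal{C}_\varepsilon$, i.e. $\mathcal{C}_\varepsilon$ has no vertical bitangent and no inflection point with vertical tangent. Children of a vertex are its neighbours in the tree that are farther from the root; an internal vertex is one having at least one child. *)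

theory Defs
  imports
    "HOL-Analysis.Analysis"
    "HOL-Computational_Algebra.Polynomial"
    "HOL-Computational_Algebra.Squarefree"
begin

section \<open>Polynomial functions on the plane and the polar curve\<close>

text \<open>
  An element of \<open>real poly poly\<close> is read as an element of \<open>\<real>[x][y]\<close>: the outer variable
  is \<open>y\<close> and the coefficients are polynomials in \<open>x\<close>. Hence \<open>pderiv\<close> is the partial
  derivative with respect to \<open>y\<close>; see \<open>deriv_plane_poly_fun\<close> below.
\<close>

definition plane_poly_fun :: "real poly poly \<Rightarrow> real \<times> real \<Rightarrow> real" where
  "plane_poly_fun F = (\<lambda>(x, y). poly (poly F [:y:]) x)"

definition polar_curve :: "(real \<times> real \<Rightarrow> real) \<Rightarrow> (real \<times> real) set" where
  "polar_curve f = {(x, y). deriv (\<lambda>t. f (x, t)) y = 0}"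

lemma has_derivative_plane_poly_fun:
  "((\<lambda>t. plane_poly_fun F (x, t)) has_real_derivative plane_poly_fun (pderiv F) (x, y)) (at y)"
proof (induction F)
  case 0
  show ?case by (simp add: plane_poly_fun_def)
next
  case (pCons a F)
  have "((\<lambda>t. poly a x + t * plane_poly_fun F (x, t)) has_real_derivative
          plane_poly_fun F (x, y) + y * plane_poly_fun (pderiv F) (x, y)) (at y)"
    by (auto intro!: derivative_eq_intros pCons.IH)
  then show ?case by (simp add: plane_poly_fun_def pderiv_pCons)
qed

lemma deriv_plane_poly_fun:
  "deriv (\<lambda>t. plane_poly_fun F (x, t)) y = plane_poly_fun (pderiv F) (x, y)"
  by (rule DERIV_imp_deriv) (rule has_derivative_plane_poly_fun)

lemma polar_curve_plane_poly_fun: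
  "polar_curve (plane_poly_fun F) = {p. plane_poly_fun (pderiv F) p = 0}"
  by (auto simp: polar_curve_def deriv_plane_poly_fun)

definition strict_local_minimum :: "('a::topological_space \<Rightarrow> real) \<Rightarrow> 'a \<Rightarrow> bool" where
  "strict_local_minimum f a \<longleftrightarrow> (\<forall>\<^sub>F p in at a. f a < f p)"


section \<open>Level disks and level curves\<close>

definition level_disk :: "(real \<times> real \<Rightarrow> real) \<Rightarrow> real \<Rightarrow> (real \<times> real) set" where
  "level_disk f \<epsilon> = connected_component_set (f -` {0..\<epsilon>}) (0, 0)"

definition boundary_curve :: "(real \<times> real) set \<Rightarrow> (real \<times> real) set" where
  "boundary_curve D = D - interior D"


section \<open>Tangency with vertical lines\<close>

text \<open>Velocities at \<open>p\<close> of curves contained in \<open>C\<close>. If \<open>C\<close> is a smooth curve, these form its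
  tangent line at \<open>p\<close>, seen as a vector line.\<close>

definition tangent_vector :: "(real \<times> real) set \<Rightarrow> real \<times> real \<Rightarrow> real \<times> real \<Rightarrow> bool" where
  "tangent_vector C p v \<longleftrightarrow>
     (\<exists>\<gamma>. \<gamma> 0 = p \<and> (\<forall>\<^sub>F t in nhds (0::real). \<gamma> t \<in> C) \<and> (\<gamma> has_vector_derivative v) (at 0))"

definition vertical_tangent_points :: "(real \<times> real) set \<Rightarrow> (real \<times> real) set" where
  "vertical_tangent_points C = {p \<in> C. tangent_vector C p (0, 1)}"

text \<open>At an inflection point the contact of the curve with its tangent line has order at least
  three, that is, the curvature vanishes: the distance from a point \<open>q\<close> of \<open>C\<close> to the tangent
  line at \<open>p\<close> is negligible compared to the square of the distance from \<open>q\<close> to \<open>p\<close>. No change of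
  side is required, so undulation points (contact of even order) are included.\<close>

definition inflection_point :: "(real \<times> real) set \<Rightarrow> real \<times> real \<Rightarrow> bool" where
  "inflection_point C p \<longleftrightarrow> p \<in> C \<and>
     (\<exists>v. v \<noteq> 0 \<and> tangent_vector C p v \<and>
        ((\<lambda>q. (fst v * snd (q - p) - snd v * fst (q - p)) / (dist q p)\<^sup>2) \<longlongrightarrow> 0) (at p within C))"

definition has_vertical_bitangent :: "(real \<times> real) set \<Rightarrow> bool" where
  "has_vertical_bitangent C \<longleftrightarrow>
     (\<exists>p \<in> vertical_tangent_points C. \<exists>q \<in> vertical_tangent_points C. p \<noteq> q \<and> fst p = fst q)"

definition vertical_generic :: "(real \<times> real) set \<Rightarrow> bool" where
  "vertical_generic C \<longleftrightarrow>
     \<not> has_vertical_bitangent C \<and> (\<forall>p \<in> vertical_tangent_points C. \<not> inflection_point C p)"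


section \<open>Rooted plane trees with a preorder on the vertices\<close>

text \<open>
  Besides the root and the symmetric adjacency relation \<open>pt_edges\<close>, the structure records a
  preorder \<open>pt_preorder\<close> on the vertices and the plane embedding. The latter is encoded by the
  triples \<open>(v, u, w)\<close> in \<open>pt_below\<close>, meaning that the edges from \<open>v\<close> to \<open>u\<close> and from \<open>v\<close> to \<open>w\<close>
  leave \<open>v\<close> on the same side (left or right), the first one lying below the second one. For a
  Poincare-Reeb tree this together with the preorder determines the cyclic order of the edges
  around each vertex.
\<close>

record 'v plane_tree =
  pt_verts :: "'v set"
  pt_root :: 'v
  pt_edges :: "'v rel"
  pt_preorder :: "'v rel"
  pt_below :: "('v \<times> 'v \<times> 'v) set"

definition pt_isomorphism :: "('v \<Rightarrow> 'w) \<Rightarrow> 'v plane_tree \<Rightarrow> 'w plane_tree \<Rightarrow> bool" where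
  "pt_isomorphism h S T \<longleftrightarrow>
     bij_betw h (pt_verts S) (pt_verts T) \<and>
     h (pt_root S) = pt_root T \<and>
     (\<forall>u \<in> pt_verts S. \<forall>v \<in> pt_verts S.
        ((u, v) \<in> pt_edges S \<longleftrightarrow> (h u, h v) \<in> pt_edges T) \<and>
        ((u, v) \<in> pt_preorder S \<longleftrightarrow> (h u, h v) \<in> pt_preorder T) \<and>
        (\<forall>w \<in> pt_verts S. (u, v, w) \<in> pt_below S \<longleftrightarrow> (h u, h v, h w) \<in> pt_below T))"

definition pt_isomorphic :: "'v plane_tree \<Rightarrow> 'w plane_tree \<Rightarrow> bool" where
  "pt_isomorphic S T \<longleftrightarrow> pt_root S \<in> pt_verts S \<and> (\<exists>h. pt_isomorphism h S T)"

definition pt_path :: "'v plane_tree \<Rightarrow> 'v list \<Rightarrow> bool" where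
  "pt_path T p \<longleftrightarrow> p \<noteq> [] \<and> set p \<subseteq> pt_verts T \<and> distinct p \<and>
     successively (\<lambda>u v. (u, v) \<in> pt_edges T) p"

definition is_tree :: "'v plane_tree \<Rightarrow> bool" where
  "is_tree T \<longleftrightarrow>
     finite (pt_verts T) \<and> pt_root T \<in> pt_verts T \<and>
     pt_edges T \<subseteq> pt_verts T \<times> pt_verts T \<and> sym (pt_edges T) \<and> irrefl (pt_edges T) \<and>
     (\<forall>u \<in> pt_verts T. \<forall>v \<in> pt_verts T. \<exists>!p. pt_path T p \<and> hd p = u \<and> last p = v)"

definition pt_dist :: "'v plane_tree \<Rightarrow> 'v \<Rightarrow> 'v \<Rightarrow> nat" where
  "pt_dist T u v = (LEAST n. \<exists>p. pt_path T p \<and> hd p = u \<and> last p = v \<and> length p = Suc n)"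

definition pt_children :: "'v plane_tree \<Rightarrow> 'v \<Rightarrow> 'v set" where
  "pt_children T v =
     {u. (v, u) \<in> pt_edges T \<and> pt_dist T (pt_root T) v < pt_dist T (pt_root T) u}"

definition complete_binary_tree :: "'v plane_tree \<Rightarrow> bool" where
  "complete_binary_tree T \<longleftrightarrow> is_tree T \<and>
     (\<forall>v \<in> pt_verts T. pt_children T v \<noteq> {} \<longrightarrow> card (pt_children T v) = 2)"

definition pt_less :: "'v plane_tree \<Rightarrow> 'v \<Rightarrow> 'v \<Rightarrow> bool" where
  "pt_less T u v \<longleftrightarrow> (u, v) \<in> pt_preorder T \<and> (v, u) \<notin> pt_preorder T"

text \<open>The geodesics of a tree are its simple paths. Some of those starting from the root may be
  increasing and others decreasing.\<close>

definition strictly_monotone_on_root_geodesics :: "'v plane_tree \<Rightarrow> bool" where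
  "strictly_monotone_on_root_geodesics T \<longleftrightarrow>
     (\<forall>p. pt_path T p \<and> hd p = pt_root T \<longrightarrow>
        sorted_wrt (pt_less T) p \<or> sorted_wrt (\<lambda>u v. pt_less T v u) p)"


section \<open>Poincare-Reeb trees\<close>

definition PR_rel :: "(real \<times> real) set \<Rightarrow> (real \<times> real) rel" where
  "PR_rel D = {(p, q). \<exists>x\<^sub>0. connected_component (D \<inter> fst -` {x\<^sub>0}) p q}"

definition PR_class :: "(real \<times> real) set \<Rightarrow> real \<times> real \<Rightarrow> (real \<times> real) set" where
  "PR_class D p = PR_rel D `` {p}"

text \<open>The quotient topology on \<open>D // PR_rel D\<close>; the preimage in \<open>D\<close> of a set \<open>U\<close> of classes is
  \<open>\<Union>U\<close>. See \<open>quotient_map_PR_class\<close>.\<close>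

definition PR_space :: "(real \<times> real) set \<Rightarrow> (real \<times> real) set topology" where
  "PR_space D = topology (\<lambda>U. U \<subseteq> D // PR_rel D \<and> openin (top_of_set D) (\<Union>U))"

definition PR_abscissa :: "(real \<times> real) set \<Rightarrow> real" where
  "PR_abscissa A = (THE x\<^sub>0. \<forall>p \<in> A. fst p = x\<^sub>0)"

definition PR_verts :: "(real \<times> real) set \<Rightarrow> (real \<times> real) set set" where
  "PR_verts D =
     insert (PR_class D (0, 0)) (PR_class D ` vertical_tangent_points (boundary_curve D))"

text \<open>\<open>g\<close> parametrizes an edge from \<open>u\<close> to \<open>v\<close>: an arc of the quotient space which meets the set
  of vertices exactly at its two end points.\<close>

definition PR_edge ::
    "(real \<times> real) set \<Rightarrow> (real \<times> real) set \<Rightarrow> (real \<times> real) set \<Rightarrow> (real \<Rightarrow> (real \<times> real) set) \<Rightarrow> bool"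
  where
  "PR_edge D u v g \<longleftrightarrow> u \<in> PR_verts D \<and> v \<in> PR_verts D \<and>
     pathin (PR_space D) g \<and> inj_on g {0..1} \<and> g 0 = u \<and> g 1 = v \<and>
     g ` {0<..<1} \<inter> PR_verts D = {}"

definition PR_lies_below :: "(real \<times> real) set \<Rightarrow> (real \<times> real) set \<Rightarrow> bool" where
  "PR_lies_below A B \<longleftrightarrow> (\<forall>p \<in> A. \<forall>q \<in> B. fst p = fst q \<and> snd p < snd q)"

definition PR_tree :: "(real \<times> real) set \<Rightarrow> (real \<times> real) set plane_tree" where
  "PR_tree D =
     \<lparr> pt_verts = PR_verts D,
       pt_root = PR_class D (0, 0),
       pt_edges = {(u, v). \<exists>g. PR_edge D u v g},
       pt_preorder = {(u, v). u \<in> PR_verts D \<and> v \<in> PR_verts D \<and> PR_abscissa u \<le> PR_abscissa v},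
       pt_below = {(v, u, w). \<exists>g h. PR_edge D v u g \<and> PR_edge D v w h \<and>
                     (\<exists>s \<in> {0<..<1}. \<exists>t \<in> {0<..<1}. PR_lies_below (g s) (h t))} \<rparr>"

text \<open>The asymptotic tree is a combinatorial type, so it is given by any representative, which
  is unique up to isomorphism: see \<open>asymptotic_PR_tree_unique\<close>.\<close>

definition asymptotic_PR_tree :: "(real \<times> real \<Rightarrow> real) \<Rightarrow> 'v plane_tree \<Rightarrow> bool" where
  "asymptotic_PR_tree f T \<longleftrightarrow>
     (\<forall>\<^sub>F \<epsilon> in at_right 0. pt_isomorphic (PR_tree (level_disk f \<epsilon>)) T)"

definition asymptotically_generic :: "(real \<times> real \<Rightarrow> real) \<Rightarrow> bool" where
  "asymptotically_generic f \<longleftrightarrow>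
     (\<forall>\<^sub>F \<epsilon> in at_right 0. vertical_generic (boundary_curve (level_disk f \<epsilon>)))"


subsection \<open>Well-definedness\<close>

lemma PR_rel_iff:
  "(p, q) \<in> PR_rel D \<longleftrightarrow> connected_component (D \<inter> fst -` {fst p}) p q"
proof
  assume "(p, q) \<in> PR_rel D"
  then obtain x\<^sub>0 where *: "connected_component (D \<inter> fst -` {x\<^sub>0}) p q"
    unfolding PR_rel_def by blast
  from connected_component_in[OF *] have "fst p = x\<^sub>0" by simp
  with * show "connected_component (D \<inter> fst -` {fst p}) p q" by simp
qed (unfold PR_rel_def, blast)

lemma equiv_PR_rel: "equiv D (PR_rel D)"
proof (rule equivI)
  show "PR_rel D \<subseteq> D \<times> D"
    by (auto simp: PR_rel_def dest: connected_component_in)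
  show "refl_on D (PR_rel D)"
    by (auto simp: refl_on_def PR_rel_iff connected_component_refl_eq)
  show "sym (PR_rel D)"
    by (auto simp: sym_def PR_rel_def dest: connected_component_sym)
  show "trans (PR_rel D)"
    unfolding trans_def
  proof (intro allI impI)
    fix p q r assume *: "(p, q) \<in> PR_rel D" "(q, r) \<in> PR_rel D"
    then have "connected_component (D \<inter> fst -` {fst p}) p q"
      by (simp add: PR_rel_iff)
    moreover from this have "fst q = fst p"
      by (auto dest: connected_component_in)
    ultimately show "(p, r) \<in> PR_rel D"
      using * by (auto simp: PR_rel_iff intro: connected_component_trans)
  qed
qed

lemma PR_abscissa_class: "p \<in> D \<Longrightarrow> PR_abscissa (PR_class D p) = fst p"
proof -
  assume "p \<in> D"
  then have "p \<in> PR_class D p"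
    using equiv_class_self[OF equiv_PR_rel] by (auto simp: PR_class_def)
  moreover have "\<forall>q \<in> PR_class D p. fst q = fst p"
  proof
    fix q assume "q \<in> PR_class D p"
    then have "connected_component (D \<inter> fst -` {fst p}) p q"
      by (simp add: PR_class_def PR_rel_iff)
    from connected_component_in[OF this] show "fst q = fst p" by simp
  qed
  ultimately show ?thesis
    unfolding PR_abscissa_def by (intro the_equality) (assumption, metis)
qed

lemma openin_PR_space:
  "openin (PR_space D) U \<longleftrightarrow> U \<subseteq> D // PR_rel D \<and> openin (top_of_set D) (\<Union>U)"
proof -
  have "istopology (\<lambda>U. U \<subseteq> D // PR_rel D \<and> openin (top_of_set D) (\<Union>U))"
    unfolding istopology_def
  proof (intro conjI allI impI)
    fix S T
    assume S: "S \<subseteq> D // PR_rel D \<and> openin (top_of_set D) (\<Union>S)"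
      and T: "T \<subseteq> D // PR_rel D \<and> openin (top_of_set D) (\<Union>T)"
    have "\<Union>(S \<inter> T) = \<Union>S \<inter> \<Union>T"
    proof
      show "\<Union>S \<inter> \<Union>T \<subseteq> \<Union>(S \<inter> T)"
      proof
        fix p assume "p \<in> \<Union>S \<inter> \<Union>T"
        then obtain A B where "A \<in> S" "B \<in> T" "p \<in> A" "p \<in> B" by blast
        moreover from this have "A = B"
          using S T quotient_disj[OF equiv_PR_rel, of A D B] by blast
        ultimately show "p \<in> \<Union>(S \<inter> T)" by blast
      qed
    qed blast
    then show "openin (top_of_set D) (\<Union>(S \<inter> T))"
      using S T by (simp add: openin_Int)
    show "S \<inter> T \<subseteq> D // PR_rel D" using S by blast
  next
    fix K assume K: "\<forall>S\<in>K. S \<subseteq> D // PR_rel D \<and> openin (top_of_set D) (\<Union>S)"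
    have "\<Union>(\<Union>K) = \<Union>(Union ` K)" by blast
    then show "openin (top_of_set D) (\<Union>(\<Union>K))"
      using K by (auto intro: openin_Union)
    show "\<Union>K \<subseteq> D // PR_rel D" using K by blast
  qed
  then show ?thesis
    unfolding PR_space_def by (simp add: topology_inverse')
qed

lemma topspace_PR_space: "topspace (PR_space D) = D // PR_rel D"
proof -
  have "openin (PR_space D) (D // PR_rel D)"
    by (simp add: openin_PR_space Union_quotient[OF equiv_PR_rel])
  then show ?thesis
    by (auto simp: topspace_def openin_PR_space)
qed

lemma quotient_map_PR_class: "quotient_map (top_of_set D) (PR_space D) (PR_class D)"
  unfolding quotient_map_def
proof (intro conjI allI impI)
  show "PR_class D ` topspace (top_of_set D) = topspace (PR_space D)"
    by (auto simp: topspace_PR_space PR_class_def quotient_def)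
  fix U assume U: "U \<subseteq> topspace (PR_space D)"
  have class_eq: "PR_class D p = A" if "A \<in> U" "p \<in> A" for A p
  proof -
    have "A \<in> D // PR_rel D" using U that by (auto simp: topspace_PR_space)
    then obtain q where q: "A = PR_rel D `` {q}" by (rule quotientE)
    then have "(q, p) \<in> PR_rel D" using that by simp
    then show ?thesis
      unfolding PR_class_def q by (rule equiv_class_eq[OF equiv_PR_rel, symmetric])
  qed
  have self: "p \<in> PR_class D p" if "p \<in> D" for p
    using equiv_class_self[OF equiv_PR_rel that] by (simp add: PR_class_def)
  have "\<Union>U \<subseteq> \<Union>(D // PR_rel D)"
    using U by (simp add: topspace_PR_space Union_mono)
  then have sub: "\<Union>U \<subseteq> D"
    by (simp add: Union_quotient[OF equiv_PR_rel])
  have "{p \<in> topspace (top_of_set D). PR_class D p \<in> U} = \<Union>U"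
  proof (intro set_eqI iffI)
    fix p assume "p \<in> {p \<in> topspace (top_of_set D). PR_class D p \<in> U}"
    then have "p \<in> D" "PR_class D p \<in> U" by simp_all
    with self show "p \<in> \<Union>U" by blast
  next
    fix p assume p: "p \<in> \<Union>U"
    then obtain A where "A \<in> U" "p \<in> A" by (rule UnionE)
    with class_eq have "PR_class D p \<in> U" by simp
    with p sub show "p \<in> {p \<in> topspace (top_of_set D). PR_class D p \<in> U}" by auto
  qed
  then show "openin (top_of_set D) {p \<in> topspace (top_of_set D). PR_class D p \<in> U}
      = openin (PR_space D) U"
    using U by (simp add: openin_PR_space topspace_PR_space)
qed

lemma pt_isomorphic_same_source:
  assumes "pt_isomorphic R S" "pt_isomorphic R T"
  shows "pt_isomorphic S T"
proof -
  obtain g h where g: "pt_isomorphism g R S" and h: "pt_isomorphism h R T"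
    using assms by (auto simp: pt_isomorphic_def)
  have r: "pt_root R \<in> pt_verts R" using assms by (simp add: pt_isomorphic_def)
  define k where "k = inv_into (pt_verts R) g"
  have bg: "bij_betw g (pt_verts R) (pt_verts S)" using g by (simp add: pt_isomorphism_def)
  have bk: "bij_betw k (pt_verts S) (pt_verts R)"
    unfolding k_def by (rule bij_betw_inv_into[OF bg])
  have gk: "g (k v) = v" "k v \<in> pt_verts R" if "v \<in> pt_verts S" for v
    using that bg bk unfolding k_def by (auto simp: bij_betw_inv_into_right bij_betwE)
  have kr: "k (pt_root S) = pt_root R"
    using g bij_betw_inv_into_left[OF bg r] by (simp add: k_def pt_isomorphism_def)
  have "pt_isomorphism (h \<circ> k) S T"
    unfolding pt_isomorphism_def
  proof (intro conjI ballI)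
    show "bij_betw (h \<circ> k) (pt_verts S) (pt_verts T)"
      using bk h by (auto simp: pt_isomorphism_def intro: bij_betw_trans)
    show "(h \<circ> k) (pt_root S) = pt_root T"
      using kr h by (simp add: pt_isomorphism_def)
    fix u v assume u: "u \<in> pt_verts S" and v: "v \<in> pt_verts S"
    have gE: "((a, b) \<in> pt_edges R) = ((g a, g b) \<in> pt_edges S)"
             "((a, b) \<in> pt_preorder R) = ((g a, g b) \<in> pt_preorder S)"
      and hE: "((a, b) \<in> pt_edges R) = ((h a, h b) \<in> pt_edges T)"
             "((a, b) \<in> pt_preorder R) = ((h a, h b) \<in> pt_preorder T)"
      if "a \<in> pt_verts R" "b \<in> pt_verts R" for a b
      using g h that by (simp_all add: pt_isomorphism_def)
    show "((u, v) \<in> pt_edges S) = (((h \<circ> k) u, (h \<circ> k) v) \<in> pt_edges T)"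
      using gE(1)[of "k u" "k v"] hE(1)[of "k u" "k v"] gk[OF u] gk[OF v] by simp
    show "((u, v) \<in> pt_preorder S) = (((h \<circ> k) u, (h \<circ> k) v) \<in> pt_preorder T)"
      using gE(2)[of "k u" "k v"] hE(2)[of "k u" "k v"] gk[OF u] gk[OF v] by simp
    fix w assume w: "w \<in> pt_verts S"
    have "((k u, k v, k w) \<in> pt_below R) = ((g (k u), g (k v), g (k w)) \<in> pt_below S)"
         "((k u, k v, k w) \<in> pt_below R) = ((h (k u), h (k v), h (k w)) \<in> pt_below T)"
      using g h gk(2)[OF u] gk(2)[OF v] gk(2)[OF w] by (simp_all add: pt_isomorphism_def)
    then show "((u, v, w) \<in> pt_below S) = (((h \<circ> k) u, (h \<circ> k) v, (h \<circ> k) w) \<in> pt_below T)"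
      using gk[OF u] gk[OF v] gk[OF w] by simp
  qed
  moreover have "pt_root S \<in> pt_verts S"
    using g bij_betw_apply[OF bg r] by (simp add: pt_isomorphism_def)
  ultimately show ?thesis by (auto simp: pt_isomorphic_def)
qed

lemma asymptotic_PR_tree_unique:
  assumes "asymptotic_PR_tree f S" "asymptotic_PR_tree f T"
  shows "pt_isomorphic S T"
proof -
  have "\<forall>\<^sub>F \<epsilon> in at_right (0::real). pt_isomorphic S T"
    using assms unfolding asymptotic_PR_tree_def
    by eventually_elim (rule pt_isomorphic_same_source)
  then show ?thesis by (simp add: eventually_const)
qed

end

theory Submission
  imports Defs "HOL-Computational_Algebra.Polynomial_Factorial"
    "HOL-Computational_Algebra.Field_as_Ring"
begin

text \<open>
  Fix a small box around the origin. On the part of the box where \<open>x > 0\<close> the polar curve consists of finitely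
  many half-branches issuing from the origin, which are graphs over the \<open>x\<close> axis. They are simple zeros of
  \<open>\<partial>f/\<partial>y\<close> on vertical lines, because the polar curve is reduced, so on every vertical line local minima and
  local maxima of \<open>f\<close> alternate, with minima at both ends. Along a half-branch \<open>f\<close> either is critical
  throughout, hence constant, which a strict minimum excludes, or has no critical point at all; so it
  increases strictly, starting from zero. Condition (b) says that the critical values on a vertical line are
  distinct, hence the values along the half-branches are ordered in a way that does not depend on \<open>x\<close>.
  The same holds for \<open>x < 0\<close>.

  For small \<open>\<epsilon>\<close> the level disk is therefore the set \<open>f \<le> \<epsilon>\<close> in the box, and every half-branch leaves it
  exactly once, at a point with vertical tangent; there are no other vertical tangents. Moving away from the
  axis, a vertical component of the disk splits in two when a half-branch of maxima leaves,
  and it shrinks to a point and disappears when a half-branch of minima leaves. Components never merge. This is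
  the reason why the tree is binary and \<open>x\<close> is strictly monotone along geodesics from the root. Distinct
  critical values exclude bitangents, so \<open>x\<close> orders the vertices totally, and simple zeros of \<open>\<partial>f/\<partial>y\<close>
  exclude vertical inflections (\<open>polar_box.generic\<close>).

  In the proof the combinatorial type is described explicitly. Two half-branches on the same side of the axis
  are in the same vertical component at a given distance from it if and only if no half-branch between them has left
  the disk before. This is the rule that defines the Cartesian tree of the sequence of exit times, listed
  from bottom to top; putting the right side, the origin with exit time zero, and the left side into a single
  sequence yields the entire tree (\<open>cartesian_tree\<close>). Its properties are elementary
  (\<open>alternating_sequence.complete_binary\<close>, \<open>alternating_sequence.monotone_geodesics\<close>). That it is isomorphic to
  the Poincare-Reeb tree is shown in \<open>PR_model.PR_tree_isomorphic\<close>: the open edges are disjoint open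
  subsets of the quotient space, so an arc avoiding the vertices runs along one of them. The order of the exit
  times is that of the critical values, whence the independence of \<open>\<epsilon>\<close> (\<open>polar_box.exit_order_constant\<close>).
  The half-branches themselves come from \<open>polar_half.polar_branches\<close>, after elimination of \<open>y\<close> has shown that the
  relevant polynomials have no common zeros close to the axis, except on it (\<open>polar_curve_separation\<close>).
\<close>

section \<open>Elimination and the calculus of plane polynomials\<close>

lemma prime_factor_positive_degree:
  fixes R :: "'a::{factorial_ring_gcd, semiring_gcd_mult_normalize} poly"
  assumes "degree R > 0"
  shows "\<exists>\<pi>. prime_elem \<pi> \<and> \<pi> dvd R \<and> degree \<pi> > 0"
  using assms
proof (induction R rule: prime_divisors_induct)
  case zero
  then show ?case by simp
next
  case (unit x)
  then obtain c where "x = [:c:]" using is_unit_polyE by blast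
  then show ?case using unit.prems by simp
next
  case (factor p x)
  then have "prime_elem p" by simp
  show ?case
  proof (cases "degree p > 0")
    case True
    then show ?thesis using \<open>prime_elem p\<close> dvd_triv_left[of p x] by blast
  next
    case False
    then have "degree x > 0"
      using factor.prems degree_mult_le[of p x] by simp
    then show ?thesis using factor.IH dvd_mult by blast
  qed
qed

text \<open>A nonzero element \<open>R\<close> of least degree in the ideal \<open>(P, Q)\<close> divides every element of the ideal up
  to a constant factor, by pseudo-division. Hence a prime factor of \<open>R\<close> of positive degree would be
  a common factor of \<open>P\<close> and \<open>Q\<close>, so \<open>R\<close> is a constant, that is, a polynomial in \<open>x\<close> alone when the
  coefficients are such polynomials.\<close>

lemma elimination_identity:
  fixes P Q :: "'a::{factorial_ring_gcd, semiring_gcd_mult_normalize} poly"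
  assumes P: "P \<noteq> 0"
    and no_common: "\<And>\<pi>. prime_elem \<pi> \<Longrightarrow> \<pi> dvd P \<Longrightarrow> \<pi> dvd Q \<Longrightarrow> degree \<pi> = 0"
  obtains A B d where "A * P + B * Q = [:d:]" "d \<noteq> 0"
proof -
  define I where "I = {A * P + B * Q |A B. True}"
  have "P \<in> I" "Q \<in> I"
    unfolding I_def by (rule CollectI, metis mult_1 mult_zero_left add_0 add.right_neutral)+
  define R where "R = arg_min degree (\<lambda>R. R \<in> I \<and> R \<noteq> 0)"
  have R: "R \<in> I" "R \<noteq> 0"
    using arg_min_natI[of "\<lambda>R. R \<in> I \<and> R \<noteq> 0" P degree] \<open>P \<in> I\<close> P by (auto simp: R_def)
  have minimal: "degree R \<le> degree S" if "S \<in> I" "S \<noteq> 0" for S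
    unfolding R_def using that by (intro arg_min_nat_le) auto
  have divides: "\<exists>c. c \<noteq> 0 \<and> R dvd smult c S" if S_in: "S \<in> I" for S
  proof -
    obtain q r where qr: "pseudo_divmod S R = (q, r)" by fastforce
    define c where "c = lead_coeff R ^ (Suc (degree S) - degree R)"
    have c: "c \<noteq> 0" using R by (simp add: c_def)
    have eq: "smult c S = R * q + r" and small: "r = 0 \<or> degree r < degree R"
      using pseudo_divmod[OF R(2) qr] by (auto simp: c_def)
    obtain A B where S: "S = A * P + B * Q" using S_in unfolding I_def by blast
    obtain A' B' where R': "R = A' * P + B' * Q" using R unfolding I_def by blast
    have "r = ([:c:] * A - q * A') * P + ([:c:] * B - q * B') * Q"
    proof -
      have "r = [:c:] * S - R * q" using eq by simp
      also have "\<dots> = ([:c:] * A - q * A') * P + ([:c:] * B - q * B') * Q"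
        unfolding S R' by (simp only: algebra_simps)
      finally show ?thesis .
    qed
    then have "r \<in> I" unfolding I_def by blast
    then have "r = 0" using minimal small by force
    then show ?thesis using eq c by (intro exI[of _ c]) auto
  qed
  have "degree R = 0"
  proof (rule ccontr)
    assume "degree R \<noteq> 0"
    then obtain \<pi> where \<pi>: "prime_elem \<pi>" "\<pi> dvd R" "degree \<pi> > 0"
      using prime_factor_positive_degree[of R] by auto
    have "\<pi> dvd S" if S_in: "S \<in> I" for S
    proof -
      obtain c where c: "c \<noteq> 0" "R dvd smult c S" using divides[OF S_in] by blast
      then have "\<pi> dvd [:c:] * S" using dvd_trans[OF \<pi>(2) c(2)] by simp
      moreover have "\<not> \<pi> dvd [:c:]"
        using dvd_imp_degree_le[of \<pi> "[:c:]"] c(1) \<pi>(3) by auto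
      ultimately show ?thesis using \<pi>(1) prime_elem_dvd_multD by blast
    qed
    then have "degree \<pi> = 0" using no_common \<pi>(1) \<open>P \<in> I\<close> \<open>Q \<in> I\<close> by blast
    then show False using \<pi>(3) by simp
  qed
  then obtain d where "R = [:d:]" by (rule degree_eq_zeroE)
  moreover from this have "d \<noteq> 0" using R by auto
  moreover obtain A B where "A * P + B * Q = R" using R unfolding I_def by blast
  ultimately show thesis using that by blast
qed

lemma plane_poly_fun_add: "plane_poly_fun (P + Q) p = plane_poly_fun P p + plane_poly_fun Q p"
  and plane_poly_fun_mult: "plane_poly_fun (P * Q) p = plane_poly_fun P p * plane_poly_fun Q p"
  by (simp_all add: plane_poly_fun_def case_prod_beta)

lemma plane_poly_fun_const: "plane_poly_fun [:d:] (x, y) = poly d x"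
  by (simp add: plane_poly_fun_def)

lemma plane_poly_fun_pCons:
  "plane_poly_fun (pCons a P) (x, y) = poly a x + y * plane_poly_fun P (x, y)"
  by (simp add: plane_poly_fun_def)

lemma plane_poly_fun_zero: "plane_poly_fun 0 p = 0"
  by (simp add: plane_poly_fun_def case_prod_beta)

lemma poly_nonzero_near_zero:
  fixes d :: "real poly"
  assumes "d \<noteq> 0"
  shows "\<exists>\<delta>>0. \<forall>x. 0 < \<bar>x\<bar> \<and> \<bar>x\<bar> < \<delta> \<longrightarrow> poly d x \<noteq> 0"
proof -
  have "finite {x. poly d x = 0}" using assms by (rule poly_roots_finite)
  then obtain \<delta> where "\<delta> > 0" "\<forall>x\<in>{x. poly d x = 0}. x \<noteq> 0 \<longrightarrow> \<delta> \<le> dist 0 x"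
    using finite_set_avoid[of "{x. poly d x = 0}" 0] by auto
  then show ?thesis by (intro exI[of _ \<delta>]) (auto simp: dist_real_def)
qed

text \<open>The common zeros of \<open>P\<close> and \<open>Q\<close> lie on the vertical lines \<open>d = 0\<close>, where \<open>d\<close> comes from the
  elimination identity. There are finitely many of them, so close to the axis \<open>x = 0\<close> only the axis
  itself can contain common zeros.\<close>

lemma no_common_zeros_near_axis:
  fixes P Q :: "real poly poly"
  assumes "P \<noteq> 0"
    and "\<And>\<pi>. prime_elem \<pi> \<Longrightarrow> \<pi> dvd P \<Longrightarrow> \<pi> dvd Q \<Longrightarrow> degree \<pi> = 0"
  shows "\<exists>\<delta>>0. \<forall>x y. 0 < \<bar>x\<bar> \<and> \<bar>x\<bar> < \<delta> \<and> plane_poly_fun P (x, y) = 0 \<longrightarrow>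
           plane_poly_fun Q (x, y) \<noteq> 0"
proof -
  obtain A B d where d: "A * P + B * Q = [:d:]" "d \<noteq> 0"
    using elimination_identity assms by blast
  obtain \<delta> where \<delta>: "\<delta> > 0" "\<And>x. 0 < \<bar>x\<bar> \<Longrightarrow> \<bar>x\<bar> < \<delta> \<Longrightarrow> poly d x \<noteq> 0"
    using poly_nonzero_near_zero[OF d(2)] by blast
  have "poly d x = 0" if "plane_poly_fun P (x, y) = 0" "plane_poly_fun Q (x, y) = 0" for x y
  proof -
    have "poly d x = plane_poly_fun (A * P + B * Q) (x, y)"
      unfolding d(1) by (simp add: plane_poly_fun_const)
    also have "\<dots> = 0" using that by (simp add: plane_poly_fun_add plane_poly_fun_mult)
    finally show ?thesis .
  qed
  then show ?thesis using \<delta> by blast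
qed

text \<open>A factor of multiplicity one that also divided the derivative would divide its own derivative,
  which has smaller degree and is nonzero in characteristic zero. Factors depending on \<open>x\<close> alone
  are not excluded: their derivative with respect to \<open>y\<close> is zero.\<close>

lemma squarefree_prime_pderiv:
  fixes P :: "real poly poly"
  assumes "squarefree P" "prime_elem \<pi>" "\<pi> dvd P" "\<pi> dvd pderiv P"
  shows "degree \<pi> = 0"
proof (rule ccontr)
  assume deg: "degree \<pi> \<noteq> 0"
  obtain K where K: "P = \<pi> * K" using assms(3) by blast
  have "\<pi> dvd \<pi> * pderiv K + K * pderiv \<pi>" using assms(4) unfolding K by (simp add: pderiv_mult)
  then have "\<pi> dvd K * pderiv \<pi>" by (simp add: dvd_add_right_iff)
  then consider "\<pi> dvd K" | "\<pi> dvd pderiv \<pi>" using assms(2) prime_elem_dvd_multD by blast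
  then show False
  proof cases
    case 1
    then have "\<pi>\<^sup>2 dvd P" unfolding K power2_eq_square by (rule mult_dvd_mono[OF dvd_refl])
    then have "\<pi> dvd 1" using assms(1) squarefreeD by blast
    then show False using assms(2) by (simp add: prime_elem_def)
  next
    case 2
    have "pderiv \<pi> \<noteq> 0" using deg by (simp add: pderiv_eq_0_iff)
    then have "degree \<pi> \<le> degree (pderiv \<pi>)" using 2 by (intro dvd_imp_degree_le)
    then show False using deg by (simp add: degree_pderiv)
  qed
qed

definition x_pderiv :: "real poly poly \<Rightarrow> real poly poly" where
  "x_pderiv F = map_poly pderiv F"

lemma x_pderiv_pCons: "x_pderiv (pCons a F) = pCons (pderiv a) (x_pderiv F)"
  by (cases "a = 0 \<and> F = 0") (auto simp: x_pderiv_def map_poly_pCons)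

lemma plane_poly_fun_has_derivative:
  "(plane_poly_fun F has_derivative
     (\<lambda>h. fst h * plane_poly_fun (x_pderiv F) p + snd h * plane_poly_fun (pderiv F) p)) (at p)"
proof (induction F)
  case 0
  show ?case by (simp add: plane_poly_fun_zero[abs_def] plane_poly_fun_def x_pderiv_def)
next
  case (pCons a F)
  obtain x y where p: "p = (x, y)" by fastforce
  have eq: "plane_poly_fun (pCons a F) = (\<lambda>q. poly a (fst q) + snd q * plane_poly_fun F q)"
    by (auto simp: plane_poly_fun_pCons)
  have a: "((\<lambda>q. poly a (fst q)) has_derivative (\<lambda>h. fst h * poly (pderiv a) x)) (at p)"
  proof -
    have "(poly a has_derivative (\<lambda>h. h * poly (pderiv a) x)) (at (fst p))"
      using poly_DERIV[of a x] by (simp add: p has_field_derivative_def mult_commute_abs)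
    from has_derivative_compose[OF has_derivative_fst[OF has_derivative_ident] this]
    show ?thesis by simp
  qed
  show ?case
    unfolding eq
    by (rule has_derivative_eq_rhs, rule has_derivative_add[OF a],
        rule has_derivative_mult[OF has_derivative_snd[OF has_derivative_ident] pCons.IH])
      (auto simp: p pderiv_pCons x_pderiv_pCons plane_poly_fun_pCons plane_poly_fun_add
        algebra_simps)
qed

lemma continuous_on_plane_poly_fun: "continuous_on S (plane_poly_fun F)"
  using plane_poly_fun_has_derivative
  by (meson continuous_at_imp_continuous_on has_derivative_continuous)

text \<open>Near the axis the polar curve splits into a part \<open>g = 0\<close> that consists of critical points of \<open>f\<close>
  and a part \<open>h = 0\<close> free of critical points: \<open>g\<close> is the greatest common divisor of the two partial
  derivatives. Reducedness enters twice. A common factor of \<open>h\<close> and \<open>\<partial>f/\<partial>x\<close> would divide \<open>g\<close> as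
  well, hence be a double factor of \<open>\<partial>f/\<partial>y\<close>; and the zeros of \<open>\<partial>f/\<partial>y\<close> on vertical lines close
  to the axis are simple.\<close>

lemma polar_curve_separation:
  fixes F :: "real poly poly"
  assumes sf: "squarefree (pderiv F)"
  obtains \<delta> g h where "\<delta> > 0" "pderiv F = g * h"
    "\<And>x y. 0 < \<bar>x\<bar> \<Longrightarrow> \<bar>x\<bar> < \<delta> \<Longrightarrow> plane_poly_fun (pderiv F) (x, y) = 0 \<Longrightarrow>
       plane_poly_fun (pderiv (pderiv F)) (x, y) \<noteq> 0"
    "\<And>x y. plane_poly_fun g (x, y) = 0 \<Longrightarrow> plane_poly_fun (x_pderiv F) (x, y) = 0"
    "\<And>x y. 0 < \<bar>x\<bar> \<Longrightarrow> \<bar>x\<bar> < \<delta> \<Longrightarrow> plane_poly_fun h (x, y) = 0 \<Longrightarrow>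
       plane_poly_fun (x_pderiv F) (x, y) \<noteq> 0"
proof -
  define P where "P = pderiv F"
  define Q where "Q = x_pderiv F"
  define g where "g = gcd P Q"
  have P: "P \<noteq> 0" using sf by (auto simp: P_def)
  obtain h where h: "P = g * h" unfolding g_def by (meson dvdE gcd_dvd1)
  obtain k where k: "Q = g * k" unfolding g_def by (meson dvdE gcd_dvd2)
  have h0: "h \<noteq> 0" using h P by auto
  obtain \<delta>1 where \<delta>1: "\<delta>1 > 0" "\<And>x y. 0 < \<bar>x\<bar> \<Longrightarrow> \<bar>x\<bar> < \<delta>1 \<Longrightarrow> plane_poly_fun P (x, y) = 0 \<Longrightarrow>
       plane_poly_fun (pderiv P) (x, y) \<noteq> 0"
    using no_common_zeros_near_axis[OF P, of "pderiv P"] squarefree_prime_pderiv sf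
    unfolding P_def by blast
  have "degree \<pi> = 0" if "prime_elem \<pi>" "\<pi> dvd h" "\<pi> dvd Q" for \<pi>
  proof -
    have "\<pi> dvd P" using that(2) h by simp
    then have "\<pi> dvd g" using that(3) by (simp add: g_def)
    then have "\<pi>\<^sup>2 dvd P" unfolding h power2_eq_square using that(2) by (rule mult_dvd_mono)
    then have "\<pi> dvd 1" using sf squarefreeD P_def by blast
    then show ?thesis using that(1) by (simp add: prime_elem_def)
  qed
  then obtain \<delta>2 where \<delta>2: "\<delta>2 > 0" "\<And>x y. 0 < \<bar>x\<bar> \<Longrightarrow> \<bar>x\<bar> < \<delta>2 \<Longrightarrow> plane_poly_fun h (x, y) = 0 \<Longrightarrow>
       plane_poly_fun Q (x, y) \<noteq> 0"
    using no_common_zeros_near_axis[OF h0, of Q] by blast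
  show thesis
  proof (rule that[of "min \<delta>1 \<delta>2" g h])
    show "min \<delta>1 \<delta>2 > 0" using \<delta>1 \<delta>2 by simp
    show "pderiv F = g * h" using h P_def by simp
    show "plane_poly_fun (x_pderiv F) (x, y) = 0" if "plane_poly_fun g (x, y) = 0" for x y
      using that k by (simp add: Q_def[symmetric] plane_poly_fun_mult)
  qed (use \<delta>1 \<delta>2 in \<open>auto simp: P_def Q_def\<close>)
qed

lemma finite_zeros_on_vertical:
  assumes "plane_poly_fun P (x, y0) \<noteq> 0"
  shows "finite {y. plane_poly_fun P (x, y) = 0}"
proof -
  define p where "p = map_poly (\<lambda>c. poly c x) P"
  have eval: "plane_poly_fun P (x, y) = poly p y" for y
    unfolding p_def
  proof (induction P)
    case (pCons a P)
    then show ?case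
      by (cases "poly a x = 0 \<and> P = 0") (auto simp: plane_poly_fun_pCons map_poly_pCons)
  qed (simp add: plane_poly_fun_zero)
  then have "p \<noteq> 0" using assms by auto
  then show ?thesis unfolding eval by (rule poly_roots_finite)
qed


section \<open>Rooted trees given by a parent function\<close>

text \<open>The number \<open>dep\<close> need not be the distance to the root; it only has to decrease towards it, which
  is what the inductions on paths use.\<close>

locale parent_tree =
  fixes T :: "'v plane_tree" and par :: "'v \<Rightarrow> 'v" and dep :: "'v \<Rightarrow> nat"
  assumes finite_verts: "finite (pt_verts T)"
    and root_in: "pt_root T \<in> pt_verts T"
    and par_in: "j \<in> pt_verts T \<Longrightarrow> j \<noteq> pt_root T \<Longrightarrow> par j \<in> pt_verts T"
    and dep_par: "j \<in> pt_verts T \<Longrightarrow> j \<noteq> pt_root T \<Longrightarrow> dep (par j) < dep j"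
    and dep_root: "dep (pt_root T) = 0"
    and edges_eq: "pt_edges T =
      {(i, j). j \<in> pt_verts T \<and> j \<noteq> pt_root T \<and> i = par j \<or>
               i \<in> pt_verts T \<and> i \<noteq> pt_root T \<and> j = par i}"
begin

abbreviation "V \<equiv> pt_verts T"
abbreviation "rt \<equiv> pt_root T"

lemma edge_cases:
  assumes "(i, j) \<in> pt_edges T"
  obtains "j \<in> V" "j \<noteq> rt" "i = par j" | "i \<in> V" "i \<noteq> rt" "j = par i"
  using assms by (auto simp: edges_eq)

lemma sym_edges: "sym (pt_edges T)"
  by (auto simp: sym_def edges_eq)

lemma pt_path_Cons_Cons:
  "pt_path T (u # w # p) \<longleftrightarrow> u \<in> V \<and> u \<notin> set (w # p) \<and> (u, w) \<in> pt_edges T \<and> pt_path T (w # p)"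
  by (auto simp: pt_path_def)

lemma pt_path_single: "u \<in> V \<Longrightarrow> pt_path T [u]"
  by (simp add: pt_path_def)

lemma pt_path_rev: "pt_path T (rev p) \<longleftrightarrow> pt_path T p"
proof -
  have "(\<lambda>u v. (v, u) \<in> pt_edges T) = (\<lambda>u v. (u, v) \<in> pt_edges T)"
    using sym_edges by (auto simp: sym_def fun_eq_iff)
  then have "successively (\<lambda>u v. (v, u) \<in> pt_edges T) p = successively (\<lambda>u v. (u, v) \<in> pt_edges T) p"
    by (rule arg_cong)
  then show ?thesis by (simp add: pt_path_def successively_rev)
qed

text \<open>A simple path cannot turn back: after a step from a vertex to one of its children, stepping
  to the parent would revisit a vertex. So it keeps moving away from the root.\<close>

lemma climbing_path:
  assumes "pt_path T (u # w # p)" "w \<noteq> rt" "u = par w"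
  shows "successively (\<lambda>i j. j \<in> V \<and> j \<noteq> rt \<and> i = par j) (u # w # p)"
  using assms
proof (induction p arbitrary: u w)
  case Nil
  then show ?case by (simp add: pt_path_def)
next
  case (Cons z p)
  have path: "pt_path T (w # z # p)" using Cons.prems(1) unfolding pt_path_Cons_Cons by blast
  have w: "w \<in> V" using path by (simp add: pt_path_def)
  have "(w, z) \<in> pt_edges T" "z \<noteq> u"
    using Cons.prems(1) by (auto simp: pt_path_Cons_Cons)
  then have "w = par z" "z \<noteq> rt" using Cons.prems(3) by (auto elim: edge_cases)
  from Cons.IH[OF path this(2,1)] show ?case using Cons.prems w by simp
qed

lemma climbing_dep:
  assumes "successively (\<lambda>i j. j \<in> V \<and> j \<noteq> rt \<and> i = par j) p"
  shows "sorted_wrt (\<lambda>i j. dep i < dep j) p"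
proof -
  have "successively (\<lambda>i j. dep i < dep j) p"
    using assms by (rule successively_mono) (auto simp: dep_par)
  moreover have "transp (\<lambda>i j. dep i < dep j)" by (auto simp: transp_def)
  ultimately show ?thesis by (simp add: successively_conv_sorted_wrt)
qed

lemma root_path:
  assumes "pt_path T p" "hd p = rt"
  shows "successively (\<lambda>i j. j \<in> V \<and> j \<noteq> rt \<and> i = par j) p"
proof (cases "\<exists>u w q. p = u # w # q")
  case True
  then obtain u w q where pq: "p = u # w # q" by blast
  then have p: "pt_path T (u # w # q)" "u = rt" using assms by simp_all
  then have "(u, w) \<in> pt_edges T" by (simp add: pt_path_Cons_Cons)
  then have "w \<noteq> rt" "u = par w" using p(2) by (auto elim: edge_cases)
  then show ?thesis using climbing_path p(1) pq by simp
next
  case False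
  then have "p = [] \<or> (\<exists>u. p = [u])" by (metis list.exhaust)
  then show ?thesis by auto
qed

text \<open>If the first step went to a child, the path would climb for ever and end above \<open>u\<close>.\<close>

lemma path_to_lower_vertex:
  assumes "pt_path T p" "hd p = u" "last p = v" "u \<noteq> v" "dep v \<le> dep u"
  obtains p' where "p = u # p'" "pt_path T p'" "hd p' = par u" "last p' = v" "u \<noteq> rt"
proof -
  obtain w q where p: "p = u # w # q"
    using assms by (cases p rule: list.exhaust; cases "tl p") (auto simp: pt_path_def)
  have uw: "(u, w) \<in> pt_edges T" and path: "pt_path T (u # w # q)" "pt_path T (w # q)"
    using assms(1) unfolding p pt_path_Cons_Cons by auto
  from uw show thesis
  proof (cases rule: edge_cases)
    case 1
    then have "sorted_wrt (\<lambda>i j. dep i < dep j) (u # w # q)"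
      using climbing_path path climbing_dep by blast
    moreover have "v \<in> set (w # q)" using assms(3) p by auto
    ultimately have "dep u < dep v" by auto
    then show thesis using assms(5) by simp
  next
    case 2
    then show thesis using that[of "w # q"] path assms(3) p by auto
  qed
qed

text \<open>Induction on \<open>dep u + dep v\<close>: of two distinct end points, the higher one is joined to the rest of the
  path through its parent. The same induction gives uniqueness.\<close>

lemma paths_exist:
  assumes "u \<in> V" "v \<in> V"
  shows "\<exists>p. pt_path T p \<and> hd p = u \<and> last p = v"
  using assms
proof (induction "dep u + dep v" arbitrary: u v rule: less_induct)
  case less
  have down: "\<exists>p. pt_path T p \<and> hd p = a \<and> last p = b"
    if ab: "a \<in> V" "b \<in> V" "a \<noteq> b" "dep b \<le> dep a" "dep a + dep b = dep u + dep v" for a b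
  proof -
    have "a \<noteq> rt"
    proof
      assume "a = rt"
      then have "dep b = 0" "b \<noteq> rt" using ab dep_root by auto
      then show False using dep_par[of b] ab by simp
    qed
    then have par: "par a \<in> V" "dep (par a) < dep a" using par_in dep_par ab by auto
    obtain p where p: "pt_path T p" "hd p = par a" "last p = b"
      using less.hyps[of "par a" b] par ab by auto
    have ne: "p \<noteq> []" using p by (simp add: pt_path_def)
    show ?thesis
    proof (cases "a \<in> set p")
      case True
      then obtain q r where qr: "p = q @ a # r" by (auto simp: in_set_conv_decomp)
      then have "pt_path T (a # r)" using p(1) by (auto simp: pt_path_def successively_append_iff)
      then show ?thesis using p(3) qr by (intro exI[of _ "a # r"]) auto
    next
      case False
      have "(a, par a) \<in> pt_edges T" using ab \<open>a \<noteq> rt\<close> by (auto simp: edges_eq)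
      then have "pt_path T (a # p)"
        using p ne False ab by (cases p) (auto simp: pt_path_Cons_Cons)
      then show ?thesis using p ne by (intro exI[of _ "a # p"]) auto
    qed
  qed
  consider "u = v" | "u \<noteq> v" "dep v \<le> dep u" | "u \<noteq> v" "dep u \<le> dep v" by linarith
  then show ?case
  proof cases
    case 1
    then show ?thesis using less.prems pt_path_single[of u] by (intro exI[of _ "[u]"]) auto
  next
    case 2
    then show ?thesis using down less.prems by blast
  next
    case 3
    then obtain p where "pt_path T p" "hd p = v" "last p = u"
      using down[of v u] less.prems by (auto simp: add.commute)
    moreover from this have "p \<noteq> []" by (simp add: pt_path_def)
    ultimately show ?thesis
      by (intro exI[of _ "rev p"]) (simp add: pt_path_rev hd_rev last_rev)
  qed
qed

lemma paths_unique:
  assumes "pt_path T p" "pt_path T q" "hd p = u" "hd q = u" "last p = v" "last q = v"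
  shows "p = q"
  using assms
proof (induction "dep u + dep v" arbitrary: u v p q rule: less_induct)
  case less
  have closed: "r = [a]" if "pt_path T r" "hd r = a" "last r = a" for r a
    using that by (cases r) (auto simp: pt_path_def split: if_splits)
  have down: "r = s"
    if rs: "pt_path T r" "pt_path T s" "hd r = a" "hd s = a" "last r = b" "last s = b"
      "a \<noteq> b" "dep b \<le> dep a" "dep a + dep b = dep u + dep v" for r s a b
  proof -
    obtain r' where r': "r = a # r'" "pt_path T r'" "hd r' = par a" "last r' = b" "a \<noteq> rt"
      using path_to_lower_vertex rs by metis
    obtain s' where s': "s = a # s'" "pt_path T s'" "hd s' = par a" "last s' = b"
      using path_to_lower_vertex rs by metis
    have "a \<in> V" using rs(1) r'(1) by (auto simp: pt_path_def)
    then have "dep (par a) + dep b < dep u + dep v" using dep_par r'(5) rs(9) by fastforce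
    then have "r' = s'" using less.hyps r' s' by blast
    then show ?thesis using r' s' by simp
  qed
  consider "u = v" | "u \<noteq> v" "dep v \<le> dep u" | "u \<noteq> v" "dep u \<le> dep v" by linarith
  then show ?case
  proof cases
    case 1
    then show ?thesis using closed less.prems by metis
  next
    case 2
    then show ?thesis using down less.prems by blast
  next
    case 3
    have "p \<noteq> []" "q \<noteq> []" using less.prems by (auto simp: pt_path_def)
    then have "rev p = rev q"
      using down[of "rev p" "rev q" v u] less.prems 3
      by (simp add: pt_path_rev hd_rev last_rev add.commute)
    then show ?thesis by simp
  qed
qed

lemma is_tree: "is_tree T"
  unfolding is_tree_def
proof (intro conjI ballI)
  show "pt_edges T \<subseteq> V \<times> V" by (auto simp: edges_eq par_in)
  show "irrefl (pt_edges T)"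
    using dep_par by (fastforce simp: irrefl_def edges_eq)
  fix u v assume "u \<in> V" "v \<in> V"
  then show "\<exists>!p. pt_path T p \<and> hd p = u \<and> last p = v"
    using paths_exist paths_unique by (meson ex_ex1I)
qed (fact finite_verts root_in sym_edges)+

lemma dist_eq:
  assumes "pt_path T p" "hd p = u" "last p = v"
  shows "pt_dist T u v = length p - 1"
  unfolding pt_dist_def
proof (rule Least_equality)
  have "p \<noteq> []" using assms by (simp add: pt_path_def)
  then show "\<exists>q. pt_path T q \<and> hd q = u \<and> last q = v \<and> length q = Suc (length p - 1)"
    using assms by (intro exI[of _ p]) auto
  fix n assume "\<exists>q. pt_path T q \<and> hd q = u \<and> last q = v \<and> length q = Suc n"
  then obtain q where q: "pt_path T q" "hd q = u" "last q = v" "length q = Suc n" by blast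
  then have "q = p" using paths_unique assms by blast
  then show "length p - 1 \<le> n" using q by simp
qed

lemma dist_par:
  assumes "u \<in> V" "u \<noteq> rt"
  shows "pt_dist T rt u = Suc (pt_dist T rt (par u))"
proof -
  obtain p where p: "pt_path T p" "hd p = rt" "last p = par u"
    using paths_exist root_in par_in assms by blast
  have ne: "p \<noteq> []" using p by (simp add: pt_path_def)
  have "sorted_wrt (\<lambda>i j. dep i < dep j) p" using root_path climbing_dep p by blast
  then have "\<forall>z\<in>set (butlast p). dep z < dep (last p)"
    using ne by (metis append_butlast_last_id list.set_intros(1) sorted_wrt_append)
  moreover have "set p = insert (last p) (set (butlast p))"
    using ne by (metis append_butlast_last_id list.simps(15) rotate1.simps(2) set_rotate1)
  ultimately have "u \<notin> set p" using dep_par[OF assms] p(3) by auto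
  moreover have "(par u, u) \<in> pt_edges T" using assms by (auto simp: edges_eq)
  ultimately have "pt_path T (p @ [u])"
    using p ne assms by (auto simp: pt_path_def successively_append_iff)
  then have "pt_dist T rt u = length p" using dist_eq[of "p @ [u]" rt u] p ne by simp
  moreover have "pt_dist T rt (par u) = length p - 1" using dist_eq p by blast
  ultimately show ?thesis using ne by simp
qed

lemma children_eq: "pt_children T v = {u \<in> V. u \<noteq> rt \<and> par u = v}"
  using dist_par by (fastforce simp: pt_children_def edges_eq)

end


section \<open>Cartesian trees\<close>

text \<open>In the Cartesian tree of a sequence, \<open>i\<close> is an ancestor of \<open>j\<close> if the minimum of the sequence
  between the two positions is attained at \<open>i\<close>.\<close>

definition cart_anc :: "(nat \<Rightarrow> real) \<Rightarrow> nat \<Rightarrow> nat \<Rightarrow> bool" where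
  "cart_anc \<tau> i j \<longleftrightarrow> (\<forall>k\<in>{min i j..max i j}. \<tau> i \<le> \<tau> k)"

definition cart_parent :: "nat \<Rightarrow> (nat \<Rightarrow> real) \<Rightarrow> nat \<Rightarrow> nat \<Rightarrow> bool" where
  "cart_parent M \<tau> i j \<longleftrightarrow> i < M \<and> j < M \<and> i \<noteq> j \<and> cart_anc \<tau> i j \<and>
     (\<forall>k<M. k \<noteq> j \<longrightarrow> cart_anc \<tau> k j \<longrightarrow> cart_anc \<tau> k i)"

text \<open>Positions smaller than \<open>m\<close> stand for half-branches of the polar curve in the half plane \<open>x > 0\<close>,
  position \<open>m\<close> for the origin, and larger ones for half-branches in \<open>x < 0\<close>. On each side the
  half-branches are numbered from bottom to top, and \<open>\<tau> i\<close> is the distance from the axis \<open>x = 0\<close> at which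
  the \<open>i\<close>-th one leaves the level disk. So \<open>side m i * \<tau> i\<close> is the abscissa of a vertex. Placing the
  origin, with \<open>\<tau> m = 0\<close>, between the two sides makes the whole Poincare-Reeb tree the Cartesian tree
  of a single sequence.\<close>

definition side :: "nat \<Rightarrow> nat \<Rightarrow> real" where
  "side m i = (if i < m then 1 else if i = m then 0 else - 1)"

definition cartesian_tree :: "nat \<Rightarrow> nat \<Rightarrow> (nat \<Rightarrow> real) \<Rightarrow> nat plane_tree" where
  "cartesian_tree M m \<tau> =
     \<lparr> pt_verts = {..<M},
       pt_root = m,
       pt_edges = {(i, j). cart_parent M \<tau> i j \<or> cart_parent M \<tau> j i},
       pt_preorder = {(i, j). i < M \<and> j < M \<and> side m i * \<tau> i \<le> side m j * \<tau> j},
       pt_below = {(v, u, w). cart_parent M \<tau> v u \<and> cart_parent M \<tau> v w \<and> u < w \<and>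
                     side m u = side m w} \<rparr>"

text \<open>Odd positions carry the local minima of \<open>\<tau>\<close>: along a vertical line local maxima of \<open>f\<close> alternate with
  local minima, and a half-branch of maxima leaves the disk before its neighbours. Equal values are possible
  only on different sides of \<open>m\<close>; they are harmless since the smaller value \<open>\<tau> m\<close> lies between them.\<close>

locale alternating_sequence =
  fixes M m :: nat and \<tau> :: "nat \<Rightarrow> real"
  assumes m: "m < M" and odd_m: "odd m" and odd_M: "odd M"
    and \<tau>_m: "\<tau> m = 0"
    and \<tau>_pos: "i < M \<Longrightarrow> i \<noteq> m \<Longrightarrow> 0 < \<tau> i"
    and \<tau>_distinct: "i < M \<Longrightarrow> j < M \<Longrightarrow> i \<noteq> j \<Longrightarrow> side m i = side m j \<Longrightarrow> \<tau> i \<noteq> \<tau> j"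
    and \<tau>_even: "Suc i < M \<Longrightarrow> even i \<Longrightarrow> \<tau> (Suc i) < \<tau> i"
    and \<tau>_odd: "Suc i < M \<Longrightarrow> odd i \<Longrightarrow> \<tau> i < \<tau> (Suc i)"
begin

abbreviation "anc \<equiv> cart_anc \<tau>"
abbreviation "parent \<equiv> cart_parent M \<tau>"

lemma \<tau>_nonneg: "i < M \<Longrightarrow> 0 \<le> \<tau> i"
  using \<tau>_pos[of i] \<tau>_m by (cases "i = m") auto

lemma anc_refl: "anc i i"
  by (simp add: cart_anc_def)

lemma anc_le: "anc i j \<Longrightarrow> \<tau> i \<le> \<tau> j"
  by (auto simp: cart_anc_def)

lemma anc_trans: "anc i j \<Longrightarrow> anc j l \<Longrightarrow> anc i l"
proof -
  assume ij: "anc i j" and jl: "anc j l"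
  have "\<tau> i \<le> \<tau> k" if "k \<in> {min i l..max i l}" for k
  proof (cases "k \<in> {min i j..max i j}")
    case True
    then show ?thesis using ij by (simp add: cart_anc_def)
  next
    case False
    then have "k \<in> {min j l..max j l}" using that by auto
    then show ?thesis using jl anc_le[OF ij] by (force simp: cart_anc_def)
  qed
  then show "anc i l" by (simp add: cart_anc_def)
qed

lemma separated:
  assumes "i < M" "j < M" "i \<noteq> j" "\<tau> i = \<tau> j"
  obtains k where "k \<in> {min i j..max i j}" "\<tau> k < \<tau> i"
proof -
  have "side m i \<noteq> side m j" using assms \<tau>_distinct by blast
  moreover have "i \<noteq> m" using assms \<tau>_m \<tau>_pos[of j] by auto
  moreover have "j \<noteq> m" using assms \<tau>_m \<tau>_pos[of i] by auto
  ultimately have "m \<in> {min i j..max i j}" by (auto simp: side_def split: if_splits)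
  moreover have "\<tau> m < \<tau> i" using \<tau>_m \<tau>_pos[of i] \<open>i \<noteq> m\<close> assms by simp
  ultimately show thesis using that by blast
qed

lemma anc_less:
  assumes "i < M" "j < M" "anc i j" "i \<noteq> j"
  shows "\<tau> i < \<tau> j"
proof (rule ccontr)
  assume "\<not> \<tau> i < \<tau> j"
  then have "\<tau> i = \<tau> j" using anc_le[OF assms(3)] by simp
  then obtain k where "k \<in> {min i j..max i j}" "\<tau> k < \<tau> i" using separated assms by blast
  then show False using assms by (force simp: cart_anc_def)
qed

text \<open>This is what makes the ancestor relation a tree: the windows of two ancestors of \<open>j\<close> overlap in \<open>j\<close>.\<close>

lemma anc_chain:
  assumes "anc i j" "anc k j"
  shows "anc i k \<or> anc k i"
proof -
  have "anc i k" if "anc i j" "anc k j" "\<tau> i \<le> \<tau> k" for i k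
    unfolding cart_anc_def
  proof
    fix l assume l: "l \<in> {min i k..max i k}"
    show "\<tau> i \<le> \<tau> l"
    proof (cases "l \<in> {min i j..max i j}")
      case True
      then show ?thesis using that by (simp add: cart_anc_def)
    next
      case False
      then have "l \<in> {min k j..max k j}" using l by auto
      then show ?thesis using that by (force simp: cart_anc_def)
    qed
  qed
  then show ?thesis using assms by (meson linear)
qed

lemma anc_root: "j < M \<Longrightarrow> anc m j"
  using \<tau>_nonneg \<tau>_m m by (auto simp: cart_anc_def)

lemma lowest_between:
  assumes "i < M" "j < M"
  obtains k where "k \<in> {min i j..max i j}" "k < M" "anc k i" "anc k j"
proof -
  define k where "k = arg_min_on \<tau> {min i j..max i j}"
  have k: "k \<in> {min i j..max i j}" unfolding k_def by (rule arg_min_if_finite) auto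
  have least: "\<tau> k \<le> \<tau> l" if "l \<in> {min i j..max i j}" for l
    unfolding k_def using that by (intro arg_min_least) auto
  have "anc k i" "anc k j" unfolding cart_anc_def using k by (auto intro!: least)
  moreover have "k < M" using k assms by auto
  ultimately show thesis using that k by blast
qed

lemma parent_exists:
  assumes "j < M" "j \<noteq> m"
  obtains i where "parent i j"
proof -
  define S where "S = {k. k < M \<and> k \<noteq> j \<and> anc k j}"
  have S: "finite S" "m \<in> S" using assms anc_root m by (auto simp: S_def)
  define i where "i = arg_min_on (\<lambda>k. - \<tau> k) S"
  have i: "i \<in> S" unfolding i_def using S by (intro arg_min_if_finite) auto
  have greatest: "\<tau> k \<le> \<tau> i" if "k \<in> S" for k
    using arg_min_least[of S k "\<lambda>k. - \<tau> k"] S that by (auto simp: i_def)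
  have "anc k i" if "k \<in> S" for k
  proof (cases "k = i")
    case False
    have "anc k i \<or> anc i k" using that i anc_chain by (auto simp: S_def)
    moreover have "\<not> anc i k" using anc_less[of i k] i that greatest[OF that] False
      by (auto simp: S_def)
    ultimately show ?thesis by blast
  qed (simp add: anc_refl)
  then have "parent i j" using i assms by (auto simp: S_def cart_parent_def)
  then show thesis by (rule that)
qed

lemma parent_less: "parent i j \<Longrightarrow> \<tau> i < \<tau> j"
  using anc_less by (auto simp: cart_parent_def)

lemma parent_not_root: "parent i j \<Longrightarrow> j \<noteq> m"
  using parent_less[of i j] \<tau>_nonneg[of i] \<tau>_m by (auto simp: cart_parent_def)

lemma anc_antisym: "i < M \<Longrightarrow> j < M \<Longrightarrow> anc i j \<Longrightarrow> anc j i \<Longrightarrow> i = j"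
  using anc_less[of i j] anc_le[of j i] by fastforce

lemma parent_unique: "parent i j \<Longrightarrow> parent i' j \<Longrightarrow> i = i'"
  by (rule anc_antisym) (auto simp: cart_parent_def)

definition par :: "nat \<Rightarrow> nat" where
  "par j = (THE i. parent i j)"

lemma par_iff: "j < M \<Longrightarrow> j \<noteq> m \<Longrightarrow> i = par j \<longleftrightarrow> parent i j"
proof -
  assume "j < M" "j \<noteq> m"
  then obtain i' where "parent i' j" using parent_exists by blast
  moreover from this have "par j = i'" unfolding par_def using parent_unique by blast
  ultimately show ?thesis using parent_unique by blast
qed

lemma parent_iff: "parent i j \<longleftrightarrow> j < M \<and> j \<noteq> m \<and> i = par j"
proof -
  have "parent i j \<Longrightarrow> j < M" by (simp add: cart_parent_def)
  then show ?thesis using par_iff[of j i] parent_not_root[of i j] by blast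
qed

abbreviation "T \<equiv> cartesian_tree M m \<tau>"

sublocale parent_tree T par "\<lambda>i. card {k. k < M \<and> \<tau> k < \<tau> i}"
proof
  show "finite (pt_verts T)" "pt_root T \<in> pt_verts T" using m by (auto simp: cartesian_tree_def)
  have "{k. k < M \<and> \<tau> k < \<tau> (pt_root T)} = {}"
  proof -
    have "\<not> \<tau> k < 0" if "k < M" for k using \<tau>_nonneg[OF that] by simp
    then show ?thesis by (simp add: cartesian_tree_def \<tau>_m)
  qed
  then show "card {k. k < M \<and> \<tau> k < \<tau> (pt_root T)} = 0" by (simp only: card.empty)
  show "pt_edges T = {(i, j). j \<in> pt_verts T \<and> j \<noteq> pt_root T \<and> i = par j \<or>
               i \<in> pt_verts T \<and> i \<noteq> pt_root T \<and> j = par i}"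
    by (auto simp: cartesian_tree_def parent_iff)
  fix j assume "j \<in> pt_verts T" "j \<noteq> pt_root T"
  then have par: "parent (par j) j" by (auto simp: cartesian_tree_def parent_iff)
  then show "par j \<in> pt_verts T" by (auto simp: cartesian_tree_def cart_parent_def)
  show "card {k. k < M \<and> \<tau> k < \<tau> (par j)} < card {k. k < M \<and> \<tau> k < \<tau> j}"
    using parent_less[OF par] par by (intro psubset_card_mono) (auto simp: cart_parent_def)
qed

lemma anc_convex:
  assumes "anc v j" "k \<in> {min v j..max v j}"
  shows "anc v k"
  unfolding cart_anc_def
proof
  fix l assume "l \<in> {min v k..max v k}"
  then have "l \<in> {min v j..max v j}"
    using assms(2) by (simp add: min_def max_def split: if_splits)
  then show "\<tau> v \<le> \<tau> l" using assms(1) by (simp add: cart_anc_def)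
qed

text \<open>The descendants of \<open>v\<close> with indices on one side of \<open>v\<close> are consecutive, and the child of
  \<open>v\<close> on this side is the lowest of them.\<close>

lemma unique_child_on_side:
  assumes "v < M" and S: "S = {j. j < M \<and> j < v \<and> anc v j} \<or> S = {j. j < M \<and> v < j \<and> anc v j}"
    and ne: "S \<noteq> {}"
  shows "\<exists>!j. j \<in> S \<and> parent v j"
proof -
  have S_sub: "j < M" "j \<noteq> v" "anc v j" if "j \<in> S" for j using S that by auto
  have fin: "finite S" by (rule finite_subset[of _ "{..<M}"]) (auto dest: S_sub)
  have convex: "k \<in> S" if "i \<in> S" "j \<in> S" "k \<in> {min i j..max i j}" for i j k
  proof -
    have "k \<in> {min v i..max v i} \<or> k \<in> {min v j..max v j}" using that S by auto
    then have "anc v k" using anc_convex that S_sub by blast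
    then show ?thesis using that S by auto
  qed
  define j where "j = arg_min_on \<tau> S"
  have j: "j \<in> S" unfolding j_def using fin ne by (rule arg_min_if_finite)
  have least: "\<tau> j \<le> \<tau> k" if "k \<in> S" for k
    unfolding j_def using fin ne that by (intro arg_min_least) auto
  have j_anc: "anc j k" if "k \<in> S" for k
    unfolding cart_anc_def using convex[OF j that] least by blast
  have "parent v j"
    unfolding cart_parent_def
  proof (intro conjI allI impI)
    fix k assume k: "k < M" "k \<noteq> j" "anc k j"
    have "anc k v \<or> anc v k" using anc_chain k(3) S_sub(3)[OF j] by blast
    moreover have "k = v" if vk: "anc v k"
    proof (rule ccontr)
      assume kv: "k \<noteq> v"
      have kj: "\<tau> k < \<tau> j" using anc_less k S_sub(1)[OF j] by blast
      show False
      proof (cases "k \<in> S")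
        case True
        then show ?thesis using least kj by force
      next
        case False
        then have "v \<in> {min k j..max k j}" using S j kv vk k(1) by auto
        then have "\<tau> k \<le> \<tau> v" using k(3) by (simp add: cart_anc_def)
        then show ?thesis using anc_less[OF assms(1) k(1) vk] kv by simp
      qed
    qed
    ultimately show "anc k v" using anc_refl by blast
  qed (use assms S_sub[OF j] in auto)
  moreover have "k = j" if k: "k \<in> S" "parent v k" for k
  proof (rule ccontr)
    assume "k \<noteq> j"
    then have "anc j v" using k j_anc[OF k(1)] S_sub(1)[OF j] by (auto simp: cart_parent_def)
    then show False using anc_antisym[of j v] S_sub[OF j] assms(1) by blast
  qed
  ultimately show ?thesis using j by blast
qed

text \<open>An even position is a strict local maximum of \<open>\<tau>\<close>, so its neighbours already separate it from any
  possible descendant. At an odd position both neighbours exist, as the length is odd, and are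
  descendants, so there is exactly one child on each side.\<close>

lemma children_cases:
  assumes "v < M"
  shows "{u. parent v u} = {} \<or> card {u. parent v u} = 2"
proof -
  define L where "L = {j. j < M \<and> j < v \<and> anc v j}"
  define R where "R = {j. j < M \<and> v < j \<and> anc v j}"
  have children_sub: "{u. parent v u} \<subseteq> L \<union> R"
    by (auto simp: L_def R_def cart_parent_def)
  show ?thesis
  proof (cases "even v")
    case True
    have "L = {}"
    proof -
      have False if "j \<in> L" for j
      proof -
        have "v - 1 \<in> {min v j..max v j}" using that by (auto simp: L_def)
        then have "\<tau> v \<le> \<tau> (v - 1)" using that by (auto simp: L_def cart_anc_def)
        moreover have "Suc (v - 1) = v" "odd (v - 1)" using that True by (auto simp: L_def)
        ultimately show False using \<tau>_odd[of "v - 1"] assms by simp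
      qed
      then show ?thesis by blast
    qed
    moreover have "R = {}"
    proof -
      have False if "j \<in> R" for j
      proof -
        have "Suc v \<in> {min v j..max v j}" using that by (auto simp: R_def)
        then have "\<tau> v \<le> \<tau> (Suc v)" using that by (auto simp: R_def cart_anc_def)
        then show False using \<tau>_even[of v] True that by (auto simp: R_def)
      qed
      then show ?thesis by blast
    qed
    ultimately show ?thesis using children_sub by blast
  next
    case False
    have "anc v (v - 1)"
      unfolding cart_anc_def
    proof
      fix k assume "k \<in> {min v (v - 1)..max v (v - 1)}"
      then have "k = v \<or> k = v - 1" by auto
      moreover have "\<tau> (Suc (v - 1)) < \<tau> (v - 1)" using \<tau>_even[of "v - 1"] False assms by simp
      ultimately show "\<tau> v \<le> \<tau> k" using False by (auto simp: odd_pos)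
    qed
    moreover have "v - 1 < v" using odd_pos[of v] False by simp
    ultimately have "v - 1 \<in> L" using assms by (simp add: L_def)
    then have L: "L \<noteq> {}" by blast
    have sv: "Suc v < M" using False odd_M assms by (metis Suc_lessI even_Suc)
    have "anc v (Suc v)"
      unfolding cart_anc_def
    proof
      fix k assume "k \<in> {min v (Suc v)..max v (Suc v)}"
      then have "k = v \<or> k = Suc v" by auto
      then show "\<tau> v \<le> \<tau> k" using \<tau>_odd[OF sv] False by auto
    qed
    then have R: "R \<noteq> {}" using sv by (auto simp: R_def)
    obtain a where a: "a \<in> L" "parent v a" "\<And>j. j \<in> L \<Longrightarrow> parent v j \<Longrightarrow> j = a"
      using unique_child_on_side[OF assms _ L] L_def by blast
    obtain b where b: "b \<in> R" "parent v b" "\<And>j. j \<in> R \<Longrightarrow> parent v j \<Longrightarrow> j = b"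
      using unique_child_on_side[OF assms _ R] R_def by blast
    have "u = a \<or> u = b" if "parent v u" for u using a(3) b(3) children_sub that by blast
    then have "{u. parent v u} = {a, b}" using a(2) b(2) by blast
    moreover have "a \<noteq> b" using a(1) b(1) by (auto simp: L_def R_def)
    ultimately show ?thesis by simp
  qed
qed

lemma complete_binary: "complete_binary_tree T"
proof -
  have "pt_children T v = {u. parent v u}" for v
    unfolding children_eq by (auto simp: cartesian_tree_def parent_iff)
  then show ?thesis
    unfolding complete_binary_tree_def using is_tree children_cases
    by (auto simp: cartesian_tree_def)
qed

lemma abscissa_inj:
  assumes "i < M" "j < M" "side m i * \<tau> i = side m j * \<tau> j"
  shows "i = j"
proof (rule ccontr)
  assume "i \<noteq> j"
  then show False
    using assms \<tau>_distinct[of i j] \<tau>_pos[of i] \<tau>_pos[of j] \<tau>_m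
    by (auto simp: side_def split: if_splits)
qed

lemma linear_preorder: "linear_order_on (pt_verts T) (pt_preorder T)"
proof -
  have "antisym (pt_preorder T)"
    by (auto simp: antisym_def cartesian_tree_def intro!: abscissa_inj)
  then show ?thesis
    by (auto simp: linear_order_on_def partial_order_on_def preorder_on_def refl_on_def trans_def
        total_on_def cartesian_tree_def)
qed

text \<open>A descendant of a position other than \<open>m\<close> cannot lie beyond \<open>m\<close>, where the sequence is lowest.\<close>

lemma parent_side: "parent i j \<Longrightarrow> i \<noteq> m \<Longrightarrow> side m i = side m j"
proof (rule ccontr)
  assume ij: "parent i j" "i \<noteq> m" and sides: "side m i \<noteq> side m j"
  have "m \<in> {min i j..max i j}" using sides by (auto simp: side_def split: if_splits)
  moreover have "anc i j" "i < M" using ij(1) by (simp_all add: cart_parent_def)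
  ultimately have "\<tau> i \<le> \<tau> m" unfolding cart_anc_def by blast
  then show False using \<tau>_m \<tau>_pos[of i] ij(2) \<open>i < M\<close> by simp
qed

lemma monotone_geodesics: "strictly_monotone_on_root_geodesics T"
  unfolding strictly_monotone_on_root_geodesics_def
proof (intro allI impI)
  fix p assume p: "pt_path T p \<and> hd p = pt_root T"
  then have "successively (\<lambda>i j. j \<in> pt_verts T \<and> j \<noteq> pt_root T \<and> i = par j) p"
    using root_path by blast
  then have climb: "successively parent p"
    by (rule successively_mono) (auto simp: cartesian_tree_def parent_iff)
  have less_iff: "pt_less T i j \<longleftrightarrow> side m i * \<tau> i < side m j * \<tau> j" if "i < M" "j < M" for i j
    using that by (auto simp: pt_less_def cartesian_tree_def)
  have rt: "hd p = m" using p by (simp add: cartesian_tree_def)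
  have transp: "transp (pt_less T)"
    by (auto simp: transp_def pt_less_def cartesian_tree_def)
  \<comment> \<open>After its first step a path from the root stays on one side.\<close>
  have one_side: "successively (\<lambda>i j. parent i j \<and> side m j = s \<and> (i = m \<or> side m i = s)) (a # q)"
    if "successively parent (a # q)" "a = m \<and> (\<forall>b r. q = b # r \<longrightarrow> side m b = s) \<or> a \<noteq> m \<and> side m a = s"
    for a q s
    using that
  proof (induction q arbitrary: a)
    case (Cons b q)
    then have "parent a b" by simp
    then have b: "side m b = s" "b \<noteq> m"
      using Cons.prems(2) parent_side[of a b] parent_not_root[of a b] by auto
    have "successively (\<lambda>i j. parent i j \<and> side m j = s \<and> (i = m \<or> side m i = s)) (b # q)"
      using Cons.prems(1) b by (intro Cons.IH) auto
    then show ?case using Cons.prems b \<open>parent a b\<close> by auto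
  qed simp
  consider "p = []" | a where "p = [a]" | b r where "p = m # b # r"
    using rt by (metis list.exhaust list.sel(1))
  then show "sorted_wrt (pt_less T) p \<or> sorted_wrt (\<lambda>u v. pt_less T v u) p"
  proof cases
    case (3 b r)
    have steps: "successively (\<lambda>i j. parent i j \<and> side m j = side m b \<and> (i = m \<or> side m i = side m b)) p"
      using one_side[of m "b # r" "side m b"] climb 3 by simp
    have "parent m b" using climb 3 by simp
    then have "b \<noteq> m" by (simp add: parent_iff)
    then consider "side m b = 1" | "side m b = - 1" by (metis side_def)
    then show ?thesis
    proof cases
      case 1
      have "successively (pt_less T) p"
        using steps
      proof (rule successively_mono)
        fix i j assume "parent i j \<and> side m j = side m b \<and> (i = m \<or> side m i = side m b)"
        then show "pt_less T i j"
          using 1 parent_less[of i j] \<tau>_m less_iff[of i j] by (auto simp: cart_parent_def side_def)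
      qed
      then show ?thesis using transp by (simp add: successively_conv_sorted_wrt)
    next
      case 2
      have "successively (\<lambda>u v. pt_less T v u) p"
        using steps
      proof (rule successively_mono)
        fix i j assume "parent i j \<and> side m j = side m b \<and> (i = m \<or> side m i = side m b)"
        then show "pt_less T j i"
          using 2 parent_less[of i j] \<tau>_m less_iff[of j i] by (auto simp: cart_parent_def side_def)
      qed
      moreover have "transp (\<lambda>u v. pt_less T v u)" using transp by (auto simp: transp_def)
      ultimately show ?thesis by (simp add: successively_conv_sorted_wrt)
    qed
  qed auto
qed

end

text \<open>Only the order of the values on each side matters: across \<open>m\<close> no position but \<open>m\<close> is an ancestor,
  and abscissas of opposite signs compare in the same way whatever their size.\<close>

lemma cartesian_tree_cong:
  assumes "alternating_sequence M m \<tau>" "alternating_sequence M m \<tau>'"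
    and same_order: "\<And>i j. i < M \<Longrightarrow> j < M \<Longrightarrow> side m i = side m j \<Longrightarrow> \<tau> i \<le> \<tau> j \<longleftrightarrow> \<tau>' i \<le> \<tau>' j"
  shows "cartesian_tree M m \<tau> = cartesian_tree M m \<tau>'"
proof -
  interpret A: alternating_sequence M m \<tau> by fact
  interpret B: alternating_sequence M m \<tau>' by fact
  have anc: "cart_anc \<tau> i j \<longleftrightarrow> cart_anc \<tau>' i j" if ij: "i < M" "j < M" for i j
  proof (cases "i \<noteq> m \<and> m \<in> {min i j..max i j}")
    case True
    then have "\<not> cart_anc \<tau> i j" "\<not> cart_anc \<tau>' i j"
      using A.\<tau>_m B.\<tau>_m A.\<tau>_pos[of i] B.\<tau>_pos[of i] ij by (force simp: cart_anc_def)+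
    then show ?thesis by simp
  next
    case False
    show ?thesis
    proof (cases "i = m")
      case True
      then show ?thesis using A.anc_root B.anc_root ij by simp
    next
      case i: False
      have "\<tau> i \<le> \<tau> k \<longleftrightarrow> \<tau>' i \<le> \<tau>' k" if "k \<in> {min i j..max i j}" for k
        using that i False ij by (intro same_order) (auto simp: side_def)
      then show ?thesis by (auto simp: cart_anc_def)
    qed
  qed
  have parent: "cart_parent M \<tau> = cart_parent M \<tau>'"
  proof (intro ext)
    show "cart_parent M \<tau> i j = cart_parent M \<tau>' i j" for i j
      unfolding cart_parent_def using anc by blast
  qed
  have "side m i * \<tau> i \<le> side m j * \<tau> j \<longleftrightarrow> side m i * \<tau>' i \<le> side m j * \<tau>' j"
    if ij: "i < M" "j < M" for i j
  proof (cases "side m i = side m j")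
    case True
    consider "side m i = 1" | "side m i = 0" | "side m i = - 1"
      by (metis side_def)
    then show ?thesis
      using same_order[OF ij True] same_order[OF ij(2,1) True[symmetric]] True by cases auto
  next
    case False
    have sign: "0 \<le> \<tau> i" "0 \<le> \<tau> j" "0 \<le> \<tau>' i" "0 \<le> \<tau>' j"
      using A.\<tau>_nonneg B.\<tau>_nonneg ij by blast+
    have pos: "k \<noteq> m \<Longrightarrow> 0 < \<tau> k \<and> 0 < \<tau>' k" if "k < M" for k
      using A.\<tau>_pos B.\<tau>_pos that by blast
    have "side m k = 1 \<or> side m k = 0 \<or> side m k = - 1" for k by (metis side_def)
    from this[of i] this[of j] False consider "side m i \<le> 0" "0 \<le> side m j" "side m i < 0 \<or> 0 < side m j"
      | "side m j \<le> 0" "0 \<le> side m i" "side m j < 0 \<or> 0 < side m i"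
      by fastforce
    then show ?thesis
    proof cases
      case 1
      then have "side m i * \<tau> i \<le> side m j * \<tau> j" "side m i * \<tau>' i \<le> side m j * \<tau>' j"
        using sign by (meson mult_nonneg_nonneg mult_nonpos_nonneg order_trans)+
      then show ?thesis by simp
    next
      case 2
      have "side m j * \<sigma> j < side m i * \<sigma> i"
        if "0 \<le> \<sigma> i" "0 \<le> \<sigma> j" "i \<noteq> m \<longrightarrow> 0 < \<sigma> i" "j \<noteq> m \<longrightarrow> 0 < \<sigma> j" for \<sigma> :: "nat \<Rightarrow> real"
      proof -
        have "side m j * \<sigma> j \<le> 0" "0 \<le> side m i * \<sigma> i"
          using 2 that by (simp_all add: mult_nonpos_nonneg)
        moreover have "side m j * \<sigma> j < 0 \<or> 0 < side m i * \<sigma> i"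
          using 2(3)
        proof
          assume "side m j < 0"
          moreover from this have "j \<noteq> m" by (auto simp: side_def)
          ultimately show ?thesis using that by (simp add: mult_neg_pos)
        next
          assume "0 < side m i"
          moreover from this have "i \<noteq> m" by (auto simp: side_def)
          ultimately show ?thesis using that by simp
        qed
        ultimately show ?thesis by linarith
      qed
      then have "side m j * \<tau> j < side m i * \<tau> i" "side m j * \<tau>' j < side m i * \<tau>' i"
        using sign pos ij by blast+
      then show ?thesis by simp
    qed
  qed
  then have "{(i, j). i < M \<and> j < M \<and> side m i * \<tau> i \<le> side m j * \<tau> j} =
      {(i, j). i < M \<and> j < M \<and> side m i * \<tau>' i \<le> side m j * \<tau>' j}"
    by blast
  then show ?thesis by (simp add: cartesian_tree_def parent)
qed


section \<open>From gluing data to the Poincare-Reeb tree\<close>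

text \<open>The data from which the quotient of \<open>D\<close> is reconstructed. The path \<open>P i\<close> runs along the \<open>i\<close>-th
  half-branch, parametrized by the distance from the axis, until it leaves \<open>D\<close> at time \<open>\<tau> i\<close>. Every
  vertical component meets one of these paths, and \<open>P i\<close> and \<open>P j\<close> are in the same component at time \<open>t\<close>
  as long as none of the half-branches between them has left. So the image of \<open>P i\<close> in the quotient is
  the geodesic from the root to the \<open>i\<close>-th vertex, and the assumption \<open>branch_closed\<close>, that its preimage in
  \<open>D\<close> is closed, carries all the topology that is needed.\<close>

locale PR_model = alternating_sequence M m \<tau>
  for M m :: nat and \<tau> :: "nat \<Rightarrow> real" +
  fixes D :: "(real \<times> real) set" and P :: "nat \<Rightarrow> real \<Rightarrow> real \<times> real"
  assumes P_cont: "i < M \<Longrightarrow> continuous_on {0..\<tau> i} (P i)"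
    and P_in: "i < M \<Longrightarrow> t \<in> {0..\<tau> i} \<Longrightarrow> P i t \<in> D"
    and P_fst: "i < M \<Longrightarrow> t \<in> {0..\<tau> i} \<Longrightarrow> fst (P i t) = side m i * t"
    and P_root: "P m 0 = (0, 0)"
    and cover: "p \<in> D \<Longrightarrow> \<exists>i<M. \<exists>t\<in>{0..\<tau> i}. PR_class D p = PR_class D (P i t)"
    and glue: "i < M \<Longrightarrow> j < M \<Longrightarrow> t \<in> {0..\<tau> i} \<Longrightarrow> t \<in> {0..\<tau> j} \<Longrightarrow>
      PR_class D (P i t) = PR_class D (P j t) \<longleftrightarrow> (\<forall>k\<in>{min i j..max i j}. t \<le> \<tau> k)"
    and branch_closed: "i < M \<Longrightarrow>
      closedin (top_of_set D) {p \<in> D. \<exists>t\<in>{0..\<tau> i}. PR_class D p = PR_class D (P i t)}"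
    and verts_eq: "PR_verts D = (\<lambda>i. PR_class D (P i (\<tau> i))) ` {..<M}"
    and stacked: "i < j \<Longrightarrow> j < M \<Longrightarrow> side m i = side m j \<Longrightarrow> t \<in> {0..\<tau> i} \<Longrightarrow> t \<in> {0..\<tau> j} \<Longrightarrow>
      PR_class D (P i t) \<noteq> PR_class D (P j t) \<Longrightarrow>
      PR_lies_below (PR_class D (P i t)) (PR_class D (P j t))"
begin

abbreviation "X \<equiv> PR_space D"

definition cl :: "nat \<Rightarrow> real \<Rightarrow> (real \<times> real) set" where
  "cl i t = PR_class D (P i t)"

definition vert :: "nat \<Rightarrow> (real \<times> real) set" where
  "vert i = cl i (\<tau> i)"

definition open_edge :: "nat \<Rightarrow> (real \<times> real) set set" where
  "open_edge j = {cl j t |t. \<tau> (par j) < t \<and> t < \<tau> j}"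

lemma parentD:
  assumes "parent i j"
  shows "i < M" "j < M" "i \<noteq> j" "anc i j" "\<tau> i < \<tau> j" "i = par j" "j \<noteq> m"
  using assms parent_less[OF assms] parent_iff[of i j] by (simp_all add: cart_parent_def)

lemma class_in: "p \<in> D \<Longrightarrow> PR_class D p \<in> topspace X"
  by (auto simp: topspace_PR_space PR_class_def quotient_def)

lemma self_in_class: "p \<in> D \<Longrightarrow> p \<in> PR_class D p"
  using equiv_class_self[OF equiv_PR_rel] by (simp add: PR_class_def)

lemma class_of_topspace:
  assumes "c \<in> topspace X"
  obtains p where "p \<in> D" "c = PR_class D p"
  using assms by (auto simp: topspace_PR_space PR_class_def quotient_def)

lemma class_eq_fst:
  assumes "p \<in> D" "q \<in> D" "PR_class D p = PR_class D q"
  shows "fst p = fst q"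
  using assms PR_abscissa_class by metis

lemma abs_fst_P: "i < M \<Longrightarrow> t \<in> {0..\<tau> i} \<Longrightarrow> \<bar>fst (P i t)\<bar> = t"
  using P_fst[of i t] \<tau>_m by (auto simp: side_def)

lemma cl_eq_iff:
  assumes "i < M" "j < M" "t \<in> {0..\<tau> i}" "t' \<in> {0..\<tau> j}"
  shows "cl i t = cl j t' \<longleftrightarrow> t = t' \<and> (\<forall>k\<in>{min i j..max i j}. t \<le> \<tau> k)"
proof -
  have "t = t'" if "cl i t = cl j t'"
    using class_eq_fst[of "P i t" "P j t'"] that abs_fst_P[of i t] abs_fst_P[of j t'] P_in assms
    by (simp add: cl_def)
  then show ?thesis using glue[of i j t] assms by (auto simp: cl_def)
qed

lemma cl_in: "i < M \<Longrightarrow> t \<in> {0..\<tau> i} \<Longrightarrow> cl i t \<in> topspace X"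
  unfolding cl_def by (intro class_in P_in)

lemma vert_eq_cl: "i < M \<Longrightarrow> j < M \<Longrightarrow> anc i j \<Longrightarrow> cl j (\<tau> i) = vert i"
  unfolding vert_def using \<tau>_nonneg anc_le[of i j]
  by (subst cl_eq_iff) (auto simp: cart_anc_def min.commute max.commute)

lemma vert_inj: "inj_on vert {..<M}"
proof (rule inj_onI)
  fix i j assume ij: "i \<in> {..<M}" "j \<in> {..<M}" "vert i = vert j"
  then have *: "\<tau> i = \<tau> j" "\<forall>k\<in>{min i j..max i j}. \<tau> i \<le> \<tau> k"
    using cl_eq_iff[of i j "\<tau> i" "\<tau> j"] \<tau>_nonneg by (auto simp: vert_def)
  show "i = j"
  proof (rule ccontr)
    assume "i \<noteq> j"
    then obtain k where "k \<in> {min i j..max i j}" "\<tau> k < \<tau> i"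
      using separated[of i j] * ij by auto
    then show False using * by force
  qed
qed

lemma verts_eq': "PR_verts D = vert ` {..<M}"
  by (simp add: verts_eq vert_def cl_def)

lemma vert_eq_iff: "i < M \<Longrightarrow> j < M \<Longrightarrow> vert i = vert j \<longleftrightarrow> i = j"
  using vert_inj by (auto simp: inj_on_def)

text \<open>If the \<open>k\<close>-th vertex were on the edge, \<open>k\<close> would be a proper ancestor of \<open>j\<close> that is higher than the
  parent of \<open>j\<close>.\<close>

lemma edge_not_vertex:
  assumes "parent i j" "\<tau> i < t" "t < \<tau> j"
  shows "cl j t \<notin> PR_verts D"
proof
  have ij: "i < M" "j < M" using assms by (auto simp: cart_parent_def)
  assume "cl j t \<in> PR_verts D"
  then obtain k where k: "k < M" "cl j t = cl k (\<tau> k)" by (auto simp: verts_eq' vert_def)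
  then have t: "t = \<tau> k" and below: "\<forall>l\<in>{min j k..max j k}. t \<le> \<tau> l"
    using cl_eq_iff[of j k t "\<tau> k"] ij assms \<tau>_nonneg[of i] \<tau>_nonneg[of k] by auto
  then have "anc k j" by (simp add: cart_anc_def min.commute max.commute)
  moreover have "k \<noteq> j" using t assms by auto
  ultimately have "anc k i" using assms(1) k by (auto simp: cart_parent_def)
  then show False using anc_le t assms by fastforce
qed

lemma edge_path:
  assumes "parent i j"
  shows "PR_edge D (vert i) (vert j) (\<lambda>s. cl j ((1 - s) * \<tau> i + s * \<tau> j))"
proof -
  have ij: "i < M" "j < M" "anc i j" "\<tau> i < \<tau> j"
    using assms parent_less by (auto simp: cart_parent_def)
  define r where "r s = (1 - s) * \<tau> i + s * \<tau> j" for s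
  have r_alt: "r s = \<tau> i + s * (\<tau> j - \<tau> i)" for s by (simp add: r_def algebra_simps)
  have r_mono: "r s < r s' \<longleftrightarrow> s < s'" for s s' using ij by (simp add: r_alt)
  have r01: "r 0 = \<tau> i" "r 1 = \<tau> j" by (simp_all add: r_def)
  have r_range: "r s \<in> {0..\<tau> j}" if "s \<in> {0..1}" for s
    using r_mono[of s 0] r_mono[of 1 s] r01 that \<tau>_nonneg[OF ij(1)] by auto
  have "continuous_on {0..1} r" unfolding r_def by (intro continuous_intros)
  then have "continuous_on {0..1} (\<lambda>s. P j (r s))"
    using continuous_on_compose2[OF P_cont[OF ij(2)]] r_range by blast
  then have "continuous_map (top_of_set {0..1}) (top_of_set D) (\<lambda>s. P j (r s))"
    using P_in[OF ij(2)] r_range by (auto simp: continuous_map_subtopology_eu)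
  then have "pathin X (\<lambda>s. cl j (r s))"
    using continuous_map_compose[OF _ quotient_imp_continuous_map[OF quotient_map_PR_class]]
    unfolding pathin_def cl_def o_def by blast
  moreover have "inj_on (\<lambda>s. cl j (r s)) {0..1}"
  proof (rule inj_onI)
    fix s s' assume s: "s \<in> {0..1}" "s' \<in> {0..1}" "cl j (r s) = cl j (r s')"
    then have "r s = r s'" using cl_eq_iff[of j j "r s" "r s'"] ij r_range by auto
    then show "s = s'" using r_mono by (metis less_irrefl linorder_neq_iff)
  qed
  moreover have "cl j (r s) \<notin> PR_verts D" if "s \<in> {0<..<1}" for s
    using edge_not_vertex[OF assms, of "r s"] r_mono[of 0 s] r_mono[of s 1] r01 that by auto
  then have "(\<lambda>s. cl j (r s)) ` {0<..<1} \<inter> PR_verts D = {}" by blast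
  moreover have "vert i \<in> PR_verts D" "vert j \<in> PR_verts D" using ij by (auto simp: verts_eq')
  moreover have "cl j (r 0) = vert i" "cl j (r 1) = vert j"
    using r01 vert_eq_cl[of i j] ij by (simp_all add: vert_def)
  ultimately show ?thesis
    unfolding PR_edge_def r_def[symmetric] by blast
qed

lemma PR_edge_reverse:
  assumes "PR_edge D u v g"
  shows "PR_edge D v u (\<lambda>s. g (1 - s))"
proof -
  have "(\<lambda>s. g (1 - s)) ` {0<..<1} \<subseteq> g ` {0<..<1}"
    by (auto intro!: image_eqI[where f = g])
  moreover have "inj_on (\<lambda>s. g (1 - s)) {0..1}"
  proof (rule inj_onI)
    fix s s' :: real assume s: "s \<in> {0..1}" "s' \<in> {0..1}" "g (1 - s) = g (1 - s')"
    have "inj_on g {0..1}" using assms by (simp add: PR_edge_def)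
    from inj_onD[OF this s(3)] s(1,2) show "s = s'" by simp
  qed
  moreover have "pathin X (\<lambda>s. g (1 - s))"
  proof -
    have "continuous_map (top_of_set {0..1}) (top_of_set {0..1::real}) (\<lambda>s. 1 - s)"
      by (auto simp: continuous_map_subtopology_eu intro!: continuous_intros)
    then show ?thesis
      using assms continuous_map_compose[of _ _ "\<lambda>s. 1 - s" X g]
      unfolding PR_edge_def pathin_def o_def by blast
  qed
  ultimately show ?thesis using assms by (auto simp: PR_edge_def)
qed

lemma open_edge_disjoint:
  assumes "parent i j" "parent i' j'" "\<tau> i < t" "t < \<tau> j" "\<tau> i' < t'" "t' < \<tau> j'"
    and "cl j t = cl j' t'"
  shows "j = j'"
proof -
  have ij: "i < M" "j < M" "i' < M" "j' < M" using assms by (auto simp: cart_parent_def)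
  then have t: "t = t'" and above: "\<forall>k\<in>{min j j'..max j j'}. t \<le> \<tau> k"
    using cl_eq_iff[of j j' t t'] assms \<tau>_nonneg[of i] \<tau>_nonneg[of i'] by auto
  obtain k where k: "k \<in> {min j j'..max j j'}" "k < M" "anc k j" "anc k j'"
    using lowest_between ij by blast
  have "t \<le> \<tau> k" using above k(1) by blast
  have "k = j"
  proof (rule ccontr)
    assume "k \<noteq> j"
    then have "anc k i" using assms(1) k by (auto simp: cart_parent_def)
    then show False using anc_le[of k i] \<open>t \<le> \<tau> k\<close> assms by simp
  qed
  moreover have "k = j'"
  proof (rule ccontr)
    assume "k \<noteq> j'"
    then have "anc k i'" using assms(2) k by (auto simp: cart_parent_def)
    then show False using anc_le[of k i'] \<open>t \<le> \<tau> k\<close> assms t by simp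
  qed
  ultimately show ?thesis by simp
qed

text \<open>A point on the geodesic to the \<open>k\<close>-th vertex at time \<open>t\<close> lies on the edge that ends in \<open>j\<close>, where \<open>j\<close>
  is the first ancestor of \<open>k\<close> on the way from the root with \<open>\<tau> j\<close> at least \<open>t\<close>.\<close>

lemma open_edges_cover:
  assumes "c \<in> topspace X" "c \<notin> PR_verts D"
  obtains i j where "parent i j" "c \<in> open_edge j"
proof -
  obtain p where p: "p \<in> D" "c = PR_class D p" using assms class_of_topspace by blast
  obtain k t where k: "k < M" "t \<in> {0..\<tau> k}" and c: "c = cl k t" using cover[OF p(1)] p(2) by (auto simp: cl_def)
  define S where "S = {j. j < M \<and> anc j k \<and> t \<le> \<tau> j}"
  have S: "finite S" "S \<noteq> {}" using k anc_refl by (auto simp: S_def)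
  define j where "j = arg_min_on \<tau> S"
  have "j \<in> S" unfolding j_def using S by (rule arg_min_if_finite)
  then have j: "j < M" "anc j k" "t \<le> \<tau> j" by (auto simp: S_def)
  have least: "\<tau> j \<le> \<tau> l" if "l \<in> S" for l unfolding j_def using S that by (intro arg_min_least) auto
  have "t \<le> \<tau> l" if "l \<in> {min k j..max k j}" for l
    using j(2,3) that unfolding cart_anc_def by (metis min.commute max.commute order_trans)
  then have cj: "c = cl j t" using c cl_eq_iff[of k j t t] k j by auto
  have "t \<noteq> \<tau> j" using assms(2) cj j(1) by (auto simp: verts_eq' vert_def)
  then have tj: "t < \<tau> j" using j(3) by simp
  then have "j \<noteq> m" using \<tau>_m k(2) by auto
  then obtain i where i: "parent i j" using parent_exists j(1) by blast
  have "\<tau> i < t"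
  proof (rule ccontr)
    assume "\<not> \<tau> i < t"
    then have "i \<in> S" using i j(2) anc_trans[of i j k] by (auto simp: S_def cart_parent_def)
    then show False using least parent_less[OF i] by fastforce
  qed
  then have "c \<in> open_edge j" using i tj cj by (auto simp: open_edge_def parent_iff)
  then show thesis using that i by blast
qed

lemma closedin_abscissa:
  "closedin (top_of_set D) {p \<in> D. \<bar>fst p\<bar> \<le> a}" "closedin (top_of_set D) {p \<in> D. a \<le> \<bar>fst p\<bar>}"
proof -
  have "closed {p::real \<times> real. \<bar>fst p\<bar> \<le> a}" "closed {p::real \<times> real. a \<le> \<bar>fst p\<bar>}"
    by (auto intro!: closed_Collect_le continuous_intros)
  from this[THEN closedin_closed_Int, of D] show "closedin (top_of_set D) {p \<in> D. \<bar>fst p\<bar> \<le> a}"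
      "closedin (top_of_set D) {p \<in> D. a \<le> \<bar>fst p\<bar>}"
    by (simp_all add: Int_def)
qed

text \<open>The complement of an open edge is the union of the branches that do not run through it, of
  the part closer to the axis and of the part farther away. These are finitely many closed sets.\<close>

lemma openin_open_edge:
  assumes "parent i j"
  shows "openin X (open_edge j)"
proof -
  have ij: "i < M" "j < M" "\<tau> i < \<tau> j" "i = par j"
    using parentD[OF assms] by simp_all
  define C where "C k = {p \<in> D. \<exists>t\<in>{0..\<tau> k}. PR_class D p = cl k t}" for k
  define N where "N = {k. k < M \<and> \<not> anc j k}"
  have sub: "open_edge j \<subseteq> topspace X"
    using cl_in[OF ij(2)] \<tau>_nonneg[OF ij(1)] by (force simp: open_edge_def ij(4)[symmetric])
  have "D - {p \<in> D. PR_class D p \<in> open_edge j} =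
      {p \<in> D. \<bar>fst p\<bar> \<le> \<tau> i} \<union> {p \<in> D. \<tau> j \<le> \<bar>fst p\<bar>} \<union> \<Union>(C ` N)" (is "_ = ?R")
  proof (intro set_eqI iffI)
    fix p assume p: "p \<in> D - {p \<in> D. PR_class D p \<in> open_edge j}"
    obtain k t where k: "k < M" "t \<in> {0..\<tau> k}" "PR_class D p = cl k t"
      using cover[of p] p by (auto simp: cl_def)
    have t: "t = \<bar>fst p\<bar>"
      using class_eq_fst[of p "P k t"] k p P_in abs_fst_P[of k t] by (simp add: cl_def)
    show "p \<in> ?R"
    proof (cases "\<tau> i < t \<and> t < \<tau> j")
      case True
      have "\<not> anc j k"
      proof
        assume jk: "anc j k"
        then have "t \<le> \<tau> l" if "l \<in> {min k j..max k j}" for l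
          using that True unfolding cart_anc_def by (metis min.commute max.commute less_imp_le order_trans)
        then have "cl k t = cl j t" using cl_eq_iff[of k j t t] k ij True by auto
        then show False using p k True ij by (auto simp: open_edge_def)
      qed
      then have "p \<in> C k" "k \<in> N" using p k by (auto simp: C_def N_def)
      then show ?thesis by blast
    qed (use p t in auto)
  next
    fix p assume p: "p \<in> ?R"
    then have D: "p \<in> D" by (auto simp: C_def)
    have "False" if on_edge: "PR_class D p \<in> open_edge j"
    proof -
      obtain t where t: "PR_class D p = cl j t" "\<tau> i < t" "t < \<tau> j"
        using on_edge ij by (auto simp: open_edge_def)
      then have t_in: "t \<in> {0..\<tau> j}" using \<tau>_nonneg[OF ij(1)] by simp
      then have "t = \<bar>fst p\<bar>"
        using class_eq_fst[of p "P j t"] t D P_in ij abs_fst_P[of j t] by (simp add: cl_def)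
      then obtain k where "k \<in> N" "p \<in> C k" using p t by auto
      then obtain t' where k: "k < M" "\<not> anc j k" "t' \<in> {0..\<tau> k}" "cl j t = cl k t'"
        using t by (auto simp: C_def N_def)
      then have above: "\<forall>l\<in>{min j k..max j k}. t \<le> \<tau> l" using cl_eq_iff[of j k t t'] ij t_in by auto
      obtain l where l: "l \<in> {min j k..max j k}" "l < M" "anc l j" "anc l k"
        using lowest_between k ij by blast
      then have "l \<noteq> j" using k by auto
      then have "anc l i" using assms l by (auto simp: cart_parent_def)
      then have "\<tau> l \<le> \<tau> i" by (rule anc_le)
      then show False using above l t by force
    qed
    then show "p \<in> D - {p \<in> D. PR_class D p \<in> open_edge j}" using D by blast
  qed
  moreover have "closedin (top_of_set D) ?R"
  proof (intro closedin_Un closedin_abscissa closedin_Union)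
    show "finite (C ` N)" by (simp add: N_def)
    show "closedin (top_of_set D) A" if "A \<in> C ` N" for A
      using that branch_closed by (auto simp: C_def N_def cl_def)
  qed
  ultimately have "openin (top_of_set D) {p \<in> D. PR_class D p \<in> open_edge j}"
    by (simp add: openin_closedin_eq)
  then show ?thesis using quotient_map_PR_class[of D] sub by (simp add: quotient_map_def)
qed

lemma closedin_edge:
  assumes "parent i j"
  shows "closedin X {cl j t |t. \<tau> i \<le> t \<and> t \<le> \<tau> j}" (is "closedin X ?K")
proof -
  have ij: "i < M" "j < M" using assms by (auto simp: cart_parent_def)
  have sub: "?K \<subseteq> topspace X"
  proof
    fix c assume "c \<in> ?K"
    then obtain t where "c = cl j t" "\<tau> i \<le> t" "t \<le> \<tau> j" by blast
    then show "c \<in> topspace X" using cl_in[OF ij(2), of t] \<tau>_nonneg[OF ij(1)] by simp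
  qed
  have "{p \<in> D. PR_class D p \<in> ?K} =
      {p \<in> D. \<exists>t\<in>{0..\<tau> j}. PR_class D p = PR_class D (P j t)} \<inter> {p \<in> D. \<tau> i \<le> \<bar>fst p\<bar>}"
  proof -
    have abs: "\<bar>fst p\<bar> = t" if "p \<in> D" "t \<in> {0..\<tau> j}" "PR_class D p = PR_class D (P j t)" for p t
      using class_eq_fst[of p "P j t"] that P_in ij abs_fst_P[of j t] by simp
    have "(\<exists>t. PR_class D p = cl j t \<and> \<tau> i \<le> t \<and> t \<le> \<tau> j) \<longleftrightarrow>
        (\<exists>t\<in>{0..\<tau> j}. PR_class D p = PR_class D (P j t)) \<and> \<tau> i \<le> \<bar>fst p\<bar>" if p: "p \<in> D" for p
    proof
      assume "\<exists>t. PR_class D p = cl j t \<and> \<tau> i \<le> t \<and> t \<le> \<tau> j"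
      then obtain t where t: "PR_class D p = PR_class D (P j t)" "\<tau> i \<le> t" "t \<le> \<tau> j"
        by (auto simp: cl_def)
      then have "t \<in> {0..\<tau> j}" using \<tau>_nonneg[OF ij(1)] by simp
      then show "(\<exists>t\<in>{0..\<tau> j}. PR_class D p = PR_class D (P j t)) \<and> \<tau> i \<le> \<bar>fst p\<bar>"
        using abs[OF p _ t(1)] t by blast
    next
      assume "(\<exists>t\<in>{0..\<tau> j}. PR_class D p = PR_class D (P j t)) \<and> \<tau> i \<le> \<bar>fst p\<bar>"
      then obtain t where t: "t \<in> {0..\<tau> j}" "PR_class D p = PR_class D (P j t)" "\<tau> i \<le> \<bar>fst p\<bar>"
        by blast
      then show "\<exists>t. PR_class D p = cl j t \<and> \<tau> i \<le> t \<and> t \<le> \<tau> j"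
        using abs[OF p t(1,2)] unfolding cl_def by (intro exI[of _ t]) simp
    qed
    then show ?thesis by blast
  qed
  then have "closedin (top_of_set D) {p \<in> D. PR_class D p \<in> ?K}"
    using branch_closed[OF ij(2)] closedin_abscissa by (simp add: closedin_Int)
  moreover have "\<forall>U \<subseteq> topspace X.
      closedin (top_of_set D) {p \<in> D. PR_class D p \<in> U} = closedin X U"
    using quotient_map_PR_class[of D] by (simp add: quotient_map_closedin)
  ultimately show ?thesis using sub by blast
qed

text \<open>The open edges are disjoint open sets and cover everything but the vertices, so an arc that
  avoids the vertices runs along a single edge, from one end to the other.\<close>

lemma PR_edge_runs_along_edge:
  assumes g: "PR_edge D u v g"
  obtains i j where "parent i j" "g ` {0<..<1} \<subseteq> open_edge j"
    "u = vert i \<and> v = vert j \<or> u = vert j \<and> v = vert i"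
proof -
  have cont: "continuous_map (top_of_set {0..1}) X g" using g by (simp add: PR_edge_def pathin_def)
  have g_in: "g s \<in> topspace X" if "s \<in> {0..1}" for s
    using cont that by (auto simp: continuous_map_def)
  have g_vert: "g s \<notin> PR_verts D" if "s \<in> {0<..<1}" for s
    using g that unfolding PR_edge_def by blast
  define A where "A j = {s \<in> {0<..<1}. g s \<in> open_edge j}" for j
  have open_A: "open (A j)" if "parent i j" for i j
  proof -
    have "openin (top_of_set {0..1}) {s \<in> {0..1}. g s \<in> open_edge j}"
      using openin_continuous_map_preimage[OF cont openin_open_edge[OF that]] by simp
    then obtain U where U: "open U" "{s \<in> {0..1}. g s \<in> open_edge j} = {0..1} \<inter> U"
      by (auto simp: openin_open)
    have "A j = {0<..<1} \<inter> U"
    proof (intro set_eqI)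
      fix s show "s \<in> A j \<longleftrightarrow> s \<in> {0<..<1} \<inter> U"
        using eqset_imp_iff[OF U(2), of s] by (auto simp: A_def)
    qed
    then show ?thesis using U(1) by (simp add: open_Int)
  qed
  have A_cover: "\<exists>i j. parent i j \<and> s \<in> A j" if "s \<in> {0<..<1}" for s
    using open_edges_cover[of "g s"] g_in[of s] g_vert[OF that] that
    by (metis (mono_tags, lifting) A_def greaterThanLessThan_iff atLeastAtMost_iff less_imp_le mem_Collect_eq)
  obtain i j where ij: "parent i j" "1 / 2 \<in> A j" using A_cover[of "1 / 2"] by auto
  have ij': "i < M" "j < M" "i = par j" using parentD[OF ij(1)] by simp_all
  define B where "B = \<Union>{A j' |i' j'. parent i' j' \<and> j' \<noteq> j}"
  have "open B" unfolding B_def using open_A by (intro open_Union) blast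
  have "A j' \<inter> A j = {}" if "parent i' j'" "j' \<noteq> j" for i' j'
  proof -
    have False if s: "s \<in> A j'" "s \<in> A j" for s
    proof -
      obtain t' where t': "g s = cl j' t'" "\<tau> i' < t'" "t' < \<tau> j'"
        using s(1) \<open>parent i' j'\<close> by (auto simp: A_def open_edge_def parent_iff)
      obtain t where t: "g s = cl j t" "\<tau> i < t" "t < \<tau> j"
        using s(2) ij' by (auto simp: A_def open_edge_def)
      show False using open_edge_disjoint[OF \<open>parent i' j'\<close> ij(1) t'(2,3) t(2,3)] t t' \<open>j' \<noteq> j\<close> by simp
    qed
    then show ?thesis by blast
  qed
  then have "A j \<inter> B \<inter> {0<..<1} = {}" unfolding B_def by blast
  moreover have "{0<..<1} \<subseteq> A j \<union> B" unfolding B_def using A_cover by blast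
  moreover have "connected {0<..<1::real}" by simp
  moreover have "A j \<inter> {0<..<1} \<noteq> {}" using ij(2) unfolding A_def by blast
  ultimately have "B \<inter> {0<..<1} = {}"
    using connectedD[of "{0<..<1::real}" "A j" B] open_A[OF ij(1)] \<open>open B\<close> by blast
  then have sub: "g ` {0<..<1} \<subseteq> open_edge j"
    using \<open>{0<..<1} \<subseteq> A j \<union> B\<close> by (auto simp: A_def)
  define K where "K = {cl j t |t. \<tau> i \<le> t \<and> t \<le> \<tau> j}"
  have "closedin (top_of_set {0..1}) {s \<in> {0..1}. g s \<in> K}"
    using closedin_continuous_map_preimage[OF cont closedin_edge[OF ij(1)]] by (simp add: K_def)
  then have "closed {s \<in> {0..1}. g s \<in> K}" by (rule closedin_closed_trans) simp
  moreover have "{0<..<1} \<subseteq> {s \<in> {0..1}. g s \<in> K}"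
  proof
    fix s :: real assume s: "s \<in> {0<..<1}"
    then have "g s \<in> open_edge j" using sub by blast
    then show "s \<in> {s \<in> {0..1}. g s \<in> K}"
      using s ij' by (force simp: K_def open_edge_def)
  qed
  ultimately have "closure {0<..<1} \<subseteq> {s \<in> {0..1}. g s \<in> K}" by (rule closure_minimal[rotated])
  moreover have "0 \<in> closure {0<..<1::real}" "1 \<in> closure {0<..<1::real}" by simp_all
  ultimately have ends: "g 0 \<in> K" "g 1 \<in> K" by blast+
  have end_vertex: "c = vert i \<or> c = vert j" if c: "c \<in> K" "c \<in> PR_verts D" for c
  proof -
    obtain t where t: "c = cl j t" "\<tau> i \<le> t" "t \<le> \<tau> j" using c(1) by (auto simp: K_def)
    have "t = \<tau> i \<or> t = \<tau> j" using edge_not_vertex[OF ij(1), of t] t c(2) by force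
    then show ?thesis using t vert_eq_cl[OF ij'(1,2)] ij(1) by (auto simp: vert_def cart_parent_def)
  qed
  have uv: "u = g 0" "v = g 1" "u \<in> PR_verts D" "v \<in> PR_verts D" using g by (auto simp: PR_edge_def)
  have "u \<noteq> v"
    using g inj_onD[of g "{0..1}" 0 1] uv by (auto simp: PR_edge_def)
  then show thesis using that[OF ij(1) sub] end_vertex[of u] end_vertex[of v] ends uv by auto
qed

lemma edge_iff:
  assumes "a < M" "b < M"
  shows "(a, b) \<in> pt_edges T \<longleftrightarrow> (vert a, vert b) \<in> pt_edges (PR_tree D)"
proof
  assume "(a, b) \<in> pt_edges T"
  then have "parent a b \<or> parent b a" by (simp add: cartesian_tree_def)
  then show "(vert a, vert b) \<in> pt_edges (PR_tree D)"
    using edge_path PR_edge_reverse unfolding PR_tree_def by fastforce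
next
  assume "(vert a, vert b) \<in> pt_edges (PR_tree D)"
  then obtain g where "PR_edge D (vert a) (vert b) g" by (auto simp: PR_tree_def)
  then obtain i j where ij: "parent i j"
      "vert a = vert i \<and> vert b = vert j \<or> vert a = vert j \<and> vert b = vert i"
    by (rule PR_edge_runs_along_edge)
  then have "a = i \<and> b = j \<or> a = j \<and> b = i"
    using vert_eq_iff assms by (auto simp: cart_parent_def)
  then show "(a, b) \<in> pt_edges T" using ij(1) by (auto simp: cartesian_tree_def)
qed

text \<open>Two edges with points of equal abscissa, one below the other, are distinct and on the same side of the axis.
  They cannot be the edge to and an edge from the common vertex, since these do not overlap in time. So
  both lead to children, and these are ordered like the half-branches.\<close>

lemma below_iff:
  assumes "v < M" "u < M" "w < M"
  shows "(v, u, w) \<in> pt_below T \<longleftrightarrow> (vert v, vert u, vert w) \<in> pt_below (PR_tree D)"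
proof
  assume "(v, u, w) \<in> pt_below T"
  then have *: "parent v u" "parent v w" "u < w" "side m u = side m w"
    by (auto simp: cartesian_tree_def)
  define x where "x = (\<tau> v + min (\<tau> u) (\<tau> w)) / 2"
  have lt: "\<tau> v < \<tau> u" "\<tau> v < \<tau> w" using parent_less * by auto
  then have x: "\<tau> v < x" "x < \<tau> u" "x < \<tau> w" by (auto simp: x_def min_def)
  have reach: "\<exists>s\<in>{0<..<1}. (1 - s) * \<tau> v + s * \<tau> j = x" if "\<tau> v < \<tau> j" "x < \<tau> j" for j
  proof (intro bexI[of _ "(x - \<tau> v) / (\<tau> j - \<tau> v)"])
    show "(1 - (x - \<tau> v) / (\<tau> j - \<tau> v)) * \<tau> v + (x - \<tau> v) / (\<tau> j - \<tau> v) * \<tau> j = x"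
    proof -
      define s where "s = (x - \<tau> v) / (\<tau> j - \<tau> v)"
      have "s * (\<tau> j - \<tau> v) = x - \<tau> v" using that by (simp add: s_def)
      then show ?thesis unfolding s_def[symmetric] by (simp add: algebra_simps)
    qed
    show "(x - \<tau> v) / (\<tau> j - \<tau> v) \<in> {0<..<1}" using that x by (simp add: field_simps)
  qed
  obtain s where s: "s \<in> {0<..<1}" "(1 - s) * \<tau> v + s * \<tau> u = x" using reach lt x by blast
  obtain t where t: "t \<in> {0<..<1}" "(1 - t) * \<tau> v + t * \<tau> w = x" using reach lt x by blast
  have "cl u x \<noteq> cl w x"
    using open_edge_disjoint[of v u v w x x] * x by auto
  then have "PR_lies_below (cl u x) (cl w x)"
    using stacked[of u w x] * x assms \<tau>_nonneg[of v] by (simp add: cl_def)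
  then have below: "PR_lies_below (cl u ((1 - s) * \<tau> v + s * \<tau> u)) (cl w ((1 - t) * \<tau> v + t * \<tau> w))"
    by (simp only: s(2) t(2))
  have "\<exists>s\<in>{0<..<1}. \<exists>t\<in>{0<..<1}. PR_lies_below
      (cl u ((1 - s) * \<tau> v + s * \<tau> u)) (cl w ((1 - t) * \<tau> v + t * \<tau> w))"
    using below s(1) t(1) by blast
  then show "(vert v, vert u, vert w) \<in> pt_below (PR_tree D)"
    using edge_path[OF *(1)] edge_path[OF *(2)] unfolding PR_tree_def by auto
next
  assume "(vert v, vert u, vert w) \<in> pt_below (PR_tree D)"
  then obtain g h s t where g: "PR_edge D (vert v) (vert u) g" and h: "PR_edge D (vert v) (vert w) h"
    and st: "s \<in> {0<..<1}" "t \<in> {0<..<1}" and below: "PR_lies_below (g s) (h t)"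
    by (auto simp: PR_tree_def)
  obtain i j where ij: "parent i j" "g ` {0<..<1} \<subseteq> open_edge j"
      "vert v = vert i \<and> vert u = vert j \<or> vert v = vert j \<and> vert u = vert i"
    using g by (rule PR_edge_runs_along_edge)
  obtain i' j' where ij': "parent i' j'" "h ` {0<..<1} \<subseteq> open_edge j'"
      "vert v = vert i' \<and> vert w = vert j' \<or> vert v = vert j' \<and> vert w = vert i'"
    using h by (rule PR_edge_runs_along_edge)
  have bounds: "i < M" "j < M" "i' < M" "j' < M" "i = par j" "i' = par j'" "j \<noteq> m" "j' \<noteq> m"
    using parentD[OF ij(1)] parentD[OF ij'(1)] by simp_all
  obtain x where x: "g s = cl j x" "\<tau> i < x" "x < \<tau> j"
  proof -
    have "g s \<in> open_edge j" using ij(2) st(1) by blast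
    then show thesis using that bounds(5) by (auto simp: open_edge_def)
  qed
  obtain x' where x': "h t = cl j' x'" "\<tau> i' < x'" "x' < \<tau> j'"
  proof -
    have "h t \<in> open_edge j'" using ij'(2) st(2) by blast
    then show thesis using that bounds(6) by (auto simp: open_edge_def)
  qed
  have pos: "0 < x" "0 < x'"
    using x x' \<tau>_nonneg[of i] \<tau>_nonneg[of i'] bounds by auto
  have mem: "P j x \<in> cl j x" "P j' x' \<in> cl j' x'"
    unfolding cl_def using pos x x' bounds by (intro self_in_class P_in; simp)+
  have lt: "fst (P j x) = fst (P j' x')" "snd (P j x) < snd (P j' x')"
    using below mem x x' by (auto simp: PR_lies_below_def)
  have "side m j * x = side m j' * x'"
    using lt(1) P_fst[of j x] P_fst[of j' x'] pos x x' bounds by simp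
  then have same: "side m j = side m j'" "x = x'"
    using pos bounds by (auto simp: side_def split: if_splits)
  have "j \<noteq> j'" using lt same by auto
  have "u < w \<and> v = i \<and> u = j \<and> v = i' \<and> w = j'"
  proof -
    have "v = i \<and> u = j \<or> v = j \<and> u = i" "v = i' \<and> w = j' \<or> v = j' \<and> w = i'"
      using ij(3) ij'(3) vert_eq_iff assms bounds by blast+
    moreover have "\<not> (v = i \<and> v = j')" "\<not> (v = j \<and> v = i')" using x x' same by auto
    ultimately have *: "v = i" "u = j" "v = i'" "w = j'" using \<open>j \<noteq> j'\<close> by auto
    have "\<not> j' < j"
    proof
      assume "j' < j"
      moreover have "cl j' x \<noteq> cl j x"
        using open_edge_disjoint[OF ij'(1) ij(1)] x x' same \<open>j \<noteq> j'\<close> by blast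
      ultimately have "PR_lies_below (cl j' x) (cl j x)"
        using stacked[of j' j x] bounds same x x' pos by (simp add: cl_def)
      then show False using mem lt same by (fastforce simp: PR_lies_below_def)
    qed
    then show ?thesis using * \<open>j \<noteq> j'\<close> by auto
  qed
  then show "(v, u, w) \<in> pt_below T"
    using ij(1) ij'(1) same by (auto simp: cartesian_tree_def)
qed

lemma PR_tree_isomorphic: "pt_isomorphic (PR_tree D) T"
proof -
  have root: "PR_class D (0, 0) = vert m" by (simp add: vert_def cl_def \<tau>_m P_root)
  have abscissa: "PR_abscissa (vert i) = side m i * \<tau> i" if "i < M" for i
    unfolding vert_def cl_def using that \<tau>_nonneg[OF that]
    by (subst PR_abscissa_class) (auto intro!: P_in P_fst)
  have "pt_isomorphism vert T (PR_tree D)"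
    unfolding pt_isomorphism_def
  proof (intro conjI ballI)
    show "bij_betw vert (pt_verts T) (pt_verts (PR_tree D))"
      using vert_inj by (simp add: bij_betw_def cartesian_tree_def PR_tree_def verts_eq')
    show "vert (pt_root T) = pt_root (PR_tree D)"
      by (simp add: cartesian_tree_def PR_tree_def root)
    fix a b assume "a \<in> pt_verts T" "b \<in> pt_verts T"
    then have ab: "a < M" "b < M" by (auto simp: cartesian_tree_def)
    show "((a, b) \<in> pt_edges T) = ((vert a, vert b) \<in> pt_edges (PR_tree D))"
      by (rule edge_iff[OF ab])
    show "((a, b) \<in> pt_preorder T) = ((vert a, vert b) \<in> pt_preorder (PR_tree D))"
      using ab abscissa by (auto simp: cartesian_tree_def PR_tree_def verts_eq')
    fix c assume "c \<in> pt_verts T"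
    then have "c < M" by (auto simp: cartesian_tree_def)
    then show "((a, b, c) \<in> pt_below T) = ((vert a, vert b, vert c) \<in> pt_below (PR_tree D))"
      using below_iff ab by blast
  qed
  moreover have "pt_isomorphism id T T" by (simp add: pt_isomorphism_def bij_betw_id)
  ultimately have "pt_isomorphic T (PR_tree D)" "pt_isomorphic T T"
    unfolding pt_isomorphic_def using m by (auto simp: cartesian_tree_def)
  then show ?thesis by (rule pt_isomorphic_same_source)
qed

end


section \<open>Half-branches of the polar curve\<close>

text \<open>The polar curve over \<open>0 < x < \<delta>\<close> within the strip \<open>\<bar>y\<bar> \<le> r\<close>: graphs of functions \<open>\<gamma> i\<close> that issue
  from the origin, numbered from bottom to top. On vertical lines \<open>f\<close> has its local minima at even and
  its local maxima at odd indices. The last two assumptions describe how \<open>f\<close> varies in between: from any point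
  one can go to a critical point on the same vertical line without increasing \<open>f\<close>, and \<open>f\<close> does not
  exceed the critical values on the way from one critical point to another.\<close>

locale polar_branches =
  fixes f fx fy :: "real \<times> real \<Rightarrow> real" and r \<delta> :: real and n :: nat and \<gamma> :: "nat \<Rightarrow> real \<Rightarrow> real"
  assumes odd_n: "odd n"
    and \<gamma>_cont: "i < n \<Longrightarrow> continuous_on {0..<\<delta>} (\<gamma> i)"
    and \<gamma>_0: "i < n \<Longrightarrow> \<gamma> i 0 = 0"
    and \<gamma>_range: "i < n \<Longrightarrow> x \<in> {0..<\<delta>} \<Longrightarrow> \<bar>\<gamma> i x\<bar> < r"
    and \<gamma>_less: "i < j \<Longrightarrow> j < n \<Longrightarrow> x \<in> {0<..<\<delta>} \<Longrightarrow> \<gamma> i x < \<gamma> j x"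
    and \<gamma>_zero: "x \<in> {0<..<\<delta>} \<Longrightarrow> \<bar>y\<bar> \<le> r \<Longrightarrow> fy (x, y) = 0 \<longleftrightarrow> (\<exists>i<n. y = \<gamma> i x)"
    and fx_nonzero: "i < n \<Longrightarrow> x \<in> {0<..<\<delta>} \<Longrightarrow> fx (x, \<gamma> i x) \<noteq> 0"
    and value_less: "i < n \<Longrightarrow> 0 \<le> a \<Longrightarrow> a < b \<Longrightarrow> b < \<delta> \<Longrightarrow> f (a, \<gamma> i a) < f (b, \<gamma> i b)"
    and value_even: "Suc i < n \<Longrightarrow> even i \<Longrightarrow> x \<in> {0<..<\<delta>} \<Longrightarrow> f (x, \<gamma> i x) < f (x, \<gamma> (Suc i) x)"
    and value_odd: "Suc i < n \<Longrightarrow> odd i \<Longrightarrow> x \<in> {0<..<\<delta>} \<Longrightarrow> f (x, \<gamma> (Suc i) x) < f (x, \<gamma> i x)"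
    and value_distinct: "i < n \<Longrightarrow> j < n \<Longrightarrow> i \<noteq> j \<Longrightarrow> x \<in> {0<..<\<delta>} \<Longrightarrow>
      f (x, \<gamma> i x) \<noteq> f (x, \<gamma> j x)"
    and descent: "x \<in> {0..<\<delta>} \<Longrightarrow> \<bar>y\<bar> \<le> r \<Longrightarrow>
      \<exists>i<n. \<forall>z\<in>closed_segment y (\<gamma> i x). f (x, z) \<le> f (x, y)"
    and pass: "i \<le> j \<Longrightarrow> j < n \<Longrightarrow> x \<in> {0..<\<delta>} \<Longrightarrow> y \<in> {\<gamma> i x..\<gamma> j x} \<Longrightarrow>
      \<exists>k\<in>{i..j}. f (x, y) \<le> f (x, \<gamma> k x)"

lemma isCont_tendsto_nhds: "isCont g l \<Longrightarrow> (g \<longlongrightarrow> g l) (nhds l)"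
  by (simp add: isCont_def tendsto_at_iff_tendsto_nhds)

lemma partial_y:
  fixes k :: "real \<times> real \<Rightarrow> real"
  assumes "\<And>p. (k has_derivative (\<lambda>v. fst v * kx p + snd v * ky p)) (at p)"
  shows "((\<lambda>y. k (x, y)) has_real_derivative ky (x, y)) (at y)"
proof -
  have "((\<lambda>y. (x, y)) has_derivative (\<lambda>v. (0, v))) (at y)"
    by (intro derivative_eq_intros) auto
  from has_derivative_compose[OF this assms[of "(x, y)"]]
  show ?thesis by (simp add: has_field_derivative_def mult_commute_abs)
qed

lemma strict_mono_sorted_list_of_set:
  fixes \<phi> :: "real \<Rightarrow> real"
  assumes "finite A" "\<And>a b. a \<in> A \<Longrightarrow> b \<in> A \<Longrightarrow> a < b \<Longrightarrow> \<phi> a < \<phi> b"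
  shows "sorted_list_of_set (\<phi> ` A) = map \<phi> (sorted_list_of_set A)"
proof -
  have "sorted_wrt (<) (sorted_list_of_set A)" by simp
  then have "sorted_wrt (\<lambda>a b. \<phi> a < \<phi> b) (sorted_list_of_set A)"
    by (rule sorted_wrt_mono_rel[rotated]) (use assms in auto)
  then have "sorted_wrt (<) (map \<phi> (sorted_list_of_set A))" by (simp add: sorted_wrt_map)
  moreover have "set (map \<phi> (sorted_list_of_set A)) = \<phi> ` A" using assms(1) by simp
  ultimately show ?thesis
    using assms(1) by (intro sorted_distinct_set_unique) (auto simp: strict_sorted_iff)
qed

text \<open>Along a curve on which \<open>\<partial>f/\<partial>y\<close> vanishes only the movement in the \<open>x\<close> direction changes \<open>f\<close>
  to first order; the curve is Lipschitz because the zero of \<open>\<partial>f/\<partial>y\<close> is simple.\<close>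

lemma critical_value_derivative:
  fixes f fy :: "real \<times> real \<Rightarrow> real" and \<gamma> :: "real \<Rightarrow> real"
  assumes f: "(f has_derivative (\<lambda>v. fst v * a + snd v * 0)) (at (x0, \<gamma> x0))"
    and fy: "(fy has_derivative (\<lambda>v. fst v * b + snd v * c)) (at (x0, \<gamma> x0))"
    and c: "c \<noteq> 0"
    and cont: "isCont \<gamma> x0"
    and zero: "\<forall>\<^sub>F x in nhds x0. fy (x, \<gamma> x) = 0"
  shows "((\<lambda>x. f (x, \<gamma> x)) has_real_derivative a) (at x0)"
proof -
  define y0 where "y0 = \<gamma> x0"
  have norm_le: "norm ((x, y) - (x0, y0)) \<le> \<bar>x - x0\<bar> + \<bar>y - y0\<bar>" for x y
    using norm_Pair_le[of "x - x0" "y - y0"] by simp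
  have near: "\<forall>\<^sub>F x in nhds x0. norm ((x, \<gamma> x) - (x0, y0)) < d" if "d > 0" for d
  proof -
    have "((\<lambda>x. (x, \<gamma> x)) \<longlongrightarrow> (x0, y0)) (nhds x0)"
      using isCont_tendsto_nhds[OF cont] filterlim_ident unfolding y0_def
      by (intro tendsto_Pair)
    from tendstoD[OF this that] show ?thesis unfolding dist_norm .
  qed
  define e where "e = \<bar>c\<bar> / 2"
  define C where "C = (\<bar>b\<bar> + e) / e"
  have e: "e > 0" using c by (simp add: e_def)
  have C: "C \<ge> 0" using e by (simp add: C_def)
  obtain d where d: "d > 0" "\<And>p. norm (p - (x0, y0)) < d \<Longrightarrow>
      norm (fy p - fy (x0, y0) - (fst (p - (x0, y0)) * b + snd (p - (x0, y0)) * c))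
        \<le> e * norm (p - (x0, y0))"
    using fy e unfolding has_derivative_at_alt y0_def by blast
  have zero0: "fy (x0, y0) = 0" using eventually_nhds_x_imp_x[OF zero] by (simp add: y0_def)
  have lipschitz: "\<forall>\<^sub>F x in nhds x0. \<bar>\<gamma> x - y0\<bar> \<le> C * \<bar>x - x0\<bar>"
    using near[OF d(1)] zero
  proof eventually_elim
    case (elim x)
    have "\<bar>(x - x0) * b + (\<gamma> x - y0) * c\<bar> \<le> e * norm ((x, \<gamma> x) - (x0, y0))"
      using d(2)[OF elim(1)] elim(2) zero0 by (simp add: abs_minus_commute)
    also have "\<dots> \<le> e * (\<bar>x - x0\<bar> + \<bar>\<gamma> x - y0\<bar>)" using norm_le e by (intro mult_left_mono) auto
    finally have "\<bar>(x - x0) * b + (\<gamma> x - y0) * c\<bar> \<le> e * \<bar>x - x0\<bar> + e * \<bar>\<gamma> x - y0\<bar>"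
      by (simp add: distrib_left)
    moreover have "\<bar>(\<gamma> x - y0) * c\<bar> \<le> \<bar>(x - x0) * b + (\<gamma> x - y0) * c\<bar> + \<bar>(x - x0) * b\<bar>" by linarith
    moreover have "\<bar>(\<gamma> x - y0) * c\<bar> = 2 * (e * \<bar>\<gamma> x - y0\<bar>)" "\<bar>(x - x0) * b\<bar> = \<bar>b\<bar> * \<bar>x - x0\<bar>"
      by (simp_all add: abs_mult e_def)
    ultimately have "e * \<bar>\<gamma> x - y0\<bar> \<le> (\<bar>b\<bar> + e) * \<bar>x - x0\<bar>" unfolding distrib_right by linarith
    then show ?case using e by (simp add: C_def pos_le_divide_eq mult.commute)
  qed
  show ?thesis
    unfolding has_field_derivative_def has_derivative_at_alt
  proof (intro conjI allI impI)
    show "bounded_linear ((*) a)" by (rule bounded_linear_mult_right)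
    fix \<epsilon> :: real assume \<epsilon>: "\<epsilon> > 0"
    define \<epsilon>' where "\<epsilon>' = \<epsilon> / (1 + C)"
    have \<epsilon>': "\<epsilon>' > 0" using \<epsilon> C by (simp add: \<epsilon>'_def)
    obtain d' where d': "d' > 0" "\<And>p. norm (p - (x0, y0)) < d' \<Longrightarrow>
        norm (f p - f (x0, y0) - (fst (p - (x0, y0)) * a + snd (p - (x0, y0)) * 0))
          \<le> \<epsilon>' * norm (p - (x0, y0))"
      using f \<epsilon>' unfolding has_derivative_at_alt y0_def by blast
    have "\<forall>\<^sub>F x in nhds x0. norm (f (x, \<gamma> x) - f (x0, \<gamma> x0) - a * (x - x0)) \<le> \<epsilon> * norm (x - x0)"
      using near[OF d'(1)] lipschitz
    proof eventually_elim
      case (elim x)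
      have "norm (f (x, \<gamma> x) - f (x0, \<gamma> x0) - a * (x - x0)) \<le> \<epsilon>' * norm ((x, \<gamma> x) - (x0, y0))"
        using d'(2)[OF elim(1)] by (simp add: y0_def mult.commute)
      also have "\<dots> \<le> \<epsilon>' * (\<bar>x - x0\<bar> + C * \<bar>x - x0\<bar>)"
        using norm_le[of x "\<gamma> x"] elim(2) \<epsilon>' by (intro mult_left_mono) auto
      also have "\<dots> = \<epsilon>' * (1 + C) * \<bar>x - x0\<bar>" by (simp add: algebra_simps)
      also have "\<epsilon>' * (1 + C) = \<epsilon>" using C by (simp add: \<epsilon>'_def)
      finally show ?case by simp
    qed
    then obtain d'' where "d'' > 0" "\<forall>x. dist x x0 < d'' \<longrightarrow>
        norm (f (x, \<gamma> x) - f (x0, \<gamma> x0) - a * (x - x0)) \<le> \<epsilon> * norm (x - x0)"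
      unfolding eventually_nhds_metric by blast
    then show "\<exists>d>0. \<forall>y. norm (y - x0) < d \<longrightarrow>
        norm (f (y, \<gamma> y) - f (x0, \<gamma> x0) - a * (y - x0)) \<le> \<epsilon> * norm (y - x0)"
      by (auto simp: dist_norm)
  qed
qed

lemma eventually_nonzero_on_compact_slice:
  fixes g :: "real \<times> real \<Rightarrow> real"
  assumes "continuous_on UNIV g" "compact K" "\<And>y. y \<in> K \<Longrightarrow> g (x0, y) \<noteq> 0"
  shows "\<forall>\<^sub>F x in nhds x0. \<forall>y\<in>K. g (x, y) \<noteq> 0"
proof -
  have "open (g -` (- {0}))" using assms(1) by (intro open_vimage) auto
  moreover have "{x0} \<times> K \<subseteq> g -` (- {0})" using assms(3) by auto
  ultimately obtain U where "x0 \<in> U" "open U" "U \<times> K \<subseteq> g -` (- {0})"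
    using Elementary_Topology.tube_lemma[OF assms(2), of "g -` (- {0})" x0] by blast
  then show ?thesis unfolding eventually_nhds by blast
qed

lemma no_zero_imp_same_sign:
  fixes g :: "real \<Rightarrow> real"
  assumes "continuous_on {min a b..max a b} g" "\<And>y. y \<in> {min a b..max a b} \<Longrightarrow> g y \<noteq> 0"
  shows "0 < g a \<longleftrightarrow> 0 < g b"
proof -
  have *: "\<not> (0 < g a \<and> g b < 0)" if "continuous_on {min a b..max a b} g"
    "\<And>y. y \<in> {min a b..max a b} \<Longrightarrow> g y \<noteq> 0" for a b
  proof
    assume sg: "0 < g a \<and> g b < 0"
    show False
    proof (cases "a \<le> b")
      case True
      then show False using IVT2'[of g b 0 a] sg that by force
    next
      case False
      then show False using IVT'[of g b 0 a] sg that by force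
    qed
  qed
  have "g a \<noteq> 0" "g b \<noteq> 0" using assms(2) by auto
  then show ?thesis using *[of a b] *[of b a] assms
    by (auto simp: min.commute max.commute not_less less_le)
qed

text \<open>The local situation on one side of the axis, with partial derivatives \<open>fx\<close>, \<open>fy\<close>, \<open>fyx\<close>, \<open>fyy\<close>, and
  with \<open>fy = g * h\<close> the separation of the polar curve into critical and noncritical points of \<open>f\<close>.\<close>

locale polar_half =
  fixes f fx fy fyx fyy g h :: "real \<times> real \<Rightarrow> real" and r \<delta> :: real
  assumes r: "r > 0" and \<delta>: "\<delta> > 0"
    and f_deriv: "(f has_derivative (\<lambda>v. fst v * fx p + snd v * fy p)) (at p)"
    and fy_deriv: "(fy has_derivative (\<lambda>v. fst v * fyx p + snd v * fyy p)) (at p)"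
    and cont_fyy: "continuous_on UNIV fyy"
    and cont_g: "continuous_on UNIV g" and cont_h: "continuous_on UNIV h"
    and f_0: "f (0, 0) = 0"
    and f_pos: "x \<in> {0<..<\<delta>} \<Longrightarrow> \<bar>y\<bar> \<le> r \<Longrightarrow> 0 < f (x, y)"
    and axis: "y \<noteq> 0 \<Longrightarrow> \<bar>y\<bar> \<le> r \<Longrightarrow> fy (0, y) \<noteq> 0"
    and simple: "x \<in> {0<..<\<delta>} \<Longrightarrow> fy (x, y) = 0 \<Longrightarrow> fyy (x, y) \<noteq> 0"
    and factor: "fy p = g p * h p"
    and g_zero: "g p = 0 \<Longrightarrow> fx p = 0"
    and h_zero: "x \<in> {0<..<\<delta>} \<Longrightarrow> h (x, y) = 0 \<Longrightarrow> fx (x, y) \<noteq> 0"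
    and ends: "x \<in> {0..<\<delta>} \<Longrightarrow> fy (x, - r) < 0 \<and> 0 < fy (x, r)"
    and finite_zeros: "x \<in> {0<..<\<delta>} \<Longrightarrow> finite {y. fy (x, y) = 0}"
    and distinct_values: "x \<in> {0<..<\<delta>} \<Longrightarrow> y \<noteq> y' \<Longrightarrow> fy (x, y) = 0 \<Longrightarrow> fy (x, y') = 0 \<Longrightarrow>
      f (x, y) \<noteq> f (x, y')"
begin

lemmas df = partial_y[OF f_deriv] and dfy = partial_y[OF fy_deriv]

lemma cont_f: "continuous_on UNIV f" and cont_fy: "continuous_on UNIV fy"
  using f_deriv fy_deriv by (meson continuous_at_imp_continuous_on has_derivative_continuous)+

lemma cont_y: "continuous_on S (\<lambda>y. k (x, y))" if "continuous_on UNIV k" for k :: "real \<times> real \<Rightarrow> real"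
  by (rule continuous_on_compose2[OF that]) (auto intro!: continuous_intros)

lemma cont_x: "isCont (\<lambda>x. k (x, y)) x0" if "continuous_on UNIV k" for k :: "real \<times> real \<Rightarrow> real"
proof -
  have "continuous_on UNIV (\<lambda>x. k (x, y))"
    by (rule continuous_on_compose2[OF that]) (auto intro!: continuous_intros)
  then show ?thesis by (simp add: continuous_on_eq_continuous_at)
qed

definition Z :: "real \<Rightarrow> real set" where
  "Z x = {y \<in> {- r..r}. fy (x, y) = 0}"

definition zs :: "real \<Rightarrow> real list" where
  "zs x = sorted_list_of_set (Z x)"

lemma finite_Z: "x \<in> {0<..<\<delta>} \<Longrightarrow> finite (Z x)"
  by (rule finite_subset[OF _ finite_zeros[of x]]) (auto simp: Z_def)

lemma Z_interior: "x \<in> {0..<\<delta>} \<Longrightarrow> y \<in> Z x \<Longrightarrow> - r < y \<and> y < r"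
  using ends[of x] by (auto simp: Z_def less_le)

lemma simple_zero_isolated:
  assumes "x0 \<in> {0<..<\<delta>}" "y \<in> Z x0"
  shows "\<forall>\<^sub>F e in at_right 0. \<forall>x t. \<bar>x - x0\<bar> < e \<longrightarrow> \<bar>t - y\<bar> \<le> e \<longrightarrow> fyy (x, t) \<noteq> 0"
proof -
  have "fyy (x0, y) \<noteq> 0" using assms simple by (auto simp: Z_def)
  moreover have "isCont fyy (x0, y)" using cont_fyy by (simp add: continuous_on_eq_continuous_at)
  ultimately have "\<forall>\<^sub>F p in nhds (x0, y). fyy p \<noteq> 0"
    using tendsto_imp_eventually_ne[of fyy "fyy (x0, y)" "at (x0, y)" 0]
    by (simp add: isCont_def eventually_nhds_conv_at)
  then obtain d where d: "d > 0" "\<And>p. dist p (x0, y) < d \<Longrightarrow> fyy p \<noteq> 0"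
    unfolding eventually_nhds_metric by blast
  have "fyy (x, t) \<noteq> 0" if "e < d / 2" "\<bar>x - x0\<bar> < e" "\<bar>t - y\<bar> \<le> e" for e x t
  proof (rule d(2))
    have "dist (x, t) (x0, y) \<le> \<bar>x - x0\<bar> + \<bar>t - y\<bar>"
      using norm_Pair_le[of "x - x0" "t - y"] by (simp add: dist_norm)
    then show "dist (x, t) (x0, y) < d" using that by linarith
  qed
  moreover have "\<forall>\<^sub>F e in at_right 0. e < d / 2"
    using eventually_at_right_real[of 0 "d / 2"] d(1) by (auto elim: eventually_mono)
  ultimately show ?thesis by (auto elim: eventually_mono)
qed

text \<open>Near \<open>x0\<close> each zero of \<open>fy\<close> on the vertical line persists, because \<open>fy\<close> changes sign there, and does
  so uniquely, by Rolle's theorem, because \<open>fyy\<close> has no zero nearby. By compactness no further zeros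
  appear elsewhere. So the zeros keep their number and move continuously.\<close>

lemma local_branches:
  assumes x0: "x0 \<in> {0<..<\<delta>}" and \<eta>: "\<eta> > 0"
  shows "\<forall>\<^sub>F x in nhds x0. length (zs x) = length (zs x0) \<and>
           (\<forall>i<length (zs x0). \<bar>zs x ! i - zs x0 ! i\<bar> < \<eta>)"
proof -
  have fin: "finite (Z x0)" using finite_Z x0 by blast
  \<comment> \<open>The intervals of radius \<open>e\<close> around the zeros are disjoint and contain no zero of \<open>fyy\<close>.\<close>
  have "\<forall>\<^sub>F e in at_right 0. \<forall>y\<in>Z x0. e < \<eta> \<and> - r < y - e \<and> y + e < r \<and>
      (\<forall>y'\<in>Z x0. y' \<noteq> y \<longrightarrow> 2 * e < \<bar>y' - y\<bar>) \<and>
      (\<forall>x t. \<bar>x - x0\<bar> < e \<longrightarrow> \<bar>t - y\<bar> \<le> e \<longrightarrow> fyy (x, t) \<noteq> 0)"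
  proof (intro eventually_ball_finite[OF fin] ballI eventually_conj)
    fix y assume y: "y \<in> Z x0"
    have small: "\<forall>\<^sub>F e in at_right 0. e < a" if "a > 0" for a :: real
      using eventually_at_right_real[OF that] by eventually_elim simp
    show "\<forall>\<^sub>F e in at_right 0. e < \<eta>" using small \<eta> by blast
    have "- r < y" "y < r" using Z_interior[of x0 y] y x0 by auto
    then show "\<forall>\<^sub>F e in at_right 0. - r < y - e" "\<forall>\<^sub>F e in at_right 0. y + e < r"
      using small[of "y + r"] small[of "r - y"] by (auto elim: eventually_mono)
    show "\<forall>\<^sub>F e in at_right 0. y' \<noteq> y \<longrightarrow> 2 * e < \<bar>y' - y\<bar>" for y'
      using small[of "\<bar>y' - y\<bar> / 2"] by (cases "y' = y") (auto elim: eventually_mono)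
    show "\<forall>\<^sub>F e in at_right 0. \<forall>x t. \<bar>x - x0\<bar> < e \<longrightarrow> \<bar>t - y\<bar> \<le> e \<longrightarrow> fyy (x, t) \<noteq> 0"
      using simple_zero_isolated x0 y by blast
  qed
  moreover have "\<forall>\<^sub>F e in at_right 0. (0::real) < e" by (rule eventually_at_right_less)
  ultimately obtain e where e: "e > 0"
    and e_all: "\<forall>y\<in>Z x0. e < \<eta> \<and> - r < y - e \<and> y + e < r \<and>
      (\<forall>y'\<in>Z x0. y' \<noteq> y \<longrightarrow> 2 * e < \<bar>y' - y\<bar>) \<and>
      (\<forall>x t. \<bar>x - x0\<bar> < e \<longrightarrow> \<bar>t - y\<bar> \<le> e \<longrightarrow> fyy (x, t) \<noteq> 0)"
    using eventually_happens'[OF trivial_limit_at_right_real[of "0::real"] eventually_conj] by blast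
  have mvt: "\<exists>c. a < c \<and> c < b \<and> fy (x, b) - fy (x, a) = (b - a) * fyy (x, c)" if "a < b" for a b x
    using MVT2[OF that, of "\<lambda>t. fy (x, t)" "\<lambda>t. fyy (x, t)"] dfy by blast
  have crossing: "fy (x0, y - e) * fy (x0, y + e) < 0" if y: "y \<in> Z x0" for y
  proof -
    have fyy: "fyy (x0, t) \<noteq> 0" if "t \<in> {y - e..y + e}" for t
    proof -
      have "\<bar>t - y\<bar> \<le> e" "\<bar>x0 - x0\<bar> < e" using that e by auto
      then show ?thesis using e_all y by blast
    qed
    obtain s where s: "y < s" "s < y + e" "fy (x0, y + e) - fy (x0, y) = (y + e - y) * fyy (x0, s)"
      using mvt[of y "y + e" x0] e by auto
    obtain t where t: "y - e < t" "t < y" "fy (x0, y) - fy (x0, y - e) = (y - (y - e)) * fyy (x0, t)"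
      using mvt[of "y - e" y x0] e by auto
    have "0 < fyy (x0, s) \<longleftrightarrow> 0 < fyy (x0, t)"
      using no_zero_imp_same_sign[of s t "\<lambda>t. fyy (x0, t)"] cont_y[OF cont_fyy] fyy s t by auto
    moreover have "fyy (x0, s) \<noteq> 0" "fyy (x0, t) \<noteq> 0" using fyy s t by auto
    ultimately have "0 < fyy (x0, s) * fyy (x0, t)" by (metis linorder_neqE mult_neg_neg mult_pos_pos)
    then have "0 < (e * e) * (fyy (x0, s) * fyy (x0, t))" using e by simp
    moreover have "fy (x0, y + e) = e * fyy (x0, s)" "fy (x0, y - e) = - (e * fyy (x0, t))"
      using s(3) t(3) y by (auto simp: Z_def)
    ultimately show ?thesis by (simp add: algebra_simps)
  qed
  define K where "K = {- r..r} - (\<Union>y\<in>Z x0. {y - e<..<y + e})"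
  have "compact K" unfolding K_def by (intro compact_diff) auto
  moreover have "fy (x0, t) \<noteq> 0" if "t \<in> K" for t
  proof
    assume "fy (x0, t) = 0"
    then have "t \<in> Z x0" using that by (simp add: K_def Z_def)
    moreover have "t \<in> {t - e<..<t + e}" using e by simp
    ultimately show False using that unfolding K_def by blast
  qed
  ultimately have no_other: "\<forall>\<^sub>F x in nhds x0. \<forall>t\<in>K. fy (x, t) \<noteq> 0"
    by (intro eventually_nonzero_on_compact_slice cont_fy)
  have "\<forall>\<^sub>F x in nhds x0. \<forall>y\<in>Z x0. fy (x, y - e) * fy (x, y + e) < 0"
  proof (intro eventually_ball_finite[OF fin] ballI)
    fix y assume "y \<in> Z x0"
    then have neg: "fy (x0, y - e) * fy (x0, y + e) < 0" by (rule crossing)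
    have "isCont (\<lambda>x. fy (x, y - e) * fy (x, y + e)) x0"
      by (intro continuous_mult cont_x cont_fy)
    from isCont_tendsto_nhds[OF this] show "\<forall>\<^sub>F x in nhds x0. fy (x, y - e) * fy (x, y + e) < 0"
      using neg by (rule order_tendstoD)
  qed
  moreover have "\<forall>\<^sub>F x in nhds x0. \<bar>x - x0\<bar> < e"
    using e unfolding eventually_nhds_metric by (auto simp: dist_real_def)
  ultimately show ?thesis
    using no_other
  proof eventually_elim
    case (elim x)
    have root: "\<exists>!t. t \<in> {y - e<..<y + e} \<and> fy (x, t) = 0" if y: "y \<in> Z x0" for y
    proof (rule ex_ex1I)
      have prod: "fy (x, y - e) * fy (x, y + e) < 0" using elim(1) y by blast
      then have "fy (x, y - e) < 0 \<and> 0 < fy (x, y + e) \<or> 0 < fy (x, y - e) \<and> fy (x, y + e) < 0"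
        by (auto simp: mult_less_0_iff)
      then obtain t where "y - e \<le> t" "t \<le> y + e" "fy (x, t) = 0"
        using IVT'[of "\<lambda>t. fy (x, t)" "y - e" 0 "y + e"] IVT2'[of "\<lambda>t. fy (x, t)" "y + e" 0 "y - e"]
          cont_y[OF cont_fy] e by fastforce
      moreover have "t \<noteq> y - e" "t \<noteq> y + e" using calculation(3) prod by auto
      ultimately show "\<exists>t. t \<in> {y - e<..<y + e} \<and> fy (x, t) = 0" by (intro exI[of _ t]) auto
    next
      fix s t assume st: "s \<in> {y - e<..<y + e} \<and> fy (x, s) = 0" "t \<in> {y - e<..<y + e} \<and> fy (x, t) = 0"
      have False if ab: "a < b" "a \<in> {y - e<..<y + e}" "b \<in> {y - e<..<y + e}" "fy (x, a) = 0" "fy (x, b) = 0" for a b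
      proof -
        obtain c where c: "a < c" "c < b" "fy (x, b) - fy (x, a) = (b - a) * fyy (x, c)"
          using mvt[OF ab(1)] by blast
        then have "fyy (x, c) = 0" using ab by simp
        moreover have "\<bar>c - y\<bar> \<le> e" using c ab by auto
        ultimately show False using e_all y elim(2) by blast
      qed
      then show "s = t" using st by (metis linorder_neqE)
    qed
    define \<phi> where "\<phi> y = (THE t. t \<in> {y - e<..<y + e} \<and> fy (x, t) = 0)" for y
    have \<phi>: "\<phi> y \<in> {y - e<..<y + e}" "fy (x, \<phi> y) = 0" if "y \<in> Z x0" for y
      using theI'[OF root[OF that]] by (simp_all add: \<phi>_def)
    have \<phi>_unique: "t = \<phi> y" if "y \<in> Z x0" "t \<in> {y - e<..<y + e}" "fy (x, t) = 0" for y t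
      using root[OF that(1)] \<phi>[OF that(1)] that(2,3) by blast
    have "Z x = \<phi> ` Z x0"
    proof (intro set_eqI iffI)
      fix t assume t: "t \<in> Z x"
      then have "t \<notin> K" using elim(3) by (auto simp: Z_def)
      then obtain y where "y \<in> Z x0" "t \<in> {y - e<..<y + e}" using t by (auto simp: K_def Z_def)
      then show "t \<in> \<phi> ` Z x0" using \<phi>_unique t by (auto simp: Z_def)
    next
      fix t assume "t \<in> \<phi> ` Z x0"
      then obtain y where y: "y \<in> Z x0" "t = \<phi> y" by blast
      then have "- r < y - e" "y + e < r" using e_all by auto
      then show "t \<in> Z x" using \<phi>[OF y(1)] y by (auto simp: Z_def)
    qed
    moreover have "\<phi> a < \<phi> b" if "a \<in> Z x0" "b \<in> Z x0" "a < b" for a b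
    proof -
      have "2 * e < \<bar>b - a\<bar>" using e_all that by force
      then show ?thesis using \<phi>[OF that(1)] \<phi>[OF that(2)] that(3) by auto
    qed
    ultimately have zs: "zs x = map \<phi> (zs x0)"
      unfolding zs_def using strict_mono_sorted_list_of_set[OF fin] by simp
    have "\<bar>\<phi> y - y\<bar> < \<eta>" if "y \<in> Z x0" for y
    proof -
      have "e < \<eta>" using e_all that by blast
      then show ?thesis using \<phi>(1)[OF that] by auto
    qed
    moreover have "zs x0 ! i \<in> Z x0" if "i < length (zs x0)" for i
      using nth_mem[OF that] fin by (simp add: zs_def)
    ultimately show ?case by (simp add: zs)
  qed
qed

definition n :: nat where "n = length (zs (\<delta> / 2))"

lemma length_zs: "x \<in> {0<..<\<delta>} \<Longrightarrow> length (zs x) = n"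
proof -
  assume x: "x \<in> {0<..<\<delta>}"
  have "(\<lambda>x. length (zs x)) constant_on {0<..<\<delta>}"
  proof (rule locally_constant_imp_constant)
    fix a assume a: "a \<in> {0<..<\<delta>}"
    obtain U where U: "open U" "a \<in> U" "\<forall>x\<in>U. length (zs x) = length (zs a)"
      using local_branches[OF a zero_less_one] unfolding eventually_nhds by blast
    show "\<exists>T. openin (top_of_set {0<..<\<delta>}) T \<and> a \<in> T \<and> (\<forall>x\<in>T. length (zs x) = length (zs a))"
    proof (intro exI conjI)
      show "openin (top_of_set {0<..<\<delta>}) ({0<..<\<delta>} \<inter> U)" using U(1) by (rule openin_open_Int)
      show "a \<in> {0<..<\<delta>} \<inter> U" using U(2) a by blast
      show "\<forall>x\<in>{0<..<\<delta>} \<inter> U. length (zs x) = length (zs a)" using U(3) by blast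
    qed
  qed (rule connected_Ioo)
  then obtain c where "\<forall>x\<in>{0<..<\<delta>}. length (zs x) = c" unfolding constant_on_def by blast
  moreover have "\<delta> / 2 \<in> {0<..<\<delta>}" using \<delta> by simp
  ultimately have "length (zs x) = c" "length (zs (\<delta> / 2)) = c" using x by blast+
  then show ?thesis by (simp only: n_def)
qed

text \<open>The value at \<open>x = 0\<close> is the limit: on the axis the origin is the only zero of \<open>fy\<close>.\<close>

definition \<gamma> :: "nat \<Rightarrow> real \<Rightarrow> real" where
  "\<gamma> i x = (if x = 0 then 0 else zs x ! i)"

lemma Z_eq: "x \<in> {0<..<\<delta>} \<Longrightarrow> Z x = {\<gamma> i x |i. i < n}"
proof -
  assume x: "x \<in> {0<..<\<delta>}"
  have "Z x = set (zs x)" using finite_Z[OF x] by (simp add: zs_def)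
  also have "\<dots> = {zs x ! i |i. i < n}" using length_zs[OF x] by (simp add: set_conv_nth)
  finally show ?thesis using x by (simp add: \<gamma>_def)
qed

lemma \<gamma>_in_Z: "x \<in> {0<..<\<delta>} \<Longrightarrow> i < n \<Longrightarrow> \<gamma> i x \<in> Z x"
  using Z_eq by blast

lemma \<gamma>_less: "i < j \<Longrightarrow> j < n \<Longrightarrow> x \<in> {0<..<\<delta>} \<Longrightarrow> \<gamma> i x < \<gamma> j x"
proof -
  assume ij: "i < j" "j < n" and x: "x \<in> {0<..<\<delta>}"
  have "sorted_wrt (<) (zs x)" by (simp add: zs_def)
  then have "zs x ! i < zs x ! j" using ij length_zs[OF x] by (simp add: sorted_wrt_nth_less)
  then show ?thesis using x by (simp add: \<gamma>_def)
qed

lemma \<gamma>_tendsto: "x0 \<in> {0<..<\<delta>} \<Longrightarrow> i < n \<Longrightarrow> isCont (\<gamma> i) x0"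
proof -
  assume x: "x0 \<in> {0<..<\<delta>}" and i: "i < n"
  have "(\<gamma> i \<longlongrightarrow> \<gamma> i x0) (nhds x0)"
  proof (rule tendstoI)
    fix \<eta> :: real assume "\<eta> > 0"
    moreover have "\<forall>\<^sub>F x in nhds x0. x \<in> {0<..<\<delta>}"
      using x by (intro eventually_nhds_in_open) auto
    ultimately show "\<forall>\<^sub>F x in nhds x0. dist (\<gamma> i x) (\<gamma> i x0) < \<eta>"
      using local_branches[OF x \<open>\<eta> > 0\<close>] length_zs[OF x] i x
      by (auto simp: \<gamma>_def dist_real_def elim: eventually_elim2)
  qed
  then show ?thesis by (simp add: isCont_def tendsto_at_iff_tendsto_nhds)
qed

lemma \<gamma>_tendsto_0: "i < n \<Longrightarrow> (\<gamma> i \<longlongrightarrow> 0) (at 0 within {0..<\<delta>})"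
proof (rule tendstoI)
  fix \<eta> :: real assume i: "i < n" and \<eta>: "\<eta> > 0"
  have "compact ({- r..r} - {- \<eta><..<\<eta>})" by (intro compact_diff) auto
  moreover have "fy (0, y) \<noteq> 0" if "y \<in> {- r..r} - {- \<eta><..<\<eta>}" for y
    using axis[of y] that \<eta> by auto
  ultimately have "\<forall>\<^sub>F x in nhds 0. \<forall>y\<in>{- r..r} - {- \<eta><..<\<eta>}. fy (x, y) \<noteq> 0"
    by (intro eventually_nonzero_on_compact_slice cont_fy)
  then have "\<forall>\<^sub>F x in at 0 within {0..<\<delta>}. \<forall>y\<in>{- r..r} - {- \<eta><..<\<eta>}. fy (x, y) \<noteq> 0"
    by (rule filter_leD[OF at_within_le_nhds])
  moreover have "\<forall>\<^sub>F x in at 0 within {0..<\<delta>}. x \<in> {0<..<\<delta>}"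
    unfolding eventually_at_filter by (auto intro!: always_eventually)
  ultimately show "\<forall>\<^sub>F x in at 0 within {0..<\<delta>}. dist (\<gamma> i x) 0 < \<eta>"
  proof eventually_elim
    case (elim x)
    have "\<gamma> i x \<in> {- r..r}" "fy (x, \<gamma> i x) = 0" using \<gamma>_in_Z[OF elim(2) i] by (auto simp: Z_def)
    then have "\<gamma> i x \<in> {- \<eta><..<\<eta>}" using elim(1) by blast
    then show ?case by (auto simp: dist_real_def)
  qed
qed

lemma \<gamma>_cont: "i < n \<Longrightarrow> continuous_on {0..<\<delta>} (\<gamma> i)"
  unfolding continuous_on
proof
  fix x assume i: "i < n" and x: "x \<in> {0..<\<delta>}"
  show "(\<gamma> i \<longlongrightarrow> \<gamma> i x) (at x within {0..<\<delta>})"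
  proof (cases "x = 0")
    case True
    then show ?thesis using \<gamma>_tendsto_0[OF i] by (simp add: \<gamma>_def)
  next
    case False
    then show ?thesis using \<gamma>_tendsto[of x i] i x
      by (auto simp: isCont_def intro: tendsto_within_subset)
  qed
qed

definition H :: "nat \<Rightarrow> real \<Rightarrow> real" where
  "H i x = f (x, \<gamma> i x)"

lemma H_deriv:
  assumes i: "i < n" and x: "x \<in> {0<..<\<delta>}"
  shows "(H i has_real_derivative fx (x, \<gamma> i x)) (at x)"
  unfolding H_def
proof (rule critical_value_derivative)
  have zero: "fy (x, \<gamma> i x) = 0" if "x \<in> {0<..<\<delta>}" for x using \<gamma>_in_Z[OF that i] by (simp add: Z_def)
  show "(f has_derivative (\<lambda>v. fst v * fx (x, \<gamma> i x) + snd v * 0)) (at (x, \<gamma> i x))"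
    using f_deriv[of "(x, \<gamma> i x)"] zero[OF x] by simp
  show "(fy has_derivative (\<lambda>v. fst v * fyx (x, \<gamma> i x) + snd v * fyy (x, \<gamma> i x))) (at (x, \<gamma> i x))"
    by (rule fy_deriv)
  show "fyy (x, \<gamma> i x) \<noteq> 0" using simple x zero by blast
  show "isCont (\<gamma> i) x" using \<gamma>_tendsto x i by blast
  have "\<forall>\<^sub>F x in nhds x. x \<in> {0<..<\<delta>}" using x by (intro eventually_nhds_in_open) auto
  then show "\<forall>\<^sub>F x in nhds x. fy (x, \<gamma> i x) = 0" by eventually_elim (rule zero)
qed

lemma H_cont: "i < n \<Longrightarrow> continuous_on {0..<\<delta>} (H i)"
  unfolding H_def
  by (rule continuous_on_compose2[OF cont_f]) (auto intro!: continuous_intros \<gamma>_cont)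

lemma H_0: "H i 0 = 0"
  by (simp add: H_def \<gamma>_def f_0)

lemma H_pos: "i < n \<Longrightarrow> x \<in> {0<..<\<delta>} \<Longrightarrow> 0 < H i x"
  unfolding H_def using \<gamma>_in_Z[of x i] by (intro f_pos) (auto simp: Z_def)

text \<open>Either \<open>f\<close> is critical all along the half-branch, hence constant on it and equal to its
  value at the origin, or it has no critical point on it at all. A strict minimum excludes the
  first case.\<close>

lemma fx_nonzero:
  assumes i: "i < n" and x: "x \<in> {0<..<\<delta>}"
  shows "fx (x, \<gamma> i x) \<noteq> 0"
proof -
  define A where "A = {x \<in> {0<..<\<delta>}. g (x, \<gamma> i x) = 0}"
  define B where "B = {x \<in> {0<..<\<delta>}. h (x, \<gamma> i x) = 0}"
  have cont: "continuous_on {0<..<\<delta>} (\<lambda>x. k (x, \<gamma> i x))" if "continuous_on UNIV k" for k :: "real \<times> real \<Rightarrow> real"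
  proof -
    have "continuous_on {0<..<\<delta>} (\<gamma> i)" by (rule continuous_on_subset[OF \<gamma>_cont[OF i]]) auto
    then have "continuous_on {0<..<\<delta>} (\<lambda>x. (x, \<gamma> i x))" by (intro continuous_intros)
    from continuous_on_compose2[OF that this] show ?thesis by simp
  qed
  have "closedin (top_of_set {0<..<\<delta>}) A" "closedin (top_of_set {0<..<\<delta>}) B"
    unfolding A_def B_def
    by (intro continuous_closedin_preimage_constant cont cont_g cont_h)+
  moreover have "A \<union> B = {0<..<\<delta>}"
    using \<gamma>_in_Z[OF _ i] factor by (force simp: A_def B_def Z_def)
  moreover have "A \<inter> B = {}" using g_zero h_zero by (fastforce simp: A_def B_def)
  moreover have "connected {0<..<\<delta>}" by simp
  ultimately have "A = {} \<or> B = {}"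
    unfolding connected_closedin_eq by blast
  moreover have "A \<noteq> {0<..<\<delta>}"
  proof
    assume "A = {0<..<\<delta>}"
    then have crit: "fx (x, \<gamma> i x) = 0" if "x \<in> {0<..<\<delta>}" for x 
    proof -
      have "x \<in> A" using that \<open>A = {0<..<\<delta>}\<close> by blast
      then show ?thesis using g_zero unfolding A_def by blast
    qed
    have deriv: "(H i has_real_derivative 0) (at z)" if "0 < z" "z < x" for z
      using H_deriv[OF i, of z] crit[of z] that x by simp
    have "continuous_on {0..x} (H i)" using x by (intro continuous_on_subset[OF H_cont[OF i]]) auto
    then have "\<exists>l z. 0 < z \<and> z < x \<and> (H i has_real_derivative l) (at z) \<and> H i x - H i 0 = (x - 0) * l"
      using x deriv by (intro MVT) (auto simp: real_differentiable_def)
    then obtain l z where "0 < z" "z < x" "(H i has_real_derivative l) (at z)" "H i x = x * l"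
      by (auto simp: H_0)
    then have "H i x = 0" using deriv[of z] DERIV_unique by fastforce
    then show False using H_pos[OF i x] by simp
  qed
  ultimately have "B = {0<..<\<delta>}" using \<open>A \<union> B = {0<..<\<delta>}\<close> by auto
  then have "x \<in> B" using x by blast
  then have "h (x, \<gamma> i x) = 0" by (simp add: B_def)
  then show ?thesis by (rule h_zero[OF x])
qed

text \<open>Between two equal values of \<open>H i\<close> Rolle's theorem would give a critical point of \<open>f\<close> on the half-branch.
  So \<open>H i\<close> is injective, and it increases because it is zero at the origin and positive afterwards.\<close>

lemma H_less:
  assumes i: "i < n" and ab: "0 \<le> a" "a < b" "b < \<delta>"
  shows "H i a < H i b"
proof (rule ccontr)
  have inj: "H i c \<noteq> H i d" if cd: "0 \<le> c" "c < d" "d < \<delta>" for c d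
  proof -
    have deriv: "(H i has_real_derivative fx (z, \<gamma> i z)) (at z)" if "c < z" "z < d" for z
      using H_deriv[OF i, of z] that cd by simp
    have "continuous_on {c..d} (H i)" using cd by (intro continuous_on_subset[OF H_cont[OF i]]) auto
    then have "\<exists>l z. c < z \<and> z < d \<and> (H i has_real_derivative l) (at z) \<and> H i d - H i c = (d - c) * l"
      using cd(2) deriv by (intro MVT) (auto simp: real_differentiable_def)
    then obtain l z where z: "c < z" "z < d" "(H i has_real_derivative l) (at z)"
        "H i d - H i c = (d - c) * l" by blast
    have "l = fx (z, \<gamma> i z)" using DERIV_unique[OF z(3) deriv[OF z(1,2)]] .
    then have "l \<noteq> 0" using fx_nonzero[OF i, of z] z cd by simp
    then show ?thesis using z(4) cd(2) by auto
  qed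
  assume "\<not> H i a < H i b"
  then have le: "H i b \<le> H i a" by simp
  have b: "0 < H i b" using H_pos[OF i] ab by simp
  have "continuous_on {0..a} (H i)" using ab by (intro continuous_on_subset[OF H_cont[OF i]]) auto
  \<comment> \<open>A descent from \<open>H i a\<close> to \<open>H i b\<close> would make \<open>H i\<close> take the value \<open>H i b\<close> already before \<open>a\<close>.\<close>
  then obtain c where c: "0 \<le> c" "c \<le> a" "H i c = H i b"
    using IVT'[of "H i" 0 "H i b" a] le b ab H_0 by auto
  then show False using inj[of c b] ab by simp
qed

lemma increasing: "a < b \<Longrightarrow> (\<And>y. a < y \<Longrightarrow> y < b \<Longrightarrow> 0 < fy (x, y)) \<Longrightarrow> f (x, a) < f (x, b)"
  by (rule DERIV_pos_imp_increasing_open[where f = "\<lambda>y. f (x, y)"])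
    (auto intro: df cont_y cont_f)

lemma decreasing: "a < b \<Longrightarrow> (\<And>y. a < y \<Longrightarrow> y < b \<Longrightarrow> fy (x, y) < 0) \<Longrightarrow> f (x, b) < f (x, a)"
  by (rule DERIV_neg_imp_decreasing_open[where f = "\<lambda>y. f (x, y)"])
    (auto intro: df cont_y cont_f)

text \<open>The \<open>i\<close>-th interval, counted from below, that the zeros of \<open>fy\<close> cut out of \<open>[- r, r]\<close>.\<close>

definition gap :: "real \<Rightarrow> nat \<Rightarrow> real set" where
  "gap x i = {y \<in> {- r..r}. (\<forall>k<i. \<gamma> k x < y) \<and> (\<forall>k. i \<le> k \<and> k < n \<longrightarrow> y < \<gamma> k x)}"

lemma gap_nonzero: "x \<in> {0<..<\<delta>} \<Longrightarrow> y \<in> gap x i \<Longrightarrow> fy (x, y) \<noteq> 0"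
proof
  assume x: "x \<in> {0<..<\<delta>}" and y: "y \<in> gap x i" and "fy (x, y) = 0"
  then have "y \<in> Z x" by (auto simp: gap_def Z_def)
  then obtain k where k: "k < n" "y = \<gamma> k x" using Z_eq[OF x] by blast
  show False
  proof (cases "k < i")
    case True
    then show False using y k by (auto simp: gap_def)
  next
    case False
    then have "y < \<gamma> k x" using y k(1) by (simp add: gap_def)
    then show False using k by simp
  qed
qed

lemma gap_convex:
  assumes "a \<in> gap x i" "b \<in> gap x i" "y \<in> {min a b..max a b}"
  shows "y \<in> gap x i"
proof -
  have "y \<in> {- r..r}" using assms by (auto simp: gap_def)
  moreover have "\<gamma> k x < y" if "k < i" for k
  proof -
    have "\<gamma> k x < a" "\<gamma> k x < b" using assms(1,2) that by (simp_all add: gap_def)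
    then show ?thesis using assms(3) by auto
  qed
  moreover have "y < \<gamma> k x" if "i \<le> k" "k < n" for k
  proof -
    have "a < \<gamma> k x" "b < \<gamma> k x" using assms(1,2) that by (simp_all add: gap_def)
    then show ?thesis using assms(3) by auto
  qed
  ultimately show ?thesis by (simp add: gap_def)
qed

lemma gap_same_sign:
  assumes "x \<in> {0<..<\<delta>}" "a \<in> gap x i" "b \<in> gap x i"
  shows "0 < fy (x, a) \<longleftrightarrow> 0 < fy (x, b)"
  using gap_nonzero[OF assms(1)] gap_convex[OF assms(2,3)]
  by (intro no_zero_imp_same_sign[of a b "\<lambda>y. fy (x, y)"] cont_y cont_fy) blast

lemma gap_step:
  assumes x: "x \<in> {0<..<\<delta>}" and i: "i < n"
  obtains a b where "a \<in> gap x i" "b \<in> gap x (Suc i)" "0 < fy (x, a) \<longleftrightarrow> \<not> 0 < fy (x, b)"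
proof -
  define y where "y = \<gamma> i x"
  have y: "y \<in> Z x" using \<gamma>_in_Z[OF x i] by (simp add: y_def)
  have yr: "- r < y" "y < r" using Z_interior[of x y] y x by auto
  have fy0: "fy (x, y) = 0" using y by (simp add: Z_def)
  have small: "\<forall>\<^sub>F e in at_right 0. e < c" if "c > 0" for c :: real
    using eventually_at_right_real[OF that] by eventually_elim simp
  have pos: "\<forall>\<^sub>F e in at_right 0. (0::real) < e" by (rule eventually_at_right_less)
  have "\<forall>\<^sub>F e in at_right 0. \<forall>k\<in>{..<n}. (k < i \<longrightarrow> \<gamma> k x < y - e) \<and> (i < k \<longrightarrow> y + e < \<gamma> k x)"
  proof (intro eventually_ball_finite ballI)
    fix k assume k: "k \<in> {..<n}"
    consider "k < i" | "k = i" | "i < k" by linarith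
    then show "\<forall>\<^sub>F e in at_right 0. (k < i \<longrightarrow> \<gamma> k x < y - e) \<and> (i < k \<longrightarrow> y + e < \<gamma> k x)"
    proof cases
      case 1
      then have "0 < y - \<gamma> k x" using \<gamma>_less[of k i x] x i by (simp add: y_def)
      from small[OF this] show ?thesis using 1 by (auto elim: eventually_mono)
    next
      case 3
      then have "0 < \<gamma> k x - y" using \<gamma>_less[of i k x] x k by (simp add: y_def)
      from small[OF this] show ?thesis using 3 by (auto elim: eventually_mono)
    qed simp
  qed simp
  moreover have "\<forall>\<^sub>F e in at_right 0. e < min (y + r) (r - y)" using yr by (intro small) auto
  ultimately have gaps: "\<forall>\<^sub>F e in at_right 0. y - e \<in> gap x i \<and> y + e \<in> gap x (Suc i)"
    using pos
  proof eventually_elim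
    case (elim e)
    have 1: "\<gamma> k x < y - e" if "k < i" for k using elim(1) that i by simp
    have 2: "y + e < \<gamma> k x" if "i < k" "k < n" for k using elim(1) that by simp
    have 3: "y - e < \<gamma> k x" if "i \<le> k" "k < n" for k
      using 2[of k] that elim(3) by (cases "k = i") (auto simp: y_def)
    have 4: "\<gamma> k x < y + e" if "k < Suc i" for k
      using 1[of k] that elim(3) by (cases "k = i") (auto simp: y_def)
    show ?case using 1 2 3 4 elim(2,3) yr by (auto simp: gap_def)
  qed
  have nz: "fyy (x, y) \<noteq> 0" using simple x fy0 by blast
  have near: "\<forall>\<^sub>F e in at_right 0. P e" if "d > 0" "\<And>e. 0 < e \<Longrightarrow> e < d \<Longrightarrow> P e" for P and d :: real
    using eventually_at_right_real[OF that(1)] by eventually_elim (use that(2) in auto)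
  have opposite: "\<forall>\<^sub>F e in at_right 0. 0 < fy (x, y - e) \<longleftrightarrow> \<not> 0 < fy (x, y + e)"
  proof (cases "fyy (x, y) > 0")
    case True
    obtain d1 where "d1 > 0" "\<And>e. 0 < e \<Longrightarrow> e < d1 \<Longrightarrow> 0 < fy (x, y + e)"
      using DERIV_pos_inc_right[OF dfy True] fy0 by auto
    then have "\<forall>\<^sub>F e in at_right 0. 0 < fy (x, y + e)" by (rule near)
    moreover obtain d2 where "d2 > 0" "\<And>e. 0 < e \<Longrightarrow> e < d2 \<Longrightarrow> fy (x, y - e) < 0"
      using DERIV_pos_inc_left[OF dfy True] fy0 by auto
    then have "\<forall>\<^sub>F e in at_right 0. fy (x, y - e) < 0" by (rule near)
    ultimately show ?thesis by eventually_elim simp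
  next
    case False
    then have neg: "fyy (x, y) < 0" using nz by simp
    obtain d1 where "d1 > 0" "\<And>e. 0 < e \<Longrightarrow> e < d1 \<Longrightarrow> fy (x, y + e) < 0"
      using DERIV_neg_dec_right[OF dfy neg] fy0 by auto
    then have "\<forall>\<^sub>F e in at_right 0. fy (x, y + e) < 0" by (rule near)
    moreover obtain d2 where "d2 > 0" "\<And>e. 0 < e \<Longrightarrow> e < d2 \<Longrightarrow> 0 < fy (x, y - e)"
      using DERIV_neg_dec_left[OF dfy neg] fy0 by auto
    then have "\<forall>\<^sub>F e in at_right 0. 0 < fy (x, y - e)" by (rule near)
    ultimately show ?thesis by eventually_elim simp
  qed
  obtain e where "y - e \<in> gap x i \<and> y + e \<in> gap x (Suc i)" "0 < fy (x, y - e) \<longleftrightarrow> \<not> 0 < fy (x, y + e)"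
    using eventually_happens'[OF trivial_limit_at_right_real[of "0::real"] eventually_conj[OF gaps opposite]]
    by blast
  then show thesis using that by blast
qed

text \<open>The sign of \<open>fy\<close> is constant on gaps and changes at every zero, all zeros being simple. It is negative at
  the bottom, and since it is positive at the top the number of zeros is odd.\<close>

lemma gap_sign:
  assumes x: "x \<in> {0<..<\<delta>}"
  shows "i \<le> n \<Longrightarrow> y \<in> gap x i \<Longrightarrow> 0 < fy (x, y) \<longleftrightarrow> odd i"
proof (induction i arbitrary: y)
  case 0
  have "- r < \<gamma> k x" if "k < n" for k
    using Z_interior[of x "\<gamma> k x"] \<gamma>_in_Z[OF x that] x by simp
  then have "- r \<in> gap x 0" using r by (simp add: gap_def)
  then show ?case using gap_same_sign[OF x _ 0(2)] ends[of x] x by fastforce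
next
  case (Suc i)
  obtain a b where ab: "a \<in> gap x i" "b \<in> gap x (Suc i)" "0 < fy (x, a) \<longleftrightarrow> \<not> 0 < fy (x, b)"
    using gap_step[OF x, of i] Suc.prems(1) by auto
  then show ?case using Suc.IH[of a] Suc.prems gap_same_sign[OF x ab(2) Suc.prems(2)] by simp
qed

lemma odd_n: "odd n"
proof -
  have x: "\<delta> / 2 \<in> {0<..<\<delta>}" using \<delta> by simp
  have "\<gamma> k (\<delta> / 2) < r" if "k < n" for k
    using Z_interior[of "\<delta> / 2" "\<gamma> k (\<delta> / 2)"] \<gamma>_in_Z[OF x that] x by simp
  then have "r \<in> gap (\<delta> / 2) n" using r by (simp add: gap_def)
  then show ?thesis using gap_sign[OF x, of n r] ends[of "\<delta> / 2"] x by simp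
qed

lemma between_in_gap:
  assumes x: "x \<in> {0<..<\<delta>}" and i: "Suc i < n" and y: "\<gamma> i x < y" "y < \<gamma> (Suc i) x"
  shows "y \<in> gap x (Suc i)"
proof -
  have "\<gamma> i x \<in> {- r..r}" "\<gamma> (Suc i) x \<in> {- r..r}"
    using \<gamma>_in_Z[OF x] i by (simp_all add: Z_def)
  then have "y \<in> {- r..r}" using y by simp
  moreover have "\<gamma> k x < y" if "k < Suc i" for k
    using \<gamma>_less[of k i x] x i y that by (cases "k = i") auto
  moreover have "y < \<gamma> k x" if "Suc i \<le> k" "k < n" for k
    using \<gamma>_less[of "Suc i" k x] x y that by (cases "k = Suc i") auto
  ultimately show ?thesis by (simp add: gap_def)
qed

lemma increasing_between:
  assumes "x \<in> {0<..<\<delta>}" "Suc i < n" "even i" "\<gamma> i x \<le> a" "a < b" "b \<le> \<gamma> (Suc i) x"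
  shows "f (x, a) < f (x, b)"
proof (rule increasing[OF assms(5)])
  fix y assume "a < y" "y < b"
  then have "y \<in> gap x (Suc i)" using assms by (intro between_in_gap) auto
  then show "0 < fy (x, y)" using gap_sign[OF assms(1), of "Suc i" y] assms(2,3) by simp
qed

lemma decreasing_between:
  assumes "x \<in> {0<..<\<delta>}" "Suc i < n" "odd i" "\<gamma> i x \<le> a" "a < b" "b \<le> \<gamma> (Suc i) x"
  shows "f (x, b) < f (x, a)"
proof (rule decreasing[OF assms(5)])
  fix y assume "a < y" "y < b"
  then have y: "y \<in> gap x (Suc i)" using assms by (intro between_in_gap) auto
  then have "\<not> 0 < fy (x, y)" using gap_sign[OF assms(1), of "Suc i" y] assms(2,3) by simp
  then show "fy (x, y) < 0" using gap_nonzero[OF assms(1) y] by linarith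
qed

lemma pass:
  assumes "i \<le> j" "j < n" and x: "x \<in> {0..<\<delta>}" and "y \<in> {\<gamma> i x..\<gamma> j x}"
  shows "\<exists>k\<in>{i..j}. f (x, y) \<le> f (x, \<gamma> k x)"
proof (cases "x = 0")
  case True
  then show ?thesis using assms by (intro bexI[of _ i]) (auto simp: \<gamma>_def)
next
  case False
  then have x': "x \<in> {0<..<\<delta>}" using x by simp
  show ?thesis using assms(1,2,4)
  proof (induction j rule: dec_induct)
    case base
    then show ?case by auto
  next
    case (step j)
    show ?case
    proof (cases "y \<le> \<gamma> j x")
      case True
      then obtain k where "k \<in> {i..j}" "f (x, y) \<le> f (x, \<gamma> k x)" using step by auto
      then show ?thesis by (intro bexI[of _ k]) auto
    next
      case False
      show ?thesis
      proof (cases "even j")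
        case True
        have "f (x, y) \<le> f (x, \<gamma> (Suc j) x)"
        proof (cases "y = \<gamma> (Suc j) x")
          case False
          then show ?thesis
            using increasing_between[OF x', of j y "\<gamma> (Suc j) x"] step.prems \<open>\<not> y \<le> \<gamma> j x\<close> True by simp
        qed simp
        then show ?thesis using step.hyps by (intro bexI[of _ "Suc j"]) auto
      next
        case False
        then have "f (x, y) < f (x, \<gamma> j x)"
          using decreasing_between[OF x', of j "\<gamma> j x" y] step.prems \<open>\<not> y \<le> \<gamma> j x\<close> by simp
        then show ?thesis using step.hyps by (intro bexI[of _ j]) auto
      qed
    qed
  qed
qed

lemma descent_axis:
  assumes y: "\<bar>y\<bar> \<le> r" and z: "z \<in> closed_segment y 0"
  shows "f (0, z) \<le> f (0, y)"
proof (cases "z = y")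
  case False
  have ends0: "fy (0, - r) < 0" "0 < fy (0, r)" using ends[of 0] \<delta> by auto
  have "y \<noteq> 0" using z False by auto
  then consider "0 < y" | "y < 0" by linarith
  then show ?thesis
  proof cases
    case 1
    have "0 < fy (0, t)" if "0 < t" "t \<le> r" for t
    proof -
      have "0 < fy (0, t) \<longleftrightarrow> 0 < fy (0, r)"
        by (rule no_zero_imp_same_sign[of t r "\<lambda>t. fy (0, t)"]) (use that axis cont_y[OF cont_fy] in auto)
      then show ?thesis using ends0 by simp
    qed
    moreover have "0 \<le> z" "z < y" using z False 1 by (auto simp: closed_segment_eq_real_ivl split: if_splits)
    ultimately have "f (0, z) < f (0, y)" using y by (intro increasing) auto
    then show ?thesis by simp
  next
    case 2
    have "fy (0, t) < 0" if "t < 0" "- r \<le> t" for t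
    proof -
      have "0 < fy (0, - r) \<longleftrightarrow> 0 < fy (0, t)"
        by (rule no_zero_imp_same_sign[of "- r" t "\<lambda>t. fy (0, t)"]) (use that axis cont_y[OF cont_fy] in auto)
      moreover have "fy (0, t) \<noteq> 0" using axis[of t] that by auto
      ultimately show ?thesis using ends0 by simp
    qed
    moreover have "z \<le> 0" "y < z" using z False 2 by (auto simp: closed_segment_eq_real_ivl split: if_splits)
    ultimately have "f (0, z) < f (0, y)" using y by (intro decreasing) auto
    then show ?thesis by simp
  qed
qed simp

text \<open>Within the gap of \<open>y\<close> the function is monotone, so one of the two adjacent zeros can be reached without
  increasing \<open>f\<close>. At the bottom and the top the sign of \<open>fy\<close> excludes that it is \<open>- r\<close> or \<open>r\<close>.\<close>

lemma descent:
  assumes x: "x \<in> {0..<\<delta>}" and y: "\<bar>y\<bar> \<le> r"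
  shows "\<exists>i<n. \<forall>z\<in>closed_segment y (\<gamma> i x). f (x, z) \<le> f (x, y)"
proof -
  consider "x = 0" | "0 < x" "y \<in> Z x" | "0 < x" "y \<notin> Z x" using x by fastforce
  then show ?thesis
  proof cases
    case 1
    then show ?thesis using descent_axis[OF y] odd_pos[OF odd_n] by (intro exI[of _ 0]) (auto simp: \<gamma>_def)
  next
    case 2
    then obtain i where "i < n" "y = \<gamma> i x" using Z_eq[of x] x by auto
    then show ?thesis by (intro exI[of _ i]) auto
  next
    case 3
    then have x': "x \<in> {0<..<\<delta>}" using x by simp
    define i where "i = (LEAST i. n \<le> i \<or> y < \<gamma> i x)"
    have i: "n \<le> i \<or> y < \<gamma> i x" unfolding i_def by (rule LeastI[of _ n]) simp
    have i_le: "i \<le> n" unfolding i_def by (rule Least_le) simp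
    have below: "\<gamma> k x < y" if "k < i" for k
    proof -
      have k: "\<not> (n \<le> k \<or> y < \<gamma> k x)" using that unfolding i_def by (rule not_less_Least)
      then have "\<gamma> k x \<noteq> y" using 3(2) \<gamma>_in_Z[OF x', of k] by auto
      then show ?thesis using k by simp
    qed
    have above: "y < \<gamma> k x" if "i \<le> k" "k < n" for k
      using i that \<gamma>_less[of i k x] x' by (cases "i = k") auto
    have ygap: "y \<in> gap x i" using below above y by (auto simp: gap_def)
    show ?thesis
    proof (cases "even i")
      case True
      then have "i < n" using i_le odd_n by (cases "i = n") auto
      have neg: "fy (x, t) < 0" if "y \<le> t" "t < \<gamma> i x" for t
      proof -
        have "\<gamma> i x \<in> {- r..r}" using \<gamma>_in_Z[OF x' \<open>i < n\<close>] by (simp add: Z_def)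
        moreover have "t < \<gamma> k x" if "i \<le> k" "k < n" for k
          using \<gamma>_less[of i k x] x' that \<open>t < \<gamma> i x\<close> by (cases "i = k") auto
        moreover have "\<gamma> k x < t" if "k < i" for k using below[OF that] \<open>y \<le> t\<close> by simp
        ultimately have "t \<in> gap x i" using that y by (auto simp: gap_def)
        then show ?thesis using gap_sign[OF x' i_le, of t] gap_nonzero[OF x', of t i] True by auto
      qed
      have "f (x, z) \<le> f (x, y)" if z: "z \<in> closed_segment y (\<gamma> i x)" for z
      proof (cases "z = y")
        case False
        then have "y < z" "z \<le> \<gamma> i x"
          using z above[of i] \<open>i < n\<close> by (auto simp: closed_segment_eq_real_ivl)
        then have "f (x, z) < f (x, y)" using neg by (intro decreasing) auto
        then show ?thesis by simp
      qed simp
      then show ?thesis using \<open>i < n\<close> by blast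
    next
      case False
      then obtain j where j: "i = Suc j" by (cases i) auto
      have "j < n" using j i_le by simp
      have pos: "0 < fy (x, t)" if "\<gamma> j x < t" "t \<le> y" for t
      proof -
        have "\<gamma> j x \<in> {- r..r}" using \<gamma>_in_Z[OF x' \<open>j < n\<close>] by (simp add: Z_def)
        moreover have "\<gamma> k x < t" if "k < i" for k
          using \<gamma>_less[of k j x] x' that \<open>\<gamma> j x < t\<close> j \<open>j < n\<close> by (cases "k = j") auto
        moreover have "t < \<gamma> k x" if "i \<le> k" "k < n" for k using above[OF that] \<open>t \<le> y\<close> by simp
        ultimately have "t \<in> gap x i" using that y by (auto simp: gap_def)
        then show ?thesis using gap_sign[OF x' i_le, of t] False by simp
      qed
      have "f (x, z) \<le> f (x, y)" if z: "z \<in> closed_segment y (\<gamma> j x)" for z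
      proof (cases "z = y")
        case False
        then have "z < y" "\<gamma> j x \<le> z"
          using z below[of j] j by (auto simp: closed_segment_eq_real_ivl split: if_splits)
        then have "f (x, z) < f (x, y)" using pos by (intro increasing) auto
        then show ?thesis by simp
      qed simp
      then show ?thesis using \<open>j < n\<close> by blast
    qed
  qed
qed

lemma polar_branches: "polar_branches f fx fy r \<delta> n \<gamma>"
proof
  fix x i j assume i: "i < n" "j < n" "i \<noteq> j" and x: "x \<in> {0<..<\<delta>}"
  have "\<gamma> i x \<noteq> \<gamma> j x"
    using \<gamma>_less[of i j x] \<gamma>_less[of j i x] i x by (cases "i < j") auto
  then show "f (x, \<gamma> i x) \<noteq> f (x, \<gamma> j x)"
    using \<gamma>_in_Z[OF x] i x by (intro distinct_values) (auto simp: Z_def)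
next
  fix x i assume "i < n" "x \<in> {0..<\<delta>}"
  then show "\<bar>\<gamma> i x\<bar> < r"
    using \<gamma>_in_Z[of x i] Z_interior[of x "\<gamma> i x"] r by (cases "x = 0") (auto simp: \<gamma>_def abs_less_iff)
next
  fix x y assume x: "x \<in> {0<..<\<delta>}" and y: "\<bar>y\<bar> \<le> r"
  have "fy (x, y) = 0 \<longleftrightarrow> y \<in> Z x" using y by (auto simp: Z_def)
  then show "fy (x, y) = 0 \<longleftrightarrow> (\<exists>i<n. y = \<gamma> i x)" using Z_eq[OF x] by blast
next
  fix i x assume "Suc i < n" "even i" "x \<in> {0<..<\<delta>}"
  then show "f (x, \<gamma> i x) < f (x, \<gamma> (Suc i) x)"
    using \<gamma>_less[of i "Suc i" x] by (intro increasing_between) auto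
next
  fix i x assume "Suc i < n" "odd i" "x \<in> {0<..<\<delta>}"
  then show "f (x, \<gamma> (Suc i) x) < f (x, \<gamma> i x)"
    using \<gamma>_less[of i "Suc i" x] by (intro decreasing_between) auto
next
  show "\<gamma> i 0 = 0" for i by (simp add: \<gamma>_def)
  show "f (a, \<gamma> i a) < f (b, \<gamma> i b)" if "i < n" "0 \<le> a" "a < b" "b < \<delta>" for i a b
    using H_less[OF that] by (simp add: H_def)
qed (fact odd_n \<gamma>_cont \<gamma>_less fx_nonzero descent pass)+

end


section \<open>Vertical tangents of a level curve\<close>

lemma continuous_nonzero_bounds:
  fixes g :: "'a::metric_space \<Rightarrow> real"
  assumes "isCont g a" "g a > 0"
  obtains e where "e > 0" "\<And>p. dist p a < e \<Longrightarrow> g a / 2 < g p \<and> g p < 2 * g a"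
proof -
  have "g a / 2 < g a" "g a < 2 * g a" using assms(2) by simp_all
  then have "\<forall>\<^sub>F p in nhds a. g a / 2 < g p" "\<forall>\<^sub>F p in nhds a. g p < 2 * g a"
    using order_tendstoD[OF isCont_tendsto_nhds[OF assms(1)]] by blast+
  then have "\<forall>\<^sub>F p in nhds a. g a / 2 < g p \<and> g p < 2 * g a" by (rule eventually_conj)
  then show thesis using that unfolding eventually_nhds_metric by blast
qed

lemma eventually_at_of_nhds: "eventually P (nhds a) \<Longrightarrow> eventually P (at a)"
  by (simp add: eventually_nhds_conv_at)

lemma dist_Pair_le: "dist (a, b) (c, d) \<le> \<bar>a - c\<bar> + \<bar>b - (d :: real)\<bar>" for a c :: real
  using norm_Pair_le[of "a - c" "b - d"] by (simp add: dist_norm)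

text \<open>A point at which a level curve has a vertical tangent and nonzero curvature. The set \<open>C\<close> need only
  coincide with the level set near the point, as the boundary of a level disk does.\<close>

locale vertical_tangency =
  fixes f fx fy fyx fyy :: "real \<times> real \<Rightarrow> real" and x0 y0 \<epsilon> :: real and C :: "(real \<times> real) set"
  assumes f_deriv: "\<And>p. (f has_derivative (\<lambda>v. fst v * fx p + snd v * fy p)) (at p)"
    and fy_deriv: "\<And>p. (fy has_derivative (\<lambda>v. fst v * fyx p + snd v * fyy p)) (at p)"
    and cont_fx: "continuous_on UNIV fx" and cont_fyy: "continuous_on UNIV fyy"
    and on_level: "f (x0, y0) = \<epsilon>"
    and vertical: "fy (x0, y0) = 0"
    and transversal: "fx (x0, y0) \<noteq> 0"
    and curved: "fyy (x0, y0) \<noteq> 0"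
    and level: "\<forall>\<^sub>F p in nhds (x0, y0). p \<in> C \<longleftrightarrow> f p = \<epsilon>"
    and C_sub: "C \<subseteq> f -` {\<epsilon>}"
begin

lemma f_partial_x: "((\<lambda>x. f (x, y)) has_real_derivative fx (x, y)) (at x)"
proof -
  have "((\<lambda>x. (x, y)) has_derivative (\<lambda>v. (v, 0))) (at x)"
    by (intro derivative_eq_intros) auto
  from has_derivative_compose[OF this f_deriv[of "(x, y)"]]
  show ?thesis by (simp add: has_field_derivative_def mult_commute_abs)
qed

lemma level_on_vertical:
  obtains a A where "a > 0" "A > 0"
    "\<forall>\<^sub>F y in nhds y0. a * (y - y0)\<^sup>2 \<le> \<bar>f (x0, y) - \<epsilon>\<bar> \<and> \<bar>f (x0, y) - \<epsilon>\<bar> \<le> A * (y - y0)\<^sup>2"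
proof -
  define c where "c = \<bar>fyy (x0, y0)\<bar>"
  have "isCont (\<lambda>p. \<bar>fyy p\<bar>) (x0, y0)"
    using cont_fyy by (intro continuous_rabs) (simp add: continuous_on_eq_continuous_at)
  moreover have c: "c > 0" using curved by (simp add: c_def)
  ultimately obtain e where e: "e > 0"
      "\<And>p. dist p (x0, y0) < e \<Longrightarrow> c / 2 < \<bar>fyy p\<bar> \<and> \<bar>fyy p\<bar> < 2 * c"
    using continuous_nonzero_bounds[of "(x0, y0)" "\<lambda>p. \<bar>fyy p\<bar>"] unfolding c_def by blast
  have "c / 4 * (y - y0)\<^sup>2 \<le> \<bar>f (x0, y) - \<epsilon>\<bar> \<and> \<bar>f (x0, y) - \<epsilon>\<bar> \<le> c * (y - y0)\<^sup>2"
    if y: "dist y y0 < e" for y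
  proof (cases "y = y0")
    case False
    define diff where "diff k = (if k = 0 then \<lambda>t. f (x0, t) else if k = 1 then \<lambda>t. fy (x0, t)
        else (\<lambda>t. fyy (x0, t)))" for k :: nat
    \<comment> \<open>Taylor expansion to second order; the first two coefficients are \<open>\<epsilon>\<close> and zero.\<close>
    have "\<exists>t. (if y < y0 then y < t \<and> t < y0 else y0 < t \<and> t < y) \<and>
        f (x0, y) = (\<Sum>k<2. (diff k y0 / fact k) * (y - y0) ^ k) + (diff 2 t / fact 2) * (y - y0) ^ 2"
    proof (rule Taylor[where a = "min y y0" and b = "max y y0"])
      show "\<forall>k t. k < 2 \<and> min y y0 \<le> t \<and> t \<le> max y y0 \<longrightarrow> DERIV (diff k) t :> diff (Suc k) t"
        using partial_y[OF f_deriv] partial_y[OF fy_deriv] by (auto simp: diff_def less_2_cases_iff)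
    qed (use False in \<open>auto simp: diff_def\<close>)
    then obtain t where between: "if y < y0 then y < t \<and> t < y0 else y0 < t \<and> t < y"
      and expansion: "f (x0, y) =
        (\<Sum>k<2. (diff k y0 / fact k) * (y - y0) ^ k) + (diff 2 t / fact 2) * (y - y0) ^ 2"
      by blast
    have t: "\<bar>t - y0\<bar> \<le> \<bar>y - y0\<bar>" "f (x0, y) - \<epsilon> = fyy (x0, t) / 2 * (y - y0)\<^sup>2"
      using between expansion by (simp_all add: diff_def on_level vertical numeral_2_eq_2 split: if_splits)
    have "dist (x0, t) (x0, y0) < e"
      using dist_Pair_le[of x0 t x0 y0] t(1) y by (simp add: dist_real_def)
    then have "c / 2 \<le> \<bar>fyy (x0, t)\<bar>" "\<bar>fyy (x0, t)\<bar> \<le> 2 * c" using e(2) by force+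
    moreover have "\<bar>f (x0, y) - \<epsilon>\<bar> = \<bar>fyy (x0, t)\<bar> / 2 * (y - y0)\<^sup>2"
      by (simp add: t(2) abs_mult)
    moreover have "c / 4 * (y - y0)\<^sup>2 \<le> \<bar>fyy (x0, t)\<bar> / 2 * (y - y0)\<^sup>2"
        "\<bar>fyy (x0, t)\<bar> / 2 * (y - y0)\<^sup>2 \<le> c * (y - y0)\<^sup>2"
      using calculation(1,2) by (intro mult_right_mono; simp)+
    ultimately show ?thesis by simp
  qed (simp add: on_level)
  then have "\<forall>\<^sub>F y in nhds y0. c / 4 * (y - y0)\<^sup>2 \<le> \<bar>f (x0, y) - \<epsilon>\<bar> \<and> \<bar>f (x0, y) - \<epsilon>\<bar> \<le> c * (y - y0)\<^sup>2"
    using e(1) unfolding eventually_nhds_metric by blast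
  then show thesis using that[of "c / 4" c] c by simp
qed

text \<open>Solving \<open>f = \<epsilon>\<close> for \<open>x\<close>: the deviation of the level curve from its vertical tangent is
  comparable to \<open>f (x0, y) - \<epsilon>\<close>, that is, to the square of \<open>y - y0\<close>.\<close>

lemma level_curve_graph:
  obtains \<xi> k K where "k > 0" "K > 0"
    "\<forall>\<^sub>F y in nhds y0. f (\<xi> y, y) = \<epsilon> \<and> k * (y - y0)\<^sup>2 \<le> \<bar>\<xi> y - x0\<bar> \<and> \<bar>\<xi> y - x0\<bar> \<le> K * (y - y0)\<^sup>2"
proof -
  obtain a A where aA: "a > 0" "A > 0" and square:
    "\<forall>\<^sub>F y in nhds y0. a * (y - y0)\<^sup>2 \<le> \<bar>f (x0, y) - \<epsilon>\<bar> \<and> \<bar>f (x0, y) - \<epsilon>\<bar> \<le> A * (y - y0)\<^sup>2"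
    by (rule level_on_vertical)
  \<comment> \<open>Multiplying with \<open>\<sigma>\<close> makes \<open>f\<close> increasing in \<open>x\<close> near the point.\<close>
  define \<sigma> where "\<sigma> = sgn (fx (x0, y0))"
  define c where "c = \<sigma> * fx (x0, y0)"
  have \<sigma>: "\<bar>\<sigma>\<bar> = 1" "\<sigma> * \<sigma> = 1" and c: "c > 0"
    using transversal by (auto simp: \<sigma>_def c_def sgn_if)
  have "isCont (\<lambda>p. \<sigma> * fx p) (x0, y0)"
    using cont_fx by (intro continuous_mult continuous_const) (simp add: continuous_on_eq_continuous_at)
  then obtain e where e: "e > 0" "\<And>p. dist p (x0, y0) < e \<Longrightarrow> c / 2 < \<sigma> * fx p \<and> \<sigma> * fx p < 2 * c"
    using continuous_nonzero_bounds[of "(x0, y0)" "\<lambda>p. \<sigma> * fx p"] c unfolding c_def by blast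
  define e' where "e' = e / 3"
  have e': "e' > 0" using e by (simp add: e'_def)
  have slope: "c / 2 < \<sigma> * fx (x, y)" "\<sigma> * fx (x, y) < 2 * c"
    if "\<bar>x - x0\<bar> \<le> e'" "\<bar>y - y0\<bar> \<le> e'" for x y
  proof -
    have "dist (x, y) (x0, y0) < e"
      using dist_Pair_le[of x y x0 y0] that e(1) by (simp add: e'_def)
    then show "c / 2 < \<sigma> * fx (x, y)" "\<sigma> * fx (x, y) < 2 * c" using e(2) by blast+
  qed
  have mvt: "c / 2 * \<bar>x - x0\<bar> \<le> \<bar>f (x, y) - f (x0, y)\<bar> \<and> \<bar>f (x, y) - f (x0, y)\<bar> \<le> 2 * c * \<bar>x - x0\<bar> \<and>
      c / 2 * \<bar>x - x0\<bar> \<le> sgn (x - x0) * (\<sigma> * (f (x, y) - f (x0, y)))"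
    if xy: "\<bar>x - x0\<bar> \<le> e'" "\<bar>y - y0\<bar> \<le> e'" for x y
  proof -
    have "\<exists>z. \<bar>z - x0\<bar> \<le> \<bar>x - x0\<bar> \<and> f (x, y) - f (x0, y) = (x - x0) * fx (z, y)"
    proof (cases x x0 rule: linorder_cases)
      case less
      obtain z where z: "x < z" "z < x0" "f (x0, y) - f (x, y) = (x0 - x) * fx (z, y)"
        using MVT2[OF less, of "\<lambda>x. f (x, y)" "\<lambda>x. fx (x, y)"] f_partial_x by blast
      then show ?thesis by (intro exI[of _ z]) (auto simp: algebra_simps)
    next
      case greater
      obtain z where z: "x0 < z" "z < x" "f (x, y) - f (x0, y) = (x - x0) * fx (z, y)"
        using MVT2[OF greater, of "\<lambda>x. f (x, y)" "\<lambda>x. fx (x, y)"] f_partial_x by blast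
      then show ?thesis by (intro exI[of _ z]) auto
    qed auto
    then obtain z where z: "\<bar>z - x0\<bar> \<le> \<bar>x - x0\<bar>" and eq: "f (x, y) - f (x0, y) = (x - x0) * fx (z, y)"
      by blast
    define s where "s = \<sigma> * fx (z, y)"
    have s: "c / 2 < s" "s < 2 * c" using slope[of z y] z xy by (simp_all add: s_def)
    have fxz: "fx (z, y) = \<sigma> * s" using \<sigma>(2) by (simp add: s_def mult.assoc[symmetric])
    have abs: "\<bar>f (x, y) - f (x0, y)\<bar> = s * \<bar>x - x0\<bar>"
      unfolding eq fxz using \<sigma>(1) s c by (simp add: abs_mult)
    have "sgn (x - x0) * (\<sigma> * (f (x, y) - f (x0, y))) = (\<sigma> * \<sigma>) * s * (sgn (x - x0) * (x - x0))"
      unfolding eq fxz by (simp only: ac_simps)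
    also have "\<dots> = s * \<bar>x - x0\<bar>" using \<sigma>(2) by (simp add: mult_sgn_abs abs_sgn mult.commute)
    finally have signed: "sgn (x - x0) * (\<sigma> * (f (x, y) - f (x0, y))) = s * \<bar>x - x0\<bar>" .
    have "c / 2 * \<bar>x - x0\<bar> \<le> s * \<bar>x - x0\<bar>" "s * \<bar>x - x0\<bar> \<le> 2 * c * \<bar>x - x0\<bar>"
      using s by (intro mult_right_mono; simp)+
    then show ?thesis unfolding abs signed by simp
  qed
  have near: "\<forall>\<^sub>F y in nhds y0. \<bar>y - y0\<bar> < b" if "b > 0" for b
    using that unfolding eventually_nhds_metric by (auto simp: dist_real_def)
  \<comment> \<open>For \<open>y\<close> this close to \<open>y0\<close>, moving by \<open>e'\<close> to the left and to the right brackets the value \<open>\<epsilon>\<close>.\<close>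
  define b where "b = min e' (min 1 (c / 2 * e' / A))"
  have b: "b > 0" using e' aA c by (simp add: b_def)
  have "\<forall>\<^sub>F y in nhds y0. \<exists>x. f (x, y) = \<epsilon> \<and> a / (2 * c) * (y - y0)\<^sup>2 \<le> \<bar>x - x0\<bar> \<and>
      \<bar>x - x0\<bar> \<le> 2 * A / c * (y - y0)\<^sup>2"
    using square near[OF b]
  proof eventually_elim
    case (elim y)
    have y: "\<bar>y - y0\<bar> \<le> e'" "\<bar>y - y0\<bar> \<le> 1" "\<bar>y - y0\<bar> < c / 2 * e' / A" using elim(2) by (auto simp: b_def)
    have "(y - y0)\<^sup>2 \<le> \<bar>y - y0\<bar>"
      using mult_right_mono[OF y(2), of "\<bar>y - y0\<bar>"] by (simp add: power2_eq_square abs_mult[symmetric])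
    then have "A * (y - y0)\<^sup>2 \<le> A * \<bar>y - y0\<bar>" using aA by (intro mult_left_mono) auto
    also have "\<dots> < c / 2 * e'" using y(3) aA by (simp add: field_simps)
    finally have small: "\<bar>f (x0, y) - \<epsilon>\<bar> < c / 2 * e'" using elim(1) by linarith
    define g where "g x = \<sigma> * (f (x, y) - \<epsilon>)" for x
    have g0: "\<bar>g x0\<bar> < c / 2 * e'" using small \<sigma>(1) by (simp add: g_def abs_mult)
    have "c / 2 * e' \<le> g (x0 + e') - g x0"
      using mvt[of "x0 + e'" y] y e' by (simp add: g_def algebra_simps)
    moreover have "c / 2 * e' \<le> g x0 - g (x0 - e')"
      using mvt[of "x0 - e'" y] y e' by (simp add: g_def algebra_simps)
    ultimately have "g (x0 - e') \<le> 0" "0 \<le> g (x0 + e')" using g0 by linarith+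
    moreover have "continuous_on {x0 - e'..x0 + e'} g"
      unfolding g_def
      by (intro continuous_intros continuous_at_imp_continuous_on ballI DERIV_isCont[OF f_partial_x])
    ultimately obtain x where x: "x0 - e' \<le> x" "x \<le> x0 + e'" "g x = 0"
      using IVT'[of g "x0 - e'" 0 "x0 + e'"] e' by auto
    have fx\<epsilon>: "f (x, y) = \<epsilon>" using x(3) \<sigma>(1) by (auto simp: g_def)
    have "c / 2 * \<bar>x - x0\<bar> \<le> \<bar>f (x0, y) - \<epsilon>\<bar>" "\<bar>f (x0, y) - \<epsilon>\<bar> \<le> 2 * c * \<bar>x - x0\<bar>"
      using mvt[of x y] x(1,2) y(1) unfolding fx\<epsilon> by (auto simp: abs_minus_commute)
    then have "c / 2 * \<bar>x - x0\<bar> \<le> A * (y - y0)\<^sup>2" "a * (y - y0)\<^sup>2 \<le> 2 * c * \<bar>x - x0\<bar>"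
      using elim(1) by linarith+
    then have "\<bar>x - x0\<bar> \<le> 2 * A / c * (y - y0)\<^sup>2" "a / (2 * c) * (y - y0)\<^sup>2 \<le> \<bar>x - x0\<bar>"
      using c by (simp_all add: field_simps)
    then show ?case using fx\<epsilon> by blast
  qed
  then have "\<exists>\<xi>. \<forall>\<^sub>F y in nhds y0. f (\<xi> y, y) = \<epsilon> \<and> a / (2 * c) * (y - y0)\<^sup>2 \<le> \<bar>\<xi> y - x0\<bar> \<and>
      \<bar>\<xi> y - x0\<bar> \<le> 2 * A / c * (y - y0)\<^sup>2"
    unfolding eventually_ex .
  then show thesis using that[of "a / (2 * c)" "2 * A / c"] aA c by auto
qed

lemma level_curve_path:
  obtains q k K where "k > 0" "K > 0" "q 0 = (x0, y0)" "\<forall>\<^sub>F t in nhds 0. q t \<in> C"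
    "(q has_vector_derivative (0, 1)) (at 0)" "\<And>t. snd (q t) = y0 + t"
    "\<forall>\<^sub>F t in nhds 0. k * t\<^sup>2 \<le> \<bar>fst (q t) - x0\<bar> \<and> \<bar>fst (q t) - x0\<bar> \<le> K * t\<^sup>2"
proof -
  obtain \<xi> k K where kK: "k > 0" "K > 0" and ev: "\<forall>\<^sub>F y in nhds y0. f (\<xi> y, y) = \<epsilon> \<and>
      k * (y - y0)\<^sup>2 \<le> \<bar>\<xi> y - x0\<bar> \<and> \<bar>\<xi> y - x0\<bar> \<le> K * (y - y0)\<^sup>2"
    by (rule level_curve_graph)
  define q where "q t = (\<xi> (y0 + t), y0 + t)" for t
  have "((\<lambda>t. y0 + t) \<longlongrightarrow> y0) (nhds 0)"
    using isCont_tendsto_nhds[of 0 "\<lambda>t. y0 + t"] by simp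
  from eventually_compose_filterlim[OF ev this] have ev': "\<forall>\<^sub>F t in nhds 0. f (q t) = \<epsilon> \<and> k * t\<^sup>2 \<le> \<bar>fst (q t) - x0\<bar> \<and> \<bar>fst (q t) - x0\<bar> \<le> K * t\<^sup>2"
    by (simp add: q_def)
  have q0: "q 0 = (x0, y0)"
    using eventually_nhds_x_imp_x[OF ev'] by (simp add: q_def)
  have deriv: "((\<lambda>t. \<xi> (y0 + t)) has_real_derivative 0) (at 0)"
    unfolding has_field_derivative_def has_derivative_at_alt
  proof (intro conjI allI impI)
    fix e :: real assume e: "e > 0"
    have "\<forall>\<^sub>F t in nhds 0. \<bar>t\<bar> < e / K"
      using e kK unfolding eventually_nhds_metric by (intro exI[of _ "e / K"]) (auto simp: dist_real_def)
    with ev' have "\<forall>\<^sub>F t in nhds 0. \<bar>\<xi> (y0 + t) - x0\<bar> \<le> e * \<bar>t\<bar>"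
    proof eventually_elim
      case (elim t)
      have "\<bar>\<xi> (y0 + t) - x0\<bar> \<le> (K * \<bar>t\<bar>) * \<bar>t\<bar>"
        using elim(1) by (simp add: q_def power2_eq_square abs_mult[symmetric] mult.assoc)
      also have "\<dots> \<le> e * \<bar>t\<bar>" using elim(2) kK by (intro mult_right_mono) (auto simp: field_simps)
      finally show ?case .
    qed
    then show "\<exists>d>0. \<forall>y. norm (y - 0) < d \<longrightarrow> norm (\<xi> (y0 + y) - \<xi> (y0 + 0) - 0 * (y - 0)) \<le> e * norm (y - 0)"
      using q0 unfolding eventually_nhds_metric q_def by (simp add: dist_norm)
  qed (rule bounded_linear_mult_right)
  have qd: "(q has_vector_derivative (0, 1)) (at 0)"
    unfolding q_def
    by (intro has_vector_derivative_Pair)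
      (use deriv in \<open>auto simp: has_real_derivative_iff_has_vector_derivative intro!: derivative_eq_intros\<close>)
  then have "isCont q 0" by (rule has_vector_derivative_continuous)
  then have "\<forall>\<^sub>F t in nhds 0. q t \<in> C \<longleftrightarrow> f (q t) = \<epsilon>"
    using eventually_compose_filterlim[OF level] isCont_tendsto_nhds[of 0 q] q0 by simp
  with ev' have "\<forall>\<^sub>F t in nhds 0. q t \<in> C" by eventually_elim simp
  moreover have "\<forall>\<^sub>F t in nhds 0. k * t\<^sup>2 \<le> \<bar>fst (q t) - x0\<bar> \<and> \<bar>fst (q t) - x0\<bar> \<le> K * t\<^sup>2"
    using ev' by eventually_elim simp
  ultimately show thesis using that[of k K q] kK q0 qd by (simp add: q_def)
qed

lemma tangent: "tangent_vector C (x0, y0) (0, 1)"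
  using level_curve_path unfolding tangent_vector_def by metis

end

lemma tangent_vector_kernel:
  fixes f :: "real \<times> real \<Rightarrow> real"
  assumes f: "(f has_derivative f') (at p)" and "C \<subseteq> f -` {\<epsilon>}" "tangent_vector C p v"
  shows "f' v = 0"
proof -
  obtain q where q: "q 0 = p" "\<forall>\<^sub>F t in nhds 0. q t \<in> C" "(q has_vector_derivative v) (at 0)"
    using assms(3) by (auto simp: tangent_vector_def)
  have "((\<lambda>t. f (q t)) has_derivative (\<lambda>t. f' (t *\<^sub>R v))) (at 0)"
    using has_derivative_compose[OF q(3)[unfolded has_vector_derivative_def]] f q(1) by simp
  moreover have "((\<lambda>t. f (q t)) has_derivative (\<lambda>t. 0)) (at 0)"
  proof (rule has_derivative_transform_eventually)
    show "((\<lambda>t. \<epsilon>) has_derivative (\<lambda>t. 0)) (at (0::real))" by (rule has_derivative_const)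
    have ev: "\<forall>\<^sub>F t in nhds 0. \<epsilon> = f (q t)" using q(2) by eventually_elim (use assms(2) in auto)
    then show "\<forall>\<^sub>F t in at 0. \<epsilon> = f (q t)" by (rule eventually_at_of_nhds)
    show "\<epsilon> = f (q 0)" using eventually_nhds_x_imp_x[OF ev] .
  qed simp
  ultimately have "(\<lambda>t. f' (t *\<^sub>R v)) = (\<lambda>t. 0)" by (rule has_derivative_unique)
  from fun_cong[OF this, of 1] show ?thesis by simp
qed

context vertical_tangency
begin

text \<open>A tangent vector is vertical, so the quotient in the definition of an inflection point compares the horizontal
  deviation with the squared distance. Along the level curve both are of the order of \<open>(y - y0)\<^sup>2\<close>.\<close>

lemma not_inflection: "\<not> inflection_point C (x0, y0)"
proof
  assume "inflection_point C (x0, y0)"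
  then obtain v where v: "v \<noteq> 0" "tangent_vector C (x0, y0) v" and lim:
    "((\<lambda>q. (fst v * snd (q - (x0, y0)) - snd v * fst (q - (x0, y0))) / (dist q (x0, y0))\<^sup>2) \<longlongrightarrow> 0)
       (at (x0, y0) within C)"
    unfolding inflection_point_def by blast
  have "fst v * fx (x0, y0) + snd v * fy (x0, y0) = 0"
    using tangent_vector_kernel[OF f_deriv C_sub v(2)] .
  then have v1: "fst v = 0" using vertical transversal by simp
  then have v2: "snd v \<noteq> 0" using v(1) by (auto simp: prod_eq_iff)
  obtain q k K where kK: "k > 0" "K > 0" and q: "q 0 = (x0, y0)" "\<forall>\<^sub>F t in nhds 0. q t \<in> C"
    "(q has_vector_derivative (0, 1)) (at 0)" "\<And>t. snd (q t) = y0 + t"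
    and bounds: "\<forall>\<^sub>F t in nhds 0. k * t\<^sup>2 \<le> \<bar>fst (q t) - x0\<bar> \<and> \<bar>fst (q t) - x0\<bar> \<le> K * t\<^sup>2"
    by (rule level_curve_path) (rule that; assumption)
  have "filterlim q (at (x0, y0) within C) (at 0)"
    unfolding filterlim_at
  proof (intro conjI)
    have "isCont q 0" using q(3) by (rule has_vector_derivative_continuous)
    then show "(q \<longlongrightarrow> (x0, y0)) (at 0)" using q(1) by (simp add: isCont_def)
    have "\<forall>\<^sub>F t in at (0::real). t \<noteq> 0" by (simp add: eventually_at_filter)
    with eventually_at_of_nhds[OF q(2)] show "\<forall>\<^sub>F t in at 0. q t \<in> C \<and> q t \<noteq> (x0, y0)"
    proof eventually_elim
      case (elim t)
      then show ?case using q(4)[of t] by auto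
    qed
  qed
  from filterlim_compose[OF lim this]
  have lim': "((\<lambda>t. - (snd v * (fst (q t) - x0)) / (dist (q t) (x0, y0))\<^sup>2) \<longlongrightarrow> 0) (at 0)"
    by (simp add: v1)
  define c where "c = \<bar>snd v\<bar> * k / (1 + K\<^sup>2)"
  have c: "c > 0" using v2 kK by (auto simp: c_def intro!: divide_pos_pos mult_pos_pos add_pos_nonneg)
  have "\<forall>\<^sub>F t in at 0. \<bar>t\<bar> \<le> (1::real) \<and> t \<noteq> 0"
    by (auto simp: eventually_at dist_real_def intro!: exI[of _ 1])
  with eventually_at_of_nhds[OF bounds] tendstoD[OF lim' c]
  have "\<forall>\<^sub>F t in at (0::real). False"
  proof eventually_elim
    case (elim t)
    define s where "s = fst (q t) - x0"
    have t2: "t\<^sup>2 > 0" "t\<^sup>2 \<le> 1" using elim(3) by (auto simp: abs_square_le_1)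
    have "(dist (q t) (x0, y0))\<^sup>2 = s\<^sup>2 + t\<^sup>2"
      using q(4)[of t] by (simp add: dist_prod_def dist_real_def s_def)
    moreover have "s\<^sup>2 \<le> (K * t\<^sup>2)\<^sup>2" using elim(1) by (intro abs_le_square_iff[THEN iffD1]) (auto simp: s_def)
    moreover have "(K * t\<^sup>2)\<^sup>2 \<le> K\<^sup>2 * t\<^sup>2"
      using mult_left_mono[OF mult_right_mono[OF t2(2), of "t\<^sup>2"], of "K\<^sup>2"] by (simp add: power2_eq_square ac_simps)
    ultimately have dist2: "(dist (q t) (x0, y0))\<^sup>2 \<le> (1 + K\<^sup>2) * t\<^sup>2" "0 < (dist (q t) (x0, y0))\<^sup>2"
      using t2 by (auto simp: algebra_simps intro: add_nonneg_pos)
    have "\<bar>snd v\<bar> * \<bar>s\<bar> < c * (dist (q t) (x0, y0))\<^sup>2"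
      using elim(2) dist2(2) by (simp add: s_def dist_real_def abs_mult divide_less_eq)
    also have "\<dots> \<le> c * ((1 + K\<^sup>2) * t\<^sup>2)" using dist2(1) c by (intro mult_left_mono) auto
    also have "\<dots> = \<bar>snd v\<bar> * (k * t\<^sup>2)"
    proof -
      have "1 + K\<^sup>2 \<noteq> 0" by (metis add_pos_nonneg less_irrefl zero_le_power2 zero_less_one)
      then show ?thesis by (simp add: c_def)
    qed
    also have "\<dots> \<le> \<bar>snd v\<bar> * \<bar>s\<bar>" using elim(1) by (intro mult_left_mono) (auto simp: s_def)
    finally show False by simp
  qed
  then show False by simp
qed

end


section \<open>The level disk in a box around the origin\<close>

lemma PR_class_eq_iff:
  assumes p: "p \<in> D" and q: "q \<in> D"
  shows "PR_class D p = PR_class D q \<longleftrightarrow>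
    fst p = fst q \<and> (\<forall>z\<in>closed_segment (snd p) (snd q). (fst p, z) \<in> D)"
proof -
  have "PR_class D p = PR_class D q \<longleftrightarrow> (p, q) \<in> PR_rel D"
    unfolding PR_class_def using eq_equiv_class_iff[OF equiv_PR_rel p q] .
  also have "\<dots> \<longleftrightarrow> fst p = fst q \<and> (\<forall>z\<in>closed_segment (snd p) (snd q). (fst p, z) \<in> D)"
  proof
    assume "(p, q) \<in> PR_rel D"
    then obtain S where S: "connected S" "S \<subseteq> D \<inter> fst -` {fst p}" "p \<in> S" "q \<in> S"
      unfolding PR_rel_iff connected_component_def by blast
    have "connected (snd ` S)" using S(1) by (intro connected_continuous_image continuous_intros)
    then have "closed_segment (snd p) (snd q) \<subseteq> snd ` S"
      using S(3,4) by (intro closed_segment_subset) (auto simp: connected_convex_1)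
    moreover have "(fst p, z) \<in> D" if z: "z \<in> snd ` S" for z
    proof -
      obtain q' where "q' \<in> S" "z = snd q'" using z by blast
      then have "q' \<in> D" "fst q' = fst p" "(fst q', z) = q'" using S(2) by auto
      then show ?thesis by metis
    qed
    moreover have "fst q = fst p" using S(2,4) by auto
    ultimately show "fst p = fst q \<and> (\<forall>z\<in>closed_segment (snd p) (snd q). (fst p, z) \<in> D)"
      by auto
  next
    assume *: "fst p = fst q \<and> (\<forall>z\<in>closed_segment (snd p) (snd q). (fst p, z) \<in> D)"
    have "connected ((\<lambda>z. (fst p, z)) ` closed_segment (snd p) (snd q))"
      by (intro connected_continuous_image continuous_intros connected_segment)
    moreover have "p \<in> (\<lambda>z. (fst p, z)) ` closed_segment (snd p) (snd q)"
      by (rule image_eqI[of _ _ "snd p"]) auto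
    moreover have "q \<in> (\<lambda>z. (fst p, z)) ` closed_segment (snd p) (snd q)"
      using * by (intro image_eqI[of _ _ "snd q"]) (auto simp: prod_eq_iff)
    moreover have "(\<lambda>z. (fst p, z)) ` closed_segment (snd p) (snd q) \<subseteq> D \<inter> fst -` {fst p}"
      using * by auto
    ultimately show "(p, q) \<in> PR_rel D"
      unfolding PR_rel_iff connected_component_def by blast
  qed
  finally show ?thesis .
qed

context polar_branches
begin

text \<open>Between two critical points on a vertical line the critical values decide whether \<open>f\<close> stays below a level.\<close>

lemma segment_below_iff:
  assumes "i < n" "j < n" "x \<in> {0<..<\<delta>}"
  shows "(\<forall>z\<in>closed_segment (\<gamma> i x) (\<gamma> j x). f (x, z) \<le> c) \<longleftrightarrow>
    (\<forall>k\<in>{min i j..max i j}. f (x, \<gamma> k x) \<le> c)"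
proof -
  have *: "(\<forall>z\<in>closed_segment (\<gamma> i x) (\<gamma> j x). f (x, z) \<le> c) \<longleftrightarrow> (\<forall>k\<in>{i..j}. f (x, \<gamma> k x) \<le> c)"
    if ij: "i \<le> j" "j < n" for i j
  proof -
    have \<gamma>_le: "\<gamma> k x \<le> \<gamma> l x" if "k \<le> l" "l < n" for k l
      using \<gamma>_less[of k l x] that assms(3) by (cases "k = l") auto
    have seg: "closed_segment (\<gamma> i x) (\<gamma> j x) = {\<gamma> i x..\<gamma> j x}"
      using \<gamma>_le[OF ij] by (simp add: closed_segment_eq_real_ivl)
    show ?thesis
    proof
      assume "\<forall>z\<in>closed_segment (\<gamma> i x) (\<gamma> j x). f (x, z) \<le> c"
      then show "\<forall>k\<in>{i..j}. f (x, \<gamma> k x) \<le> c" unfolding seg using \<gamma>_le ij by auto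
    next
      assume k: "\<forall>k\<in>{i..j}. f (x, \<gamma> k x) \<le> c"
      show "\<forall>z\<in>closed_segment (\<gamma> i x) (\<gamma> j x). f (x, z) \<le> c"
      proof
        fix z assume "z \<in> closed_segment (\<gamma> i x) (\<gamma> j x)"
        then obtain k where "k \<in> {i..j}" "f (x, z) \<le> f (x, \<gamma> k x)"
          using pass[OF ij, of x z] assms(3) unfolding seg by auto
        then show "f (x, z) \<le> c" using k by force
      qed
    qed
  qed
  show ?thesis
  proof (cases "i \<le> j")
    case True
    then show ?thesis using *[of i j] assms by (simp add: min_def max_def)
  next
    case False
    then show ?thesis using *[of j i] assms by (simp add: min_def max_def closed_segment_commute)
  qed
qed

text \<open>The critical values of two half-branches never coincide, so their order cannot change.\<close>

lemma value_order_constant: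
  assumes f: "continuous_on UNIV f" and ij: "i < n" "j < n" "i \<noteq> j"
    and "a \<in> {0<..<\<delta>}" "b \<in> {0<..<\<delta>}"
  shows "f (a, \<gamma> i a) < f (a, \<gamma> j a) \<longleftrightarrow> f (b, \<gamma> i b) < f (b, \<gamma> j b)"
proof -
  have sub: "{min a b..max a b} \<subseteq> {0<..<\<delta>}" using assms(5,6) by auto
  have cont: "continuous_on {min a b..max a b} (\<lambda>x. f (x, \<gamma> k x))" if "k < n" for k
  proof (rule continuous_on_compose2[OF f])
    have "continuous_on {min a b..max a b} (\<gamma> k)"
      by (rule continuous_on_subset[OF \<gamma>_cont[OF that]]) (use sub in auto)
    then show "continuous_on {min a b..max a b} (\<lambda>x. (x, \<gamma> k x))" by (intro continuous_intros)
  qed simp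
  have "0 < f (a, \<gamma> j a) - f (a, \<gamma> i a) \<longleftrightarrow> 0 < f (b, \<gamma> j b) - f (b, \<gamma> i b)"
  proof (rule no_zero_imp_same_sign[of a b "\<lambda>x. f (x, \<gamma> j x) - f (x, \<gamma> i x)"])
    show "continuous_on {min a b..max a b} (\<lambda>x. f (x, \<gamma> j x) - f (x, \<gamma> i x))"
      using cont ij by (intro continuous_on_diff) auto
    fix x assume "x \<in> {min a b..max a b}"
    then show "f (x, \<gamma> j x) - f (x, \<gamma> i x) \<noteq> 0" using value_distinct[OF ij, of x] sub by auto
  qed
  then show ?thesis by simp
qed

end

text \<open>The box has half width \<open>d\<close> and half height \<open>r\<close>; on its rim \<open>f\<close> is at least \<open>\<epsilon>\<^sub>0\<close>. The two half planes are
  described together, the reflection \<open>x \<mapsto> s x\<close> with \<open>s = - 1\<close> turning the left one into the right one.\<close>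

locale polar_box =
  fixes f fx fy fyx fyy :: "real \<times> real \<Rightarrow> real" and r \<delta> d \<epsilon>\<^sub>0 :: real
    and n :: "real \<Rightarrow> nat" and \<gamma> :: "real \<Rightarrow> nat \<Rightarrow> real \<Rightarrow> real"
  assumes f_deriv: "(f has_derivative (\<lambda>v. fst v * fx p + snd v * fy p)) (at p)"
    and fy_deriv: "(fy has_derivative (\<lambda>v. fst v * fyx p + snd v * fyy p)) (at p)"
    and cont_fx: "continuous_on UNIV fx" and cont_fyy: "continuous_on UNIV fyy"
    and r: "0 < r" and d: "0 < d" "d < \<delta>" and \<epsilon>\<^sub>0: "0 < \<epsilon>\<^sub>0"
    and branches: "s = 1 \<or> s = - 1 \<Longrightarrow>
      polar_branches (\<lambda>p. f (s * fst p, snd p)) (\<lambda>p. s * fx (s * fst p, snd p))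
        (\<lambda>p. fy (s * fst p, snd p)) r \<delta> (n s) (\<gamma> s)"
    and f_0: "f (0, 0) = 0"
    and f_nonneg: "\<bar>x\<bar> \<le> d \<Longrightarrow> \<bar>y\<bar> \<le> r \<Longrightarrow> 0 \<le> f (x, y)"
    and f_rim: "\<bar>x\<bar> \<le> d \<Longrightarrow> \<bar>y\<bar> \<le> r \<Longrightarrow> \<bar>x\<bar> = d \<or> \<bar>y\<bar> = r \<Longrightarrow> \<epsilon>\<^sub>0 \<le> f (x, y)"
    and axis: "y \<noteq> 0 \<Longrightarrow> \<bar>y\<bar> \<le> r \<Longrightarrow> fy (0, y) \<noteq> 0"
    and simple: "x \<noteq> 0 \<Longrightarrow> \<bar>x\<bar> \<le> d \<Longrightarrow> fy (x, y) = 0 \<Longrightarrow> fyy (x, y) \<noteq> 0"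
begin

lemma cont_f: "continuous_on S f"
  using f_deriv by (meson continuous_at_imp_continuous_on has_derivative_continuous)

abbreviation "m \<equiv> n 1"

definition M :: nat where "M = Suc (n 1 + n (- 1))"

abbreviation "sd \<equiv> side m"

text \<open>The index of a half-branch among those on its own side.\<close>

definition loc :: "nat \<Rightarrow> nat" where
  "loc i = (if i < m then i else i - m - 1)"

text \<open>The ordinate of the \<open>i\<close>-th half-branch at distance \<open>t\<close> from the axis. For the origin, \<open>i = m\<close>, it is
  constant.\<close>

definition ord :: "nat \<Rightarrow> real \<Rightarrow> real" where
  "ord i t = (if i = m then 0 else \<gamma> (sd i) (loc i) t)"

definition P :: "nat \<Rightarrow> real \<Rightarrow> real \<times> real" where
  "P i t = (sd i * t, ord i t)"

lemma m_less: "m < M"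
  by (simp add: M_def)

lemma odd_m: "odd m" and odd_M: "odd M"
  using polar_branches.odd_n[OF branches[of 1]] polar_branches.odd_n[OF branches[of "- 1"]]
  by (simp_all add: M_def)

lemma side_cases: "i \<noteq> m \<Longrightarrow> sd i = 1 \<or> sd i = - 1"
  by (simp add: side_def)

lemma branch: "i \<noteq> m \<Longrightarrow>
    polar_branches (\<lambda>p. f (sd i * fst p, snd p)) (\<lambda>p. sd i * fx (sd i * fst p, snd p))
      (\<lambda>p. fy (sd i * fst p, snd p)) r \<delta> (n (sd i)) (\<gamma> (sd i))"
  using branches side_cases by blast

lemma loc_less: "i < M \<Longrightarrow> i \<noteq> m \<Longrightarrow> loc i < n (sd i)"
  by (auto simp: loc_def side_def M_def)

lemma global_index:
  assumes "s = 1 \<or> s = - 1" "k < n s"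
  obtains i where "i < M" "i \<noteq> m" "sd i = s" "loc i = k"
proof (cases "s = 1")
  case True
  then show thesis using that[of k] assms by (simp add: side_def loc_def M_def)
next
  case False
  then show thesis using that[of "Suc (m + k)"] assms by (simp add: side_def loc_def M_def)
qed

lemma same_side_less:
  "i \<noteq> m \<Longrightarrow> j \<noteq> m \<Longrightarrow> sd i = sd j \<Longrightarrow> i < j \<longleftrightarrow> loc i < loc j"
  by (auto simp: side_def loc_def split: if_splits)

lemma same_side_eq:
  "i \<noteq> m \<Longrightarrow> j \<noteq> m \<Longrightarrow> sd i = sd j \<Longrightarrow> i = j \<longleftrightarrow> loc i = loc j"
  by (auto simp: side_def loc_def split: if_splits)

lemma ord_eq: "i \<noteq> m \<Longrightarrow> ord i t = \<gamma> (sd i) (loc i) t"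
  by (simp add: ord_def)

lemma fP: "i \<noteq> m \<Longrightarrow> f (P i t) = f (sd i * t, \<gamma> (sd i) (loc i) t)"
  by (simp add: P_def ord_eq)

lemma P_0: "i < M \<Longrightarrow> P i 0 = (0, 0)"
  using polar_branches.\<gamma>_0[OF branch loc_less, of i] by (auto simp: P_def ord_def)

lemma ord_cont: "i < M \<Longrightarrow> continuous_on {0..<\<delta>} (ord i)"
  using polar_branches.\<gamma>_cont[OF branch loc_less, of i] unfolding ord_def[abs_def]
  by (cases "i = m") auto

lemma ord_range: "i < M \<Longrightarrow> t \<in> {0..<\<delta>} \<Longrightarrow> \<bar>ord i t\<bar> < r"
  using polar_branches.\<gamma>_range[OF branch loc_less, of i t] r by (cases "i = m") (auto simp: ord_def)

lemma P_cont: "i < M \<Longrightarrow> continuous_on {0..<\<delta>} (P i)"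
  unfolding P_def[abs_def] by (intro continuous_intros ord_cont)

lemma fP_less: "i < M \<Longrightarrow> i \<noteq> m \<Longrightarrow> 0 \<le> a \<Longrightarrow> a < b \<Longrightarrow> b < \<delta> \<Longrightarrow> f (P i a) < f (P i b)"
  using polar_branches.value_less[OF branch loc_less, of i a b] by (simp add: fP)

lemma fP_distinct:
  assumes "i < M" "j < M" "i \<noteq> m" "j \<noteq> m" "i \<noteq> j" "sd i = sd j" "t \<in> {0<..<\<delta>}"
  shows "f (P i t) \<noteq> f (P j t)"
  using polar_branches.value_distinct[OF branch, of i "loc i" "loc j" t] loc_less[of i] loc_less[of j]
    same_side_eq[of i j] assms by (simp add: fP)

lemma critical_points:
  assumes "\<bar>x\<bar> \<le> d" "\<bar>y\<bar> \<le> r" "fy (x, y) = 0" "(x, y) \<noteq> (0, 0)"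
  obtains i t where "i < M" "i \<noteq> m" "0 < t" "t \<le> d" "(x, y) = P i t"
proof -
  have "x \<noteq> 0" using axis[of y] assms by auto
  define s where "s = sgn x"
  have s: "s = 1 \<or> s = - 1" "s * x = \<bar>x\<bar>" "s * \<bar>x\<bar> = x" using \<open>x \<noteq> 0\<close> by (auto simp: s_def sgn_if)
  have x: "\<bar>x\<bar> \<in> {0<..<\<delta>}" using \<open>x \<noteq> 0\<close> assms d by auto
  then obtain k where k: "k < n s" "y = \<gamma> s k \<bar>x\<bar>"
    using polar_branches.\<gamma>_zero[OF branches[OF s(1)] x assms(2)] assms(3) s by auto
  obtain i where i: "i < M" "i \<noteq> m" "sd i = s" "loc i = k" using global_index[OF s(1) k(1)] .
  then have "(x, y) = P i \<bar>x\<bar>" using k s by (simp add: P_def ord_eq)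
  then show thesis using that[of i "\<bar>x\<bar>"] i x assms by auto
qed

lemma fy_branch: "i < M \<Longrightarrow> i \<noteq> m \<Longrightarrow> t \<in> {0<..<\<delta>} \<Longrightarrow> fy (P i t) = 0"
  using polar_branches.\<gamma>_zero[OF branch, of i t "ord i t"] loc_less[of i] ord_range[of i t]
  by (auto simp: P_def ord_eq)

lemma fx_branch: "i < M \<Longrightarrow> i \<noteq> m \<Longrightarrow> t \<in> {0<..<\<delta>} \<Longrightarrow> fx (P i t) \<noteq> 0"
  using polar_branches.fx_nonzero[OF branch loc_less, of i t] by (auto simp: P_def ord_eq)

lemma fP_end: "i < M \<Longrightarrow> i \<noteq> m \<Longrightarrow> \<epsilon>\<^sub>0 \<le> f (P i d)"
  using f_rim[of "sd i * d" "ord i d"] side_cases[of i] ord_range[of i d] d by (auto simp: P_def)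

text \<open>The abscissa, up to sign, at which the \<open>i\<close>-th half-branch leaves the disk; the index \<open>m\<close> of
  the origin gets the value zero.\<close>

definition \<tau> :: "real \<Rightarrow> nat \<Rightarrow> real" where
  "\<tau> \<epsilon> i = (if i = m then 0 else THE t. 0 < t \<and> t < d \<and> f (P i t) = \<epsilon>)"

context
  fixes \<epsilon> :: real
  assumes \<epsilon>: "0 < \<epsilon>" "\<epsilon> < \<epsilon>\<^sub>0"
begin

abbreviation "leave \<equiv> \<tau> \<epsilon>"

lemma exit:
  assumes i: "i < M" "i \<noteq> m"
  shows "0 < leave i" "leave i < d" "f (P i (leave i)) = \<epsilon>"
proof -
  have "continuous_on {0..d} (\<lambda>t. f (P i t))"
    by (rule continuous_on_compose2[OF cont_f]) (use d i in \<open>auto intro: continuous_on_subset[OF P_cont]\<close>)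
  then obtain t where t: "0 \<le> t" "t \<le> d" "f (P i t) = \<epsilon>"
    using IVT'[of "\<lambda>t. f (P i t)" 0 \<epsilon> d] P_0[OF i(1)] f_0 fP_end[OF i] \<epsilon> d by auto
  moreover have "t \<noteq> 0" "t \<noteq> d" using t P_0[OF i(1)] f_0 fP_end[OF i] \<epsilon> by auto
  ultimately have t': "0 < t \<and> t < d \<and> f (P i t) = \<epsilon>" by auto
  have "leave i = t"
    unfolding \<tau>_def using i(2)
  proof (simp, intro the_equality t')
    fix u assume u: "0 < u \<and> u < d \<and> f (P i u) = \<epsilon>"
    show "u = t"
      using fP_less[OF i, of u t] fP_less[OF i, of t u] u t' d by (cases u t rule: linorder_cases) auto
  qed
  then show "0 < leave i" "leave i < d" "f (P i (leave i)) = \<epsilon>" using t' by auto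
qed

lemma below_iff:
  assumes "i < M" "i \<noteq> m" "t \<in> {0..<\<delta>}"
  shows "f (P i t) \<le> \<epsilon> \<longleftrightarrow> t \<le> leave i"
  using fP_less[OF assms(1,2), of t "leave i"] fP_less[OF assms(1,2), of "leave i" t] exit[OF assms(1,2)] assms(3) d
  by (cases t "leave i" rule: linorder_cases) auto

lemma T_m: "leave m = 0"
  by (simp add: \<tau>_def)

lemma T_bounds: "i < M \<Longrightarrow> 0 \<le> leave i \<and> leave i < d"
  using exit[of i] T_m d by (cases "i = m") auto

lemma exit_order:
  assumes "i < M" "j < M" "i \<noteq> m" "j \<noteq> m" "f (P i (leave i)) < f (P j (leave i))"
  shows "leave j < leave i"
  using below_iff[of j "leave i"] exit[of i] assms d by force

lemma alternating: "alternating_sequence M m leave"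
proof
  show "m < M" "odd m" "odd M" "leave m = 0" by (fact m_less odd_m odd_M T_m)+
  show "0 < leave i" if "i < M" "i \<noteq> m" for i using exit that by blast
  show "leave i \<noteq> leave j" if ij: "i < M" "j < M" "i \<noteq> j" "sd i = sd j" for i j
  proof
    assume eq: "leave i = leave j"
    have "i \<noteq> m" "j \<noteq> m" using ij by (auto simp: side_def split: if_splits)
    then show False
      using fP_distinct[of i j "leave i"] exit[of i] exit[of j] ij eq d by auto
  qed
  fix i assume i: "Suc i < M"
  consider "Suc i = m" | "i = m" | "i \<noteq> m" "Suc i \<noteq> m" by blast
  note cases = this
  have consecutive: "sd (Suc i) = sd i" "loc (Suc i) = Suc (loc i)" "Suc (loc i) < n (sd i)"
    "even (loc i) \<longleftrightarrow> even i" if "i \<noteq> m" "Suc i \<noteq> m"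
  proof -
    show "sd (Suc i) = sd i" "loc (Suc i) = Suc (loc i)" using that by (auto simp: side_def loc_def)
    then show "Suc (loc i) < n (sd i)" using loc_less[of "Suc i"] that i by simp
    show "even (loc i) \<longleftrightarrow> even i"
    proof (cases "i < m")
      case False
      then have "i = loc i + Suc m" using that by (simp add: loc_def)
      then show ?thesis using odd_m by (metis even_Suc even_add)
    qed (simp add: loc_def)
  qed
  show "leave (Suc i) < leave i" if "even i"
    using cases
  proof cases
    case 1
    then show ?thesis using exit[of i] T_m i by auto
  next
    case 2
    then show ?thesis using odd_m that by simp
  next
    case 3
    have "f (P i (leave i)) < f (P (Suc i) (leave i))"
      using polar_branches.value_even[OF branch[OF 3(1)], of "loc i" "leave i"] consecutive[OF 3] that
        exit[of i] i d 3 by (simp add: fP)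
    then show ?thesis using exit_order[of i "Suc i"] 3 i by simp
  qed
  show "leave i < leave (Suc i)" if "odd i"
    using cases
  proof cases
    case 1
    then show ?thesis using odd_m that by (metis even_Suc)
  next
    case 2
    then show ?thesis using exit[of "Suc i"] T_m i by auto
  next
    case 3
    have "f (P (Suc i) (leave (Suc i))) < f (P i (leave (Suc i)))"
      using polar_branches.value_odd[OF branch[OF 3(1)], of "loc i" "leave (Suc i)"] consecutive[OF 3] that
        exit[of "Suc i"] i d 3 by (simp add: fP)
    then show ?thesis using exit_order[of "Suc i" i] 3 i by simp
  qed
qed

definition D :: "(real \<times> real) set" where
  "D = {p. \<bar>fst p\<bar> \<le> d \<and> \<bar>snd p\<bar> \<le> r \<and> f p \<le> \<epsilon>}"

lemma D_iff: "(x, y) \<in> D \<longleftrightarrow> \<bar>x\<bar> \<le> d \<and> \<bar>y\<bar> \<le> r \<and> f (x, y) \<le> \<epsilon>"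
  by (simp add: D_def)

lemma D_interior: "(x, y) \<in> D \<Longrightarrow> \<bar>x\<bar> < d \<and> \<bar>y\<bar> < r"
  using f_rim[of x y] \<epsilon> by (fastforce simp: D_iff)

lemma P_in_D: "i < M \<Longrightarrow> t \<in> {0..leave i} \<Longrightarrow> P i t \<in> D"
proof -
  assume i: "i < M" and t: "t \<in> {0..leave i}"
  have "t \<le> d" using t T_bounds[OF i] by auto
  moreover have "f (P i t) \<le> \<epsilon>"
    using below_iff[OF i, of t] t T_bounds[OF i] T_m d f_0 \<epsilon> by (cases "i = m") (auto simp: P_def ord_def)
  ultimately show ?thesis
    using ord_range[OF i, of t] t d side_cases[of i]
    by (cases "i = m") (auto simp: P_def D_iff side_def)
qed

lemma fst_P: "fst (P i t) = sd i * t"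
  by (simp add: P_def)

lemma cover:
  assumes "p \<in> D"
  shows "\<exists>i<M. \<exists>t\<in>{0..leave i}. PR_class D p = PR_class D (P i t)"
proof -
  obtain x y where p: "p = (x, y)" by fastforce
  define s :: real where "s = (if 0 \<le> x then 1 else - 1)"
  have s: "s = 1 \<or> s = - 1" "s * \<bar>x\<bar> = x" by (auto simp: s_def)
  have xy: "\<bar>x\<bar> \<le> d" "\<bar>y\<bar> \<le> r" "f (x, y) \<le> \<epsilon>" using assms p by (auto simp: D_iff)
  have "\<bar>x\<bar> \<in> {0..<\<delta>}" using xy d by auto
  then obtain k where k: "k < n s" "\<forall>z\<in>closed_segment y (\<gamma> s k \<bar>x\<bar>). f (x, z) \<le> f (x, y)"
    using polar_branches.descent[OF branches[OF s(1)], of "\<bar>x\<bar>" y] xy s by auto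
  obtain i where i: "i < M" "i \<noteq> m" "sd i = s" "loc i = k" using global_index[OF s(1) k(1)] .
  have Pi: "P i \<bar>x\<bar> = (x, \<gamma> s k \<bar>x\<bar>)" using i s by (simp add: P_def ord_eq)
  have "f (x, \<gamma> s k \<bar>x\<bar>) \<le> f (x, y)" using k(2) ends_in_segment(2) by blast
  then have "f (P i \<bar>x\<bar>) \<le> \<epsilon>" using xy(3) Pi by simp
  then have t: "\<bar>x\<bar> \<in> {0..leave i}" using below_iff[OF i(1,2), of "\<bar>x\<bar>"] xy d by auto
  have "\<bar>\<gamma> s k \<bar>x\<bar>\<bar> \<le> r" using ord_range[OF i(1), of "\<bar>x\<bar>"] xy d i by (simp add: ord_eq)
  then have "\<bar>z\<bar> \<le> r" if "z \<in> closed_segment y (\<gamma> s k \<bar>x\<bar>)" for z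
    using that xy(2) by (auto simp: closed_segment_eq_real_ivl split: if_splits)
  then have "\<forall>z\<in>closed_segment y (\<gamma> s k \<bar>x\<bar>). (x, z) \<in> D"
    using k(2) xy unfolding D_iff by (meson order_trans)
  then have "PR_class D p = PR_class D (P i \<bar>x\<bar>)"
    using PR_class_eq_iff[OF assms P_in_D[OF i(1) t]] Pi p by simp
  then show ?thesis using i t by blast
qed

lemma class_P_iff:
  assumes ij: "i < M" "j < M" "sd i = sd j" and t: "t \<in> {0..leave i}" "t \<in> {0..leave j}"
  shows "PR_class D (P i t) = PR_class D (P j t) \<longleftrightarrow>
    (\<forall>z\<in>closed_segment (ord i t) (ord j t). f (sd i * t, z) \<le> \<epsilon>)"
proof -
  have "\<bar>z\<bar> \<le> r \<and> \<bar>sd i * t\<bar> \<le> d" if z: "z \<in> closed_segment (ord i t) (ord j t)" for z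
  proof -
    have "t < d" using t T_bounds[OF ij(1)] by auto
    then have "\<bar>ord i t\<bar> < r" "\<bar>ord j t\<bar> < r" using ord_range ij t d by auto
    then show ?thesis
      using z \<open>t < d\<close> t(1) by (auto simp: closed_segment_eq_real_ivl side_def split: if_splits)
  qed
  then show ?thesis
    using PR_class_eq_iff[OF P_in_D[OF ij(1) t(1)] P_in_D[OF ij(2) t(2)]] ij(3)
    by (auto simp: P_def D_iff)
qed

text \<open>On one side, two half-branches are in the same vertical component at distance \<open>t\<close> exactly if the critical
  values between them are at most \<open>\<epsilon>\<close>, that is, if none of these half-branches has left the disk. Across
  the axis both statements amount to \<open>t = 0\<close>.\<close>

lemma glue:
  assumes ij: "i < M" "j < M" and t: "t \<in> {0..leave i}" "t \<in> {0..leave j}"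
  shows "PR_class D (P i t) = PR_class D (P j t) \<longleftrightarrow> (\<forall>k\<in>{min i j..max i j}. t \<le> leave k)"
proof (cases "t = 0")
  case True
  have "leave k \<ge> 0" if "k \<in> {min i j..max i j}" for k
    using T_bounds[of k] that ij by auto
  then show ?thesis using True P_0 ij by simp
next
  case False
  then have pos: "t > 0" using t by simp
  then have nm: "i \<noteq> m" "j \<noteq> m" using t T_m by auto
  show ?thesis
  proof (cases "sd i = sd j")
    case False
    then have "m \<in> {min i j..max i j}" by (auto simp: side_def split: if_splits)
    then have "\<not> (\<forall>k\<in>{min i j..max i j}. t \<le> leave k)" using T_m pos by force
    moreover have "fst (P i t) \<noteq> fst (P j t)" using False pos by (simp add: fst_P)
    then have "PR_class D (P i t) \<noteq> PR_class D (P j t)"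
      using PR_class_eq_iff[OF P_in_D[OF ij(1) t(1)] P_in_D[OF ij(2) t(2)]] by blast
    ultimately show ?thesis by blast
  next
    case True
    have t': "t \<in> {0<..<\<delta>}" using pos t(1) T_bounds[OF ij(1)] d by auto
    have "PR_class D (P i t) = PR_class D (P j t) \<longleftrightarrow>
        (\<forall>k\<in>{min (loc i) (loc j)..max (loc i) (loc j)}. f (sd i * t, \<gamma> (sd i) k t) \<le> \<epsilon>)"
      unfolding class_P_iff[OF ij True t]
      using polar_branches.segment_below_iff[OF branch[OF nm(1)], of "loc i" "loc j" t \<epsilon>]
        loc_less[of i] loc_less[of j] nm ij True t' by (simp add: ord_eq)
    also have "\<dots> \<longleftrightarrow> (\<forall>k\<in>{min i j..max i j}. f (P k t) \<le> \<epsilon>)"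
    proof -
      have same: "k \<noteq> m \<and> sd k = sd i \<and> k < M" if "k \<in> {min i j..max i j}" for k
        using that True nm ij by (auto simp: side_def split: if_splits)
      have "{min (loc i) (loc j)..max (loc i) (loc j)} = loc ` {min i j..max i j}"
      proof (cases "i < m")
        case True
        then have "j < m" using \<open>sd i = sd j\<close> nm by (auto simp: side_def split: if_splits)
        then have "loc ` {min i j..max i j} = id ` {min i j..max i j}"
          using True by (intro image_cong) (auto simp: loc_def)
        then show ?thesis using True \<open>j < m\<close> by (simp add: loc_def)
      next
        case False
        then have "m < j" "m < i" using \<open>sd i = sd j\<close> nm by (auto simp: side_def split: if_splits)
        have "loc ` {min i j..max i j} = (\<lambda>k. k - Suc m) ` {min i j..max i j}"
          using \<open>m < i\<close> \<open>m < j\<close> by (intro image_cong) (auto simp: loc_def)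
        also have "\<dots> = {min i j - Suc m..max i j - Suc m}"
        proof (intro set_eqI iffI)
          fix k assume k: "k \<in> {min i j - Suc m..max i j - Suc m}"
          show "k \<in> (\<lambda>k. k - Suc m) ` {min i j..max i j}"
            using k \<open>m < i\<close> \<open>m < j\<close> by (intro image_eqI[of _ _ "k + Suc m"]) auto
        qed auto
        finally show ?thesis using \<open>m < i\<close> \<open>m < j\<close> by (auto simp: loc_def min_def max_def)
      qed
      then have "(\<forall>k\<in>{min (loc i) (loc j)..max (loc i) (loc j)}. f (sd i * t, \<gamma> (sd i) k t) \<le> \<epsilon>) \<longleftrightarrow>
          (\<forall>k\<in>{min i j..max i j}. f (sd i * t, \<gamma> (sd i) (loc k) t) \<le> \<epsilon>)"
        by (simp only: ball_simps)
      also have "\<dots> \<longleftrightarrow> (\<forall>k\<in>{min i j..max i j}. f (P k t) \<le> \<epsilon>)"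
      proof (intro ball_cong refl)
        fix k assume "k \<in> {min i j..max i j}"
        then have "k \<noteq> m" "sd k = sd i" using same by blast+
        then show "f (sd i * t, \<gamma> (sd i) (loc k) t) \<le> \<epsilon> \<longleftrightarrow> f (P k t) \<le> \<epsilon>"
          by (simp add: fP)
      qed
      finally show ?thesis .
    qed
    also have "\<dots> \<longleftrightarrow> (\<forall>k\<in>{min i j..max i j}. t \<le> leave k)"
    proof (intro ball_cong refl)
      fix k assume "k \<in> {min i j..max i j}"
      then have "k \<noteq> m" "k < M" using True nm ij by (auto simp: side_def split: if_splits)
      then show "f (P k t) \<le> \<epsilon> \<longleftrightarrow> t \<le> leave k" using below_iff t' by simp
    qed
    finally show ?thesis .
  qed
qed

text \<open>The condition that the whole vertical segment from a point to the half-branch lies in the disk is an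
  intersection of closed conditions.\<close>

lemma branch_closed:
  assumes i: "i < M"
  shows "closedin (top_of_set D) {p \<in> D. \<exists>t\<in>{0..leave i}. PR_class D p = PR_class D (P i t)}"
proof -
  define S where "S = {p. \<bar>snd p\<bar> \<le> r \<and> \<bar>fst p\<bar> \<le> leave i \<and> fst p = sd i * \<bar>fst p\<bar>}"
  define R where "R = (\<Inter>u\<in>{0..1}. {p \<in> S. f (fst p, (1 - u) * snd p + u * ord i \<bar>fst p\<bar>) \<le> \<epsilon>})"
  have Td: "leave i < d" "0 \<le> leave i" using T_bounds[OF i] by auto
  have "closed S"
    unfolding S_def Collect_conj_eq
    by (intro closed_Int closed_Collect_le closed_Collect_eq continuous_intros)
  moreover have "continuous_on S (\<lambda>p. f (fst p, (1 - u) * snd p + u * ord i \<bar>fst p\<bar>))" for u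
  proof -
    have "continuous_on S (\<lambda>p. ord i \<bar>fst p\<bar>)"
      by (rule continuous_on_compose2[OF ord_cont[OF i]])
        (use Td d in \<open>auto simp: S_def intro!: continuous_intros\<close>)
    then show ?thesis
      by (intro continuous_on_compose2[OF cont_f[of UNIV]] continuous_intros) auto
  qed
  ultimately have "closed {p \<in> S. f (fst p, (1 - u) * snd p + u * ord i \<bar>fst p\<bar>) \<le> \<epsilon>}" for u
    by (intro continuous_on_closed_Collect_le) auto
  then have "closed R" unfolding R_def by blast
  moreover have "{p \<in> D. \<exists>t\<in>{0..leave i}. PR_class D p = PR_class D (P i t)} = D \<inter> R"
  proof (intro set_eqI iffI)
    fix p assume "p \<in> {p \<in> D. \<exists>t\<in>{0..leave i}. PR_class D p = PR_class D (P i t)}"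
    then obtain t where p: "p \<in> D" and t: "t \<in> {0..leave i}" "PR_class D p = PR_class D (P i t)" by blast
    have "fst p = sd i * t" and seg: "\<forall>z\<in>closed_segment (snd p) (ord i t). (fst p, z) \<in> D"
      using t PR_class_eq_iff[OF p P_in_D[OF i t(1)]] by (auto simp: P_def)
    then have abs: "\<bar>fst p\<bar> = t" using t(1) T_m by (auto simp: side_def)
    then have "p \<in> S" using p t(1) \<open>fst p = sd i * t\<close> by (auto simp: S_def D_def)
    moreover have "f (fst p, (1 - u) * snd p + u * ord i \<bar>fst p\<bar>) \<le> \<epsilon>" if "u \<in> {0..1}" for u
    proof -
      have "(1 - u) * snd p + u * ord i t \<in> closed_segment (snd p) (ord i t)"
        using that by (auto simp: closed_segment_def)
      then show ?thesis using seg abs by (auto simp: D_iff)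
    qed
    ultimately show "p \<in> D \<inter> R" using p by (auto simp: R_def)
  next
    fix p assume p: "p \<in> D \<inter> R"
    then have "\<forall>u\<in>{0..1::real}. p \<in> S" by (simp add: R_def)
    then have S: "p \<in> S" by (metis atLeastAtMost_iff order_refl zero_le_one)
    define t where "t = \<bar>fst p\<bar>"
    have t: "t \<in> {0..leave i}" "fst p = sd i * t" using S by (auto simp: S_def t_def)
    have "(fst p, z) \<in> D" if z: "z \<in> closed_segment (snd p) (ord i t)" for z
    proof -
      obtain u where u: "u \<in> {0..1}" "z = (1 - u) * snd p + u * ord i t"
        using z by (auto simp: closed_segment_def)
      then have "f (fst p, z) \<le> \<epsilon>" using p by (auto simp: R_def t_def)
      moreover have "\<bar>ord i t\<bar> \<le> r" using ord_range[OF i, of t] t(1) Td d by auto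
      then have "\<bar>z\<bar> \<le> r"
        using z S by (auto simp: S_def closed_segment_eq_real_ivl split: if_splits)
      ultimately show ?thesis using S Td by (simp add: D_iff S_def)
    qed
    then have "PR_class D p = PR_class D (P i t)"
      using PR_class_eq_iff[of p D "P i t"] p P_in_D[OF i t(1)] t(2) by (simp add: P_def)
    then show "p \<in> {p \<in> D. \<exists>t\<in>{0..leave i}. PR_class D p = PR_class D (P i t)}" using p t by blast
  qed
  ultimately show ?thesis by (simp add: closedin_closed_Int)
qed

text \<open>Two disjoint intervals on a line are ordered like any two of their points.\<close>

lemma stacked:
  assumes ij: "i < j" "j < M" "sd i = sd j" and t: "t \<in> {0..leave i}" "t \<in> {0..leave j}"
    and distinct: "PR_class D (P i t) \<noteq> PR_class D (P j t)"
  shows "PR_lies_below (PR_class D (P i t)) (PR_class D (P j t))"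
proof -
  have i: "i < M" using ij by simp
  have "t \<noteq> 0" using distinct P_0 i ij by auto
  then have pos: "t > 0" using t by simp
  then have nm: "i \<noteq> m" "j \<noteq> m" using t T_m by auto
  have t': "t \<in> {0<..<\<delta>}" using pos t(1) T_bounds[OF i] d by auto
  have less: "ord i t < ord j t"
    using polar_branches.\<gamma>_less[OF branch[OF nm(1)], of "loc i" "loc j" t] same_side_less[of i j]
      loc_less[of j] nm ij t' by (simp add: ord_eq)
  have seg: "fst p = sd k * t \<and> (\<forall>z\<in>closed_segment (ord k t) (snd p). (sd k * t, z) \<in> D)"
    if k: "k < M" "t \<in> {0..leave k}" and p: "p \<in> PR_class D (P k t)" for k p
  proof -
    have rel: "(P k t, p) \<in> PR_rel D" using p by (simp add: PR_class_def)
    then have "p \<in> D" using equivE[OF equiv_PR_rel] by blast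
    moreover have "PR_class D (P k t) = PR_class D p"
      unfolding PR_class_def using equiv_class_eq[OF equiv_PR_rel rel] .
    ultimately show ?thesis using PR_class_eq_iff[OF P_in_D[OF k], of p] by (auto simp: P_def)
  qed
  show ?thesis
    unfolding PR_lies_below_def
  proof (intro ballI conjI)
    fix p q assume p: "p \<in> PR_class D (P i t)" and q: "q \<in> PR_class D (P j t)"
    note sp = seg[OF i t(1) p] and sq = seg[OF ij(2) t(2) q]
    show "fst p = fst q" using sp sq ij(3) by simp
    show "snd p < snd q"
    proof (rule ccontr)
      assume "\<not> snd p < snd q"
      then have le: "snd q \<le> snd p" by simp
      have "(sd i * t, z) \<in> D" if "z \<in> closed_segment (ord i t) (ord j t)" for z
      proof (cases "z \<le> snd p")
        case True
        then have "z \<in> closed_segment (ord i t) (snd p)"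
          using that less by (auto simp: closed_segment_eq_real_ivl split: if_splits)
        then show ?thesis using sp by blast
      next
        case False
        then have "z \<in> closed_segment (ord j t) (snd q)"
          using that less le by (auto simp: closed_segment_eq_real_ivl split: if_splits)
        then show ?thesis using sq ij(3) by simp
      qed
      then have "PR_class D (P i t) = PR_class D (P j t)"
        using PR_class_eq_iff[OF P_in_D[OF i t(1)] P_in_D[OF ij(2) t(2)]] ij(3) by (simp add: P_def)
      then show False using distinct by blast
    qed
  qed
qed

text \<open>From any point of \<open>D\<close> one descends vertically to a half-branch and follows it to the origin, as \<open>f\<close>
  increases along it; so \<open>D\<close> is connected. Conversely, the component of the origin cannot cross the rim.\<close>

lemma level_disk_eq: "level_disk f \<epsilon> = D"
proof
  let ?L = "f -` {0..\<epsilon>}" and ?B = "{p::real \<times> real. \<bar>fst p\<bar> \<le> d \<and> \<bar>snd p\<bar> \<le> r}"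
  have O: "(0, 0) \<in> D" using f_0 \<epsilon> d r by (simp add: D_iff)
  have DL: "D \<subseteq> ?L" using f_nonneg by (auto simp: D_def)
  show "D \<subseteq> level_disk f \<epsilon>"
  proof
    fix p assume p: "p \<in> D"
    obtain i t where i: "i < M" "t \<in> {0..leave i}" and cl: "PR_class D p = PR_class D (P i t)"
      using cover[OF p] by blast
    have "(p, P i t) \<in> PR_rel D"
      using cl eq_equiv_class_iff[OF equiv_PR_rel p P_in_D[OF i]] by (simp add: PR_class_def)
    then have "connected_component D p (P i t)"
      unfolding PR_rel_iff by (rule connected_component_of_subset) auto
    moreover have "connected_component D (P i 0) (P i t)"
      unfolding connected_component_def
    proof (intro exI conjI)
      show "connected (P i ` {0..t})"
        using i T_bounds[OF i(1)] d
        by (intro connected_continuous_image continuous_on_subset[OF P_cont[OF i(1)]]) auto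
      show "P i ` {0..t} \<subseteq> D" using P_in_D[OF i(1)] i(2) by auto
    qed (use i in auto)
    ultimately have "connected_component D (0, 0) p"
      using P_0[OF i(1)] connected_component_sym connected_component_trans by metis
    then show "p \<in> level_disk f \<epsilon>"
      unfolding level_disk_def using connected_component_of_subset[OF _ DL] by blast
  qed
  show "level_disk f \<epsilon> \<subseteq> D"
  proof -
    let ?K = "level_disk f \<epsilon>"
    have K: "connected ?K" "?K \<subseteq> ?L" "(0, 0) \<in> ?K"
      unfolding level_disk_def using f_0 \<epsilon> connected_component_subset[of ?L "(0, 0)"]
      by (auto simp: connected_component_refl_eq)
    have "?K \<subseteq> ?B"
    proof (rule ccontr)
      assume "\<not> ?K \<subseteq> ?B"
      then have "?K - ?B \<noteq> {}" by blast
      moreover have "(0, 0) \<in> ?B" using d r by simp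
      then have "?K \<inter> ?B \<noteq> {}" using K(3) by blast
      ultimately have "?K \<inter> frontier ?B \<noteq> {}" by (intro connected_Int_frontier[OF K(1)])
      then obtain p where p: "p \<in> ?K" "p \<in> frontier ?B" by blast
      have "closed ?B" unfolding Collect_conj_eq
        by (intro closed_Int closed_Collect_le continuous_intros)
      then have pB: "p \<in> ?B" using p(2) by (simp add: frontier_closed closure_closed frontier_def)
      have "open {p::real \<times> real. \<bar>fst p\<bar> < d \<and> \<bar>snd p\<bar> < r}" unfolding Collect_conj_eq
        by (intro open_Int open_Collect_less continuous_intros)
      then have "{p::real \<times> real. \<bar>fst p\<bar> < d \<and> \<bar>snd p\<bar> < r} \<subseteq> interior ?B"
        by (intro interior_maximal) auto
      moreover have "p \<notin> interior ?B" using p(2) by (simp add: frontier_def)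
      ultimately have "\<not> (\<bar>fst p\<bar> < d \<and> \<bar>snd p\<bar> < r)" by blast
      then have "\<epsilon>\<^sub>0 \<le> f (fst p, snd p)" using pB by (intro f_rim) auto
      moreover have "f p \<le> \<epsilon>" using p(1) K(2) by auto
      ultimately show False using \<epsilon> by simp
    qed
    then show ?thesis using K(2) by (auto simp: D_def)
  qed
qed

lemma open_box: "open {p::real \<times> real. \<bar>fst p\<bar> < d \<and> \<bar>snd p\<bar> < r}"
  unfolding Collect_conj_eq by (intro open_Int open_Collect_less continuous_intros)

text \<open>A point of level \<open>\<epsilon>\<close> in the interior would be a local maximum, hence a critical point of \<open>f\<close>, and
  there are none but the origin.\<close>

lemma boundary_eq: "boundary_curve D = {p \<in> D. f p = \<epsilon>}"
proof -
  have "p \<in> interior D" if p: "p \<in> D" "f p < \<epsilon>" for p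
  proof -
    have "open ({p::real \<times> real. \<bar>fst p\<bar> < d \<and> \<bar>snd p\<bar> < r} \<inter> {p. f p < \<epsilon>})"
      by (intro open_Int open_box open_Collect_less continuous_intros cont_f)
    moreover have "p \<in> {p::real \<times> real. \<bar>fst p\<bar> < d \<and> \<bar>snd p\<bar> < r} \<inter> {p. f p < \<epsilon>}"
      using p D_interior[of "fst p" "snd p"] by simp
    ultimately show ?thesis by (rule interiorI) (auto simp: D_def)
  qed
  moreover have "p \<notin> interior D" if p: "p \<in> D" "f p = \<epsilon>" for p
  proof
    assume "p \<in> interior D"
    then have "(\<lambda>v. fst v * fx p + snd v * fy p) = (\<lambda>v. 0)"
      using p by (intro differential_zero_maxmin[OF _ open_interior f_deriv])
        (use interior_subset[of D] in \<open>auto simp: D_def\<close>)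
    from fun_cong[OF this, of "(1, 0)"] fun_cong[OF this, of "(0, 1)"]
    have crit: "fx p = 0" "fy p = 0" by simp_all
    obtain x y where xy: "p = (x, y)" by fastforce
    then have "(x, y) \<noteq> (0, 0)" using p f_0 \<epsilon> by auto
    then obtain i t where "i < M" "i \<noteq> m" "0 < t" "t \<le> d" "p = P i t"
      using critical_points[of x y] p crit xy by (auto simp: D_iff)
    then show False using fx_branch[of i t] crit d by auto
  qed
  ultimately show ?thesis unfolding boundary_curve_def D_def by force
qed

lemma tangency:
  assumes i: "i < M" "i \<noteq> m"
  shows "vertical_tangency f fx fy fyx fyy (fst (P i (leave i))) (snd (P i (leave i))) \<epsilon> (boundary_curve D)"
proof
  have t: "leave i \<in> {0<..<\<delta>}" using exit[OF i] d by simp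
  show "f (fst (P i (leave i)), snd (P i (leave i))) = \<epsilon>" using exit(3)[OF i] by simp
  show fy0: "fy (fst (P i (leave i)), snd (P i (leave i))) = 0" using fy_branch[OF i t] by simp
  show "fx (fst (P i (leave i)), snd (P i (leave i))) \<noteq> 0" using fx_branch[OF i t] by simp
  have "fst (P i (leave i)) \<noteq> 0" "\<bar>fst (P i (leave i))\<bar> \<le> d"
    using side_cases[OF i(2)] exit[OF i] by (auto simp: fst_P)
  then show "fyy (fst (P i (leave i)), snd (P i (leave i))) \<noteq> 0" using simple fy0 by blast
  have P: "P i (leave i) \<in> D" using P_in_D[OF i(1)] exit[OF i] by simp
  then have "\<forall>\<^sub>F p in nhds (P i (leave i)). \<bar>fst p\<bar> < d \<and> \<bar>snd p\<bar> < r"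
    using eventually_nhds_in_open[OF open_box, of "P i (leave i)"]
      D_interior[of "fst (P i (leave i))" "snd (P i (leave i))"] by simp
  then show "\<forall>\<^sub>F p in nhds (fst (P i (leave i)), snd (P i (leave i))). p \<in> boundary_curve D \<longleftrightarrow> f p = \<epsilon>"
    unfolding boundary_eq prod.collapse by eventually_elim (auto simp: D_def)
  show "boundary_curve D \<subseteq> f -` {\<epsilon>}" by (auto simp: boundary_eq)
qed (fact f_deriv fy_deriv cont_fx cont_fyy)+

text \<open>At a vertical tangent \<open>fy\<close> vanishes, so the point is on the polar curve.\<close>

lemma vertical_tangents: "vertical_tangent_points (boundary_curve D) = (\<lambda>i. P i (leave i)) ` ({..<M} - {m})"
proof (intro set_eqI iffI)
  fix p assume "p \<in> vertical_tangent_points (boundary_curve D)"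
  then have p: "p \<in> D" "f p = \<epsilon>" and tan: "tangent_vector (boundary_curve D) p (0, 1)"
    by (auto simp: vertical_tangent_points_def boundary_eq)
  have "fy p = 0"
    using tangent_vector_kernel[OF f_deriv _ tan, of \<epsilon>] by (auto simp: boundary_eq)
  obtain x y where xy: "p = (x, y)" by fastforce
  then have "(x, y) \<noteq> (0, 0)" using p f_0 \<epsilon> by auto
  then obtain i t where i: "i < M" "i \<noteq> m" "0 < t" "t \<le> d" "p = P i t"
    using critical_points[of x y] p \<open>fy p = 0\<close> xy by (auto simp: D_iff)
  have "t = leave i"
    using fP_less[OF i(1,2), of t "leave i"] fP_less[OF i(1,2), of "leave i" t] exit[OF i(1,2)] p(2) i d
    by (cases t "leave i" rule: linorder_cases) auto
  then show "p \<in> (\<lambda>i. P i (leave i)) ` ({..<M} - {m})" using i by auto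
next
  fix p assume "p \<in> (\<lambda>i. P i (leave i)) ` ({..<M} - {m})"
  then obtain i where i: "i < M" "i \<noteq> m" "p = P i (leave i)" by auto
  interpret vertical_tangency f fx fy fyx fyy "fst (P i (leave i))" "snd (P i (leave i))" \<epsilon> "boundary_curve D"
    using tangency i by blast
  have "p \<in> boundary_curve D" using P_in_D[OF i(1)] exit[OF i(1,2)] i(3) by (auto simp: boundary_eq)
  then show "p \<in> vertical_tangent_points (boundary_curve D)"
    using tangent i(3) by (simp add: vertical_tangent_points_def)
qed

text \<open>Two points with vertical tangent and equal abscissa would be on the same side with equal exit times.\<close>

lemma generic: "vertical_generic (boundary_curve (level_disk f \<epsilon>))"
  unfolding vertical_generic_def level_disk_eq
proof (intro conjI ballI)
  interpret A: alternating_sequence M m leave by (rule alternating)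
  show "\<not> has_vertical_bitangent (boundary_curve D)"
    unfolding has_vertical_bitangent_def vertical_tangents
    using A.abscissa_inj by (auto simp: fst_P)
  fix p assume "p \<in> vertical_tangent_points (boundary_curve D)"
  then obtain i where i: "i < M" "i \<noteq> m" "p = P i (leave i)" by (auto simp: vertical_tangents)
  then show "\<not> inflection_point (boundary_curve D) p"
    using vertical_tangency.not_inflection[OF tangency[OF i(1,2)]] by simp
qed

lemma tree: "pt_isomorphic (PR_tree (level_disk f \<epsilon>)) (cartesian_tree M m leave)"
proof -
  interpret PR_model M m leave D P
  proof (intro PR_model.intro alternating PR_model_axioms.intro)
    show "continuous_on {0..leave i} (P i)" if "i < M" for i
      using T_bounds[OF that] d by (intro continuous_on_subset[OF P_cont[OF that]]) auto
    show "P m 0 = (0, 0)" by (rule P_0[OF m_less])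
    show "PR_verts D = (\<lambda>i. PR_class D (P i (leave i))) ` {..<M}"
    proof -
      have "(\<lambda>i. PR_class D (P i (leave i))) ` insert m ({..<M} - {m}) =
          insert (PR_class D (P m (leave m))) (PR_class D ` (\<lambda>i. P i (leave i)) ` ({..<M} - {m}))"
        by (simp only: image_insert image_image)
      moreover have "insert m ({..<M} - {m}) = {..<M}" using m_less by (simp add: insert_absorb)
      ultimately have "(\<lambda>i. PR_class D (P i (leave i))) ` {..<M} =
          insert (PR_class D (P m (leave m))) (PR_class D ` (\<lambda>i. P i (leave i)) ` ({..<M} - {m}))"
        by (simp only:)
      then show ?thesis unfolding PR_verts_def vertical_tangents T_m P_0[OF m_less] by simp
    qed
    show "fst (P i t) = sd i * t" for i t by (rule fst_P)
  qed (fact P_in_D cover glue branch_closed stacked)+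
  show ?thesis unfolding level_disk_eq by (rule PR_tree_isomorphic)
qed

end

text \<open>The half-branch with the larger critical values leaves the disk first, whatever the level.\<close>

lemma exit_order_constant:
  assumes \<epsilon>: "0 < \<epsilon>" "\<epsilon> < \<epsilon>\<^sub>0" and \<epsilon>': "0 < \<epsilon>'" "\<epsilon>' < \<epsilon>\<^sub>0"
    and ij: "i < M" "j < M" "sd i = sd j"
  shows "\<tau> \<epsilon> i \<le> \<tau> \<epsilon> j \<longleftrightarrow> \<tau> \<epsilon>' i \<le> \<tau> \<epsilon>' j"
proof (cases "i = j")
  case False
  then have nm: "i \<noteq> m" "j \<noteq> m" using ij by (auto simp: side_def split: if_splits)
  have const: "f (P i a) < f (P j a) \<longleftrightarrow> f (P i b) < f (P j b)"
    if "a \<in> {0<..<\<delta>}" "b \<in> {0<..<\<delta>}" for a b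
  proof -
    have "continuous_on UNIV (\<lambda>p. f (sd i * fst p, snd p))"
      by (intro continuous_on_compose2[OF cont_f[of UNIV]] continuous_intros) auto
    then show ?thesis
      using polar_branches.value_order_constant[OF branch[OF nm(1)], of "loc i" "loc j" a b]
        loc_less[of i] loc_less[of j] same_side_eq[of i j] nm ij False that by (simp add: fP)
  qed
  have *: "\<tau> e i \<le> \<tau> e j \<longleftrightarrow> \<not> f (P i (\<delta> / 2)) < f (P j (\<delta> / 2))" if e: "0 < e" "e < \<epsilon>\<^sub>0" for e
  proof -
    have ti: "\<tau> e i \<in> {0<..<\<delta>}" and tj: "\<tau> e j \<in> {0<..<\<delta>}" and half: "\<delta> / 2 \<in> {0<..<\<delta>}"
      using exit(1,2)[OF e ij(1) nm(1)] exit(1,2)[OF e ij(2) nm(2)] d by auto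
    show ?thesis
    proof (cases "f (P i (\<delta> / 2)) < f (P j (\<delta> / 2))")
      case True
      then have "f (P i (\<tau> e i)) < f (P j (\<tau> e i))" using const ti half by blast
      then show ?thesis using exit_order[OF e ij(1,2) nm] True by simp
    next
      case False
      then have "\<not> f (P i (\<tau> e j)) < f (P j (\<tau> e j))" using const tj half by blast
      moreover have "f (P i (\<tau> e j)) \<noteq> f (P j (\<tau> e j))"
        using fP_distinct ij nm tj \<open>i \<noteq> j\<close> by blast
      ultimately have "f (P j (\<tau> e j)) < f (P i (\<tau> e j))" by simp
      then show ?thesis using exit_order[OF e ij(2,1) nm(2,1)] False by simp
    qed
  qed
  show ?thesis using *[OF \<epsilon>] *[OF \<epsilon>'] by simp
qed simp

lemma asymptotic_tree:
  "asymptotically_generic f \<and>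
    (\<exists>T :: nat plane_tree. asymptotic_PR_tree f T \<and> complete_binary_tree T \<and>
       linear_order_on (pt_verts T) (pt_preorder T) \<and> strictly_monotone_on_root_geodesics T)"
proof (intro conjI exI)
  let ?\<epsilon> = "\<epsilon>\<^sub>0 / 2"
  let ?T = "cartesian_tree M m (\<tau> ?\<epsilon>)"
  have half: "0 < ?\<epsilon>" "?\<epsilon> < \<epsilon>\<^sub>0" using \<epsilon>\<^sub>0 by auto
  have small: "\<forall>\<^sub>F \<epsilon> in at_right 0. \<epsilon> \<in> {0<..<\<epsilon>\<^sub>0}" using \<epsilon>\<^sub>0 by (rule eventually_at_right_real)
  show "asymptotically_generic f"
    unfolding asymptotically_generic_def using small by eventually_elim (simp add: generic)
  show "asymptotic_PR_tree f ?T"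
    unfolding asymptotic_PR_tree_def using small
  proof eventually_elim
    case (elim \<epsilon>)
    then have \<epsilon>: "0 < \<epsilon>" "\<epsilon> < \<epsilon>\<^sub>0" by auto
    have "cartesian_tree M m (\<tau> \<epsilon>) = ?T"
      using alternating[OF \<epsilon>] alternating[OF half] exit_order_constant[OF \<epsilon> half]
      by (rule cartesian_tree_cong)
    then show ?case using tree[OF \<epsilon>] by simp
  qed
  interpret alternating_sequence M m "\<tau> ?\<epsilon>" using half by (rule alternating)
  show "complete_binary_tree ?T" by (rule complete_binary)
  show "linear_order_on (pt_verts ?T) (pt_preorder ?T)" by (rule linear_preorder)
  show "strictly_monotone_on_root_geodesics ?T" by (rule monotone_geodesics)
qed

end


section \<open>From the polynomial to the box\<close>

text \<open>For \<open>s = 1\<close> and \<open>s = - 1\<close> this treats both half planes at once.\<close>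

lemma has_derivative_reflect:
  fixes k :: "real \<times> real \<Rightarrow> real"
  assumes "\<And>p. (k has_derivative (\<lambda>v. fst v * kx p + snd v * ky p)) (at p)"
  shows "((\<lambda>p. k (s * fst p, snd p)) has_derivative
    (\<lambda>v. fst v * (s * kx (s * fst p, snd p)) + snd v * ky (s * fst p, snd p))) (at p)"
proof -
  have "((\<lambda>p. (s * fst p, snd p)) has_derivative (\<lambda>v. (s * fst v, snd v))) (at p)"
    by (intro derivative_intros)
  from has_derivative_compose[OF this assms] show ?thesis by (simp add: ac_simps)
qed

lemma continuous_on_reflect:
  fixes k :: "real \<times> real \<Rightarrow> real"
  assumes "continuous_on UNIV k"
  shows "continuous_on UNIV (\<lambda>p. c * k (s * fst p, snd p))"
  by (intro continuous_on_mult_left continuous_on_compose2[OF assms] continuous_intros) auto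

text \<open>On the axis \<open>x = 0\<close> the minimum is isolated: \<open>f (0, y)\<close> is a nonconstant polynomial, whose
  derivative has the sign of \<open>y\<close> near zero.\<close>

lemma minimum_on_axis:
  fixes F :: "real poly poly"
  defines "f \<equiv> plane_poly_fun F" and "fy \<equiv> plane_poly_fun (pderiv F)"
  assumes f_0: "f (0, 0) = 0" and \<rho>: "\<rho> > 0" and pos: "\<And>p. p \<noteq> (0, 0) \<Longrightarrow> dist p (0, 0) < \<rho> \<Longrightarrow> 0 < f p"
  obtains r where "0 < r" "r < \<rho>" "\<And>y. y \<noteq> 0 \<Longrightarrow> \<bar>y\<bar> \<le> r \<Longrightarrow> fy (0, y) \<noteq> 0"
    "fy (0, - r) < 0" "0 < fy (0, r)"
proof -
  have deriv: "((\<lambda>y. f (x, y)) has_real_derivative fy (x, y)) (at y)" for x y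
    unfolding f_def fy_def by (rule has_derivative_plane_poly_fun)
  have pos_y: "0 < f (0, y)" if "y \<noteq> 0" "\<bar>y\<bar> < \<rho>" for y
    using pos[of "(0, y)"] that by (simp add: dist_prod_def dist_real_def)
  have mvt: "\<exists>z. a < z \<and> z < b \<and> f (0, b) - f (0, a) = (b - a) * fy (0, z)" if "a < b" for a b
    using MVT2[OF that, of "\<lambda>y. f (0, y)" "\<lambda>y. fy (0, y)"] deriv by blast
  obtain z where "fy (0, z) \<noteq> 0"
    using mvt[of 0 "\<rho> / 2"] pos_y[of "\<rho> / 2"] f_0 \<rho> by force
  then have "finite {y. fy (0, y) = 0}" unfolding fy_def by (rule finite_zeros_on_vertical)
  then obtain \<eta> where \<eta>: "\<eta> > 0" "\<forall>y\<in>{y. fy (0, y) = 0}. y \<noteq> 0 \<longrightarrow> \<eta> \<le> dist 0 y"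
    using finite_set_avoid[of "{y. fy (0, y) = 0}" 0] by auto
  define r where "r = min \<rho> \<eta> / 2"
  have r: "0 < r" "r < \<rho>" "r < \<eta>" using \<rho> \<eta>(1) by (auto simp: r_def)
  have axis: "fy (0, y) \<noteq> 0" if "y \<noteq> 0" "\<bar>y\<bar> \<le> r" for y
    using \<eta>(2) that r by (auto simp: dist_real_def)
  have cont: "continuous_on S (\<lambda>y. fy (0, y))" for S
    unfolding fy_def by (intro continuous_on_compose2[OF continuous_on_plane_poly_fun[of UNIV]] continuous_intros) auto
  have sign: "0 < fy (0, a) \<longleftrightarrow> 0 < fy (0, b)"
    if "0 < a \<and> 0 < b \<or> a < 0 \<and> b < 0" "\<bar>a\<bar> \<le> r" "\<bar>b\<bar> \<le> r" for a b
  proof (rule no_zero_imp_same_sign[of a b "\<lambda>y. fy (0, y)", OF cont])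
    fix y assume "y \<in> {min a b..max a b}"
    then have "y \<noteq> 0 \<and> \<bar>y\<bar> \<le> r" using that by (auto simp: min_def max_def split: if_splits)
    then show "fy (0, y) \<noteq> 0" using axis by blast
  qed
  obtain z where z: "0 < z" "z < r" "f (0, r) = r * fy (0, z)" using mvt[of 0 r] f_0 r by auto
  have "0 < fy (0, z)" using z(3) pos_y[of r] r by (simp add: zero_less_mult_iff)
  then have right: "0 < fy (0, r)" using sign[of z r] z r by simp
  obtain w where w: "- r < w" "w < 0" "- f (0, - r) = r * fy (0, w)" using mvt[of "- r" 0] f_0 r by auto
  have "r * fy (0, w) < 0" using w(3) pos_y[of "- r"] r by simp
  then have "\<not> 0 < fy (0, w)" using r by (simp add: mult_less_0_iff)
  then have "\<not> 0 < fy (0, - r)" using sign[of w "- r"] w r by simp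
  then have left: "fy (0, - r) < 0" using axis[of "- r"] r by simp
  show thesis using that[OF r(1,2) axis left right] by blast
qed

lemma minimum_off_compact:
  fixes f :: "'a::topological_space \<Rightarrow> real"
  assumes "compact K" "continuous_on K f" "\<And>p. p \<in> K \<Longrightarrow> 0 < f p"
  obtains c where "0 < c" "\<And>p. p \<in> K \<Longrightarrow> c \<le> f p"
proof (cases "K = {}")
  case True
  then show thesis using that[of 1] by simp
next
  case False
  then obtain p where "p \<in> K" "\<forall>q\<in>K. f p \<le> f q" using continuous_attains_inf[OF assms(1) False assms(2)] by blast
  then show thesis using that[of "f p"] assms(3) by blast
qed

theorem theorem1p3:
  fixes F :: "real poly poly"
    and f :: "real \<times> real \<Rightarrow> real"
    and \<Gamma> :: "(real \<times> real) set"
    and \<phi> :: "real \<times> real \<Rightarrow> real \<times> real"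
  assumes f_polynomial: "f = plane_poly_fun F"
    and f_zero: "f (0, 0) = 0"
    and f_min: "strict_local_minimum f (0, 0)"
    and \<Gamma>_eq: "\<Gamma> = polar_curve f"
    and \<phi>_eq: "\<phi> = (\<lambda>(x, y). (x, f (x, y)))"
    and reduced: "squarefree (pderiv F)"
    and homeo: "\<exists>\<psi>. homeomorphism \<Gamma> (\<phi> ` \<Gamma>) \<phi> \<psi>"
  shows "asymptotically_generic f \<and>
    (\<exists>T :: nat plane_tree. asymptotic_PR_tree f T \<and>
       complete_binary_tree T \<and>
       linear_order_on (pt_verts T) (pt_preorder T) \<and>
       strictly_monotone_on_root_geodesics T)"
proof -
  define fx where "fx = plane_poly_fun (x_pderiv F)"
  define fy where "fy = plane_poly_fun (pderiv F)"
  define fyx where "fyx = plane_poly_fun (x_pderiv (pderiv F))"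
  define fyy where "fyy = plane_poly_fun (pderiv (pderiv F))"
  note defs = f_polynomial fx_def fy_def fyx_def fyy_def
  have f_deriv: "(f has_derivative (\<lambda>v. fst v * fx p + snd v * fy p)) (at p)"
    and fy_deriv: "(fy has_derivative (\<lambda>v. fst v * fyx p + snd v * fyy p)) (at p)" for p
    unfolding defs by (rule plane_poly_fun_has_derivative)+
  have cont: "continuous_on UNIV f" "continuous_on UNIV fx" "continuous_on UNIV fy" "continuous_on UNIV fyy"
    unfolding defs by (rule continuous_on_plane_poly_fun)+
  have \<Gamma>_iff: "p \<in> \<Gamma> \<longleftrightarrow> fy p = 0" for p
    by (simp add: \<Gamma>_eq f_polynomial polar_curve_plane_poly_fun fy_def)
  \<comment> \<open>Critical points on the same vertical line have distinct critical values.\<close>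
  obtain \<psi> where "homeomorphism \<Gamma> (\<phi> ` \<Gamma>) \<phi> \<psi>" using homeo by blast
  then have "inj_on \<phi> \<Gamma>" by (intro inj_on_inverseI[of \<Gamma> \<psi>]) (simp add: homeomorphism_def)
  then have distinct: "f (x, y) \<noteq> f (x, y')" if "y \<noteq> y'" "fy (x, y) = 0" "fy (x, y') = 0" for x y y'
    using inj_onD[of \<phi> \<Gamma> "(x, y)" "(x, y')"] that by (auto simp: \<phi>_eq \<Gamma>_iff)
  obtain \<rho> where \<rho>: "\<rho> > 0" and pos: "\<And>p. p \<noteq> (0, 0) \<Longrightarrow> dist p (0, 0) < \<rho> \<Longrightarrow> 0 < f p"
    using f_min f_zero unfolding strict_local_minimum_def eventually_at by auto
  have \<rho>2: "\<rho> / 2 > 0" "\<And>p. p \<noteq> (0, 0) \<Longrightarrow> dist p (0, 0) < \<rho> / 2 \<Longrightarrow> 0 < f p"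
    using \<rho> pos by auto
  obtain r where r: "0 < r" "r < \<rho> / 2" and axis: "\<And>y. y \<noteq> 0 \<Longrightarrow> \<bar>y\<bar> \<le> r \<Longrightarrow> fy (0, y) \<noteq> 0"
    and ends: "fy (0, - r) < 0" "0 < fy (0, r)"
    using minimum_on_axis[of F "\<rho> / 2", folded fy_def f_polynomial, OF f_zero \<rho>2] by blast
  obtain \<delta>1 g h where \<delta>1: "\<delta>1 > 0" and gh: "pderiv F = g * h"
    and simple: "\<And>x y. 0 < \<bar>x\<bar> \<Longrightarrow> \<bar>x\<bar> < \<delta>1 \<Longrightarrow> fy (x, y) = 0 \<Longrightarrow> fyy (x, y) \<noteq> 0"
    and g0: "\<And>x y. plane_poly_fun g (x, y) = 0 \<Longrightarrow> fx (x, y) = 0"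
    and h0: "\<And>x y. 0 < \<bar>x\<bar> \<Longrightarrow> \<bar>x\<bar> < \<delta>1 \<Longrightarrow> plane_poly_fun h (x, y) = 0 \<Longrightarrow> fx (x, y) \<noteq> 0"
    using polar_curve_separation[OF reduced] unfolding fx_def fy_def fyy_def by blast
  have "\<forall>\<^sub>F x in nhds 0. fy (x, - r) < 0" "\<forall>\<^sub>F x in nhds 0. 0 < fy (x, r)"
  proof -
    have "isCont (\<lambda>x. fy (x, y)) 0" for y
      using continuous_on_compose2[OF cont(3), of UNIV "\<lambda>x. (x, y)"]
      by (simp add: continuous_on_eq_continuous_at continuous_on_Pair)
    note lim = isCont_tendsto_nhds[OF this]
    show "\<forall>\<^sub>F x in nhds 0. fy (x, - r) < 0" "\<forall>\<^sub>F x in nhds 0. 0 < fy (x, r)"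
      using order_tendstoD(2)[OF lim ends(1)] order_tendstoD(1)[OF lim ends(2)] by auto
  qed
  then have "\<forall>\<^sub>F x in nhds 0. fy (x, - r) < 0 \<and> 0 < fy (x, r)" by (rule eventually_conj)
  then obtain \<delta>2 where \<delta>2: "\<delta>2 > 0" "\<And>x. \<bar>x\<bar> < \<delta>2 \<Longrightarrow> fy (x, - r) < 0 \<and> 0 < fy (x, r)"
    unfolding eventually_nhds_metric by (auto simp: dist_real_def)
  \<comment> \<open>Then \<open>\<bar>x\<bar> < \<delta>\<close> and \<open>\<bar>y\<bar> \<le> r < \<rho> / 2\<close> imply that \<open>(x, y)\<close> is in the ball of radius \<open>\<rho>\<close>.\<close>
  define \<delta> where "\<delta> = min (min \<delta>1 \<delta>2) (\<rho> / 2)"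
  have \<delta>: "0 < \<delta>" "\<delta> \<le> \<delta>1" "\<delta> \<le> \<delta>2" "\<delta> \<le> \<rho> / 2" using \<delta>1 \<delta>2(1) \<rho> by (auto simp: \<delta>_def)
  have f_pos: "0 < f (x, y)" if "\<bar>x\<bar> < \<delta>" "\<bar>y\<bar> \<le> r" "(x, y) \<noteq> (0, 0)" for x y
    using pos[OF that(3)] dist_Pair_le[of x y 0 0] that r \<delta> by simp
  have finite_zeros: "finite {y. fy (x, y) = 0}" if "\<bar>x\<bar> < \<delta>" for x
    unfolding fy_def
  proof (rule finite_zeros_on_vertical)
    show "plane_poly_fun (pderiv F) (x, r) \<noteq> 0" using \<delta>2(2)[of x] that \<delta> by (simp add: fy_def)
  qed
  define B where "B s = polar_branches (\<lambda>p. f (s * fst p, snd p)) (\<lambda>p. s * fx (s * fst p, snd p))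
      (\<lambda>p. fy (s * fst p, snd p)) r \<delta>" for s
  have one_side: "\<exists>n \<gamma>. B s n \<gamma>" if s: "s = 1 \<or> s = - 1" for s
  proof -
    have abs: "\<bar>s * x\<bar> = \<bar>x\<bar>" for x using s by (auto simp: abs_mult)
    have near: "0 < \<bar>s * x\<bar>" "\<bar>s * x\<bar> < \<delta>" if "x \<in> {0<..<\<delta>}" for x using that by (simp_all only: abs) auto
    interpret polar_half "\<lambda>p. f (s * fst p, snd p)" "\<lambda>p. s * fx (s * fst p, snd p)"
      "\<lambda>p. fy (s * fst p, snd p)" "\<lambda>p. s * fyx (s * fst p, snd p)" "\<lambda>p. fyy (s * fst p, snd p)"
      "\<lambda>p. plane_poly_fun g (s * fst p, snd p)" "\<lambda>p. plane_poly_fun h (s * fst p, snd p)" r \<delta>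
    proof
      show "0 < r" "0 < \<delta>" using r \<delta> by auto
      show "continuous_on UNIV (\<lambda>p. fyy (s * fst p, snd p))"
        "continuous_on UNIV (\<lambda>p. plane_poly_fun g (s * fst p, snd p))"
        "continuous_on UNIV (\<lambda>p. plane_poly_fun h (s * fst p, snd p))"
        using continuous_on_reflect[of _ 1 s] cont continuous_on_plane_poly_fun by auto
      show "fy (s * fst p, snd p) = plane_poly_fun g (s * fst p, snd p) * plane_poly_fun h (s * fst p, snd p)" for p
        unfolding fy_def gh by (rule plane_poly_fun_mult)
      show "plane_poly_fun g (s * fst p, snd p) = 0 \<Longrightarrow> s * fx (s * fst p, snd p) = 0" for p
        using g0 by simp
      show "f (s * fst (0, 0), snd (0, 0)) = 0" using f_zero by simp
      show "fy (s * fst (0, y), snd (0, y)) \<noteq> 0" if "y \<noteq> 0" "\<bar>y\<bar> \<le> r" for y using axis that by simp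
      show "fy (s * fst (x, - r), snd (x, - r)) < 0 \<and> 0 < fy (s * fst (x, r), snd (x, r))"
        if "x \<in> {0..<\<delta>}" for x
      proof -
        have "\<bar>s * x\<bar> < \<delta>2" unfolding abs using that \<delta> by auto
        then show ?thesis using \<delta>2(2) by simp
      qed
      fix x y y' assume x: "x \<in> {0<..<\<delta>}"
      show "0 < f (s * fst (x, y), snd (x, y))" if "\<bar>y\<bar> \<le> r"
        using f_pos[of "s * x" y] near[OF x] that by auto
      show "fyy (s * fst (x, y), snd (x, y)) \<noteq> 0" if "fy (s * fst (x, y), snd (x, y)) = 0"
        using simple[of "s * x" y] near[OF x] that \<delta> by simp
      show "s * fx (s * fst (x, y), snd (x, y)) \<noteq> 0" if "plane_poly_fun h (s * fst (x, y), snd (x, y)) = 0"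
        using h0[of "s * x" y] near[OF x] that \<delta> s by auto
      show "finite {y. fy (s * fst (x, y), snd (x, y)) = 0}"
        using finite_zeros[of "s * x"] near[OF x] by simp
      show "f (s * fst (x, y), snd (x, y)) \<noteq> f (s * fst (x, y'), snd (x, y'))"
        if "y \<noteq> y'" "fy (s * fst (x, y), snd (x, y)) = 0" "fy (s * fst (x, y'), snd (x, y')) = 0"
        using distinct that by simp
    qed (rule has_derivative_reflect[OF f_deriv] has_derivative_reflect[OF fy_deriv])+
    show ?thesis unfolding B_def using polar_branches by blast
  qed
  define n where "n s = (SOME n. \<exists>\<gamma>. B s n \<gamma>)" for s
  define \<gamma> where "\<gamma> s = (SOME \<gamma>. B s (n s) \<gamma>)" for s
  have branches: "B s (n s) (\<gamma> s)" if "s = 1 \<or> s = - 1" for s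
  proof -
    have "\<exists>\<gamma>. B s (n s) \<gamma>" unfolding n_def using one_side[OF that] by (rule someI_ex)
    then show ?thesis unfolding \<gamma>_def by (rule someI_ex)
  qed
  define d where "d = \<delta> / 2"
  have d: "0 < d" "d < \<delta>" using \<delta> by (auto simp: d_def)
  define K where "K = {p::real \<times> real. \<bar>fst p\<bar> \<le> d \<and> \<bar>snd p\<bar> \<le> r \<and> (\<bar>fst p\<bar> = d \<or> \<bar>snd p\<bar> = r)}"
  have "K = ({- d..d} \<times> {- r..r}) \<inter> ({p. \<bar>fst p\<bar> = d} \<union> {p. \<bar>snd p\<bar> = r})" by (auto simp: K_def)
  moreover have "compact ({- d..d} \<times> {- r..r} :: (real \<times> real) set)" by (intro compact_Times) auto
  moreover have "closed ({p::real \<times> real. \<bar>fst p\<bar> = d} \<union> {p. \<bar>snd p\<bar> = r})"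
    by (intro closed_Un closed_Collect_eq continuous_intros)
  ultimately have K: "compact K" "continuous_on K f"
    using continuous_on_subset[OF cont(1)] by (simp_all add: compact_Int_closed)
  have K_pos: "0 < f p" if "p \<in> K" for p
  proof -
    have "(fst p, snd p) \<noteq> (0, 0)" using that d r by (auto simp: K_def)
    then have "0 < f (fst p, snd p)" using that d by (intro f_pos) (auto simp: K_def)
    then show ?thesis by simp
  qed
  obtain c where c: "0 < c" "\<And>p. p \<in> K \<Longrightarrow> c \<le> f p"
    using minimum_off_compact[OF K K_pos] by blast
  interpret polar_box f fx fy fyx fyy r \<delta> d c n \<gamma>
  proof (rule polar_box.intro)
    show "0 \<le> f (x, y)" if "\<bar>x\<bar> \<le> d" "\<bar>y\<bar> \<le> r" for x y
      using f_pos[of x y] f_zero that d by (cases "(x, y) = (0, 0)") auto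
    show "c \<le> f (x, y)" if "\<bar>x\<bar> \<le> d" "\<bar>y\<bar> \<le> r" "\<bar>x\<bar> = d \<or> \<bar>y\<bar> = r" for x y
      using c(2)[of "(x, y)"] that by (simp add: K_def)
    show "fyy (x, y) \<noteq> 0" if "x \<noteq> 0" "\<bar>x\<bar> \<le> d" "fy (x, y) = 0" for x y
      using simple[of x y] that d \<delta> by auto
  qed (fact f_deriv fy_deriv cont r d c branches[unfolded B_def] f_zero axis)+
  show ?thesis by (rule asymptotic_tree)
qed

end
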